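(* Let $\overline M=M\cup\partial M$ be a smooth manifold with boundary, let $\nabla$ be a special torsion-free linear connection on $TM$ which is projectively pre-compact, and let $\sigma\in\Gamma(\mathcal E(1)|_M)$ be a non-zero density which is parallel for $\nabla$. For a local defining function $\rho:U\to\mathbb R$ for $\partial M$, the section $\nabla^\rho\nabla^\rho\sigma$ of $\otimes^2T^*M(1)$ (over $U\cap M$) is symmetric and admits a smooth extension to the boundary. Denoting its boundary value by $\Phi^\rho$, the value $\Phi^\rho(\xi,\eta)$ is independent of $\rho$ if at least one of the fields $\xi,\eta\in\Gamma(T\overline M|_{\partial M})$ lies in $\Gamma(T\partial M)$, so it is denoted by $\Phi(\xi,\eta)$ in this case. If $\xi\in\mathfrak X(\overline M)$ and $\eta\in\mathfrak X_\partial(\overline M)$, then $\Phi(\xi|_{\partial M},\eta|_{\partial M})$ is the boundary value of $$\Big(\frac{d\rho(\xi)d\rho(\eta)}{\rho}-d\rho(\nabla^\rho_\xi\eta)\Big)\sigma^\rho,\qquad \sigma^\rho:=\sigma/\rho .$$ If also $\xi\in\mathfrak X_\partial(\overline M)$, then the first summand vanishes along the boundary, so that $\Phi|_{T\partial M\times T\partial M}$ defines a canonical weighted second fundamental form for $\partial M$.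
   Context: Setting. $\overline M$ is a smooth manifold with boundary $\partial M$ and interior $M$, $\dim\overline M=n+1$. An object on $U\cap M$ ($U\subset\overline M$ open) "admits a smooth extension to the boundary" (is "smooth up to the boundary") if it is the restriction of a smooth object on $U$. A local defining function for $\partial M$ is a smooth $\rho:U\to\mathbb R$, $U\subset\overline M$ open, with $\rho^{-1}(0)=U\cap\partial M$ and $d\rho$ nowhere zero on $U\cap\partial M$. $\mathfrak X_\partial(U)\subset\mathfrak X(U)$ is the space of vector fields tangent to $\partial M$ along $U\cap\partial M$. Connections. A torsion-free linear connection on $TM$ is special if it preserves a (nowhere vanishing) volume density. For a one-form $\Upsilon$, $\nabla+\Upsilon$ denotes the connection $\nabla_\xi\eta+\Upsilon(\xi)\eta+\Upsilon(\eta)\xi$. Put $\nabla^\rho:=\nabla+\frac{d\rho}{\rho}$ on $U\cap M$; induced connections on density and tensor bundles are denoted by the same symbol, and $\nabla^\rho\nabla^\rho\sigma(\xi,\eta)=\nabla^\rho_\xi\nabla^\rho_\eta\sigma-\nabla^\rho_{\nabla^\rho_\xi\eta}\sigma$. A special $\nabla$ is projectively pre-compact (of order $1$) if for each $U$ and each local defining function $\rho:U\to\mathbb R$: (i) $d\rho(\nabla^\rho_\xi\eta)$ is smooth up to the boundary for all $\xi,\eta\in\mathfrak X(U)$; (ii) $\rho\nabla^\rho_\xi\eta$ is smooth up to the boundary for all $\xi,\eta\in\mathfrak X(U)$; (iii) $\nabla^\rho_\xi\eta$ is smooth up to the boundary if at least one of $\xi,\eta\in\mathfrak X(U)$ lies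 in $\mathfrak X_\partial(U)$. Densities. $\mathcal E(w)$ is the oriented line bundle of projective densities of weight $w$ on $\overline M$, normalized so that $\mathcal E(-n-2)$ is the bundle of volume densities; $B(w):=B\otimes\mathcal E(w)$. A non-zero parallel density is understood to be nowhere vanishing on $M$; it is unique up to a constant factor (on connected $M$). It extends by $0$ to $\overline M$ in such a way that $\sigma^\rho=\sigma/\rho$ extends to a smooth nowhere vanishing section of $\mathcal E(1)|_U$. Claims involving $\rho:U\to\mathbb R$ are over $U$. *)

theory Defs
  imports "HOL-Analysis.Analysis"
begin

section \<open>Smooth maps on subsets of Euclidean space\<close>

text \<open>Used on open sets: in finite dimension this is the usual class of k times continuously
  differentiable maps.\<close>

primrec Ck_on :: "nat \<Rightarrow> 'a::euclidean_space set \<Rightarrow> ('a \<Rightarrow> 'b::real_normed_vector) \<Rightarrow> bool" where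
  "Ck_on 0 S f \<longleftrightarrow> continuous_on S f"
| "Ck_on (Suc k) S f \<longleftrightarrow> (\<forall>x\<in>S. f differentiable (at x)) \<and>
     (\<forall>v. Ck_on k S (\<lambda>x. frechet_derivative f (at x) v))"

text \<open>On an arbitrary set, in particular on a relatively open subset of a half-space, smooth means:
  locally the restriction of a smooth map defined on an open set.\<close>

definition smooth_on :: "'a::euclidean_space set \<Rightarrow> ('a \<Rightarrow> 'b::real_normed_vector) \<Rightarrow> bool" where
  "smooth_on S f \<longleftrightarrow> (\<forall>x\<in>S. \<exists>V g. open V \<and> x \<in> V \<and> (\<forall>k. Ck_on k V g) \<and> (\<forall>y\<in>V \<inter> S. g y = f y))"


section \<open>Manifolds with boundary\<close>

text \<open>The manifold \<open>Mbar\<close> is the whole type \<open>'m\<close>, of dimension \<open>n + 1 = CARD('n)\<close>.  A chart consists of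
  its domain and a map into \<open>real ^ 'n\<close>; the model is the half-space of points whose \<open>k\<close>-th
  coordinate is non-negative, for a fixed index \<open>k\<close>.\<close>

type_synonym ('m, 'n) chart = "'m set \<times> ('m \<Rightarrow> real ^ 'n)"

definition half_space :: "'n::finite \<Rightarrow> (real ^ 'n) set" where
  "half_space k = {x. 0 \<le> x $ k}"

definition cinv :: "('m, 'n::finite) chart \<Rightarrow> real ^ 'n \<Rightarrow> 'm" where
  "cinv c = inv_into (fst c) (snd c)"

definition is_chart :: "'n::finite \<Rightarrow> ('m::topological_space, 'n) chart \<Rightarrow> bool" where
  "is_chart k c \<longleftrightarrow> open (fst c) \<and>
     openin (top_of_set (half_space k)) (snd c ` fst c) \<and>
     homeomorphism (fst c) (snd c ` fst c) (snd c) (cinv c)"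

definition smooth_atlas ::
  "'n::finite \<Rightarrow> ('m::{t2_space,second_countable_topology}, 'n) chart set \<Rightarrow> bool" where
  "smooth_atlas k A \<longleftrightarrow> (\<forall>c\<in>A. is_chart k c) \<and> (\<Union>c\<in>A. fst c) = UNIV \<and>
     (\<forall>c\<in>A. \<forall>d\<in>A. smooth_on (snd c ` (fst c \<inter> fst d)) (snd d \<circ> cinv c))"

definition bdry :: "'n::finite \<Rightarrow> ('m, 'n) chart set \<Rightarrow> 'm set" where
  "bdry k A = {p. \<exists>c\<in>A. p \<in> fst c \<and> snd c p $ k = 0}"

definition intr :: "'n::finite \<Rightarrow> ('m, 'n) chart set \<Rightarrow> 'm set" where
  "intr k A = - bdry k A"

text \<open>Derivative at \<open>p\<close> of the change of coordinates from \<open>c\<close> to \<open>d\<close>.  It is unique also at boundary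
  points, since relatively open subsets of a half-space are not locally contained in hyperplanes.\<close>

definition jac :: "('m, 'n::finite) chart \<Rightarrow> ('m, 'n) chart \<Rightarrow> 'm \<Rightarrow> real ^ 'n \<Rightarrow> real ^ 'n" where
  "jac c d p = frechet_derivative (snd d \<circ> cinv c) (at (snd c p) within snd c ` (fst c \<inter> fst d))"


section \<open>Functions, vector fields, densities\<close>

text \<open>An element of the fibre at \<open>p\<close> of a natural vector bundle is the family of its coordinate
  expressions in all the charts around \<open>p\<close>, subject to the transformation law of the bundle.  The
  value is normalised to be \<open>0\<close> on charts that are irrelevant, so that equality of fibre elements
  is equality of functions and the vector space operations are pointwise.\<close>

type_synonym ('m, 'n, 'b) fibre = "('m, 'n) chart \<Rightarrow> 'b"
type_synonym ('m, 'n) tvec = "('m, 'n, real ^ 'n) fibre"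
type_synonym ('m, 'n) dens = "('m, 'n, real) fibre"

definition fzero :: "('m, 'n, 'b::real_vector) fibre" where
  "fzero = (\<lambda>c. 0)"

definition fadd :: "('m, 'n, 'b::real_vector) fibre \<Rightarrow> ('m, 'n, 'b) fibre \<Rightarrow> ('m, 'n, 'b) fibre" where
  "fadd u v = (\<lambda>c. u c + v c)"

definition fscale :: "real \<Rightarrow> ('m, 'n, 'b::real_vector) fibre \<Rightarrow> ('m, 'n, 'b) fibre" where
  "fscale a v = (\<lambda>c. a *\<^sub>R v c)"

definition fibre_supp :: "('m, 'n) chart set \<Rightarrow> 'm \<Rightarrow> ('m, 'n, 'b::real_vector) fibre \<Rightarrow> bool" where
  "fibre_supp A p v \<longleftrightarrow> (\<forall>c. \<not> (c \<in> A \<and> p \<in> fst c) \<longrightarrow> v c = 0)"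

definition tangent_space :: "('m, 'n::finite) chart set \<Rightarrow> 'm \<Rightarrow> ('m, 'n) tvec set" where
  "tangent_space A p = {v. fibre_supp A p v \<and>
     (\<forall>c\<in>A. \<forall>d\<in>A. p \<in> fst c \<inter> fst d \<longrightarrow> v d = jac c d p (v c))}"

text \<open>The tangent space of the boundary at a boundary point, as a subspace of the tangent space of
  the manifold: in each chart the boundary is the hyperplane \<open>x $ k = 0\<close>.\<close>

definition bdry_tangent_space ::
  "'n::finite \<Rightarrow> ('m, 'n) chart set \<Rightarrow> 'm \<Rightarrow> ('m, 'n) tvec set" where
  "bdry_tangent_space k A p = {v \<in> tangent_space A p. \<forall>c\<in>A. p \<in> fst c \<longrightarrow> v c $ k = 0}"

text \<open>Projective densities of weight \<open>w\<close>; with \<open>n + 2 = CARD('n) + 1\<close>, the weight \<open>- (n + 2)\<close> gives the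
  volume densities, whose coordinate expressions are multiplied by the inverse of the absolute value
  of the Jacobian determinant.\<close>

definition dens_space :: "('m, 'n::finite) chart set \<Rightarrow> real \<Rightarrow> 'm \<Rightarrow> ('m, 'n) dens set" where
  "dens_space A w p = {s. fibre_supp A p s \<and>
     (\<forall>c\<in>A. \<forall>d\<in>A. p \<in> fst c \<inter> fst d \<longrightarrow>
        s d = \<bar>det (matrix (jac c d p))\<bar> powr (w / (real CARD('n) + 1)) * s c)}"

text \<open>Smoothness along an arbitrary subset \<open>S\<close>.  For open \<open>S\<close> this is smoothness up to the boundary
  points in \<open>S\<close>; for \<open>S\<close> relatively open in the boundary it is smoothness of sections along the
  boundary.\<close>

definition smooth_comps ::
  "('m, 'n::finite) chart set \<Rightarrow> 'm set \<Rightarrow> ('m \<Rightarrow> ('m, 'n, 'b::real_normed_vector) fibre) \<Rightarrow> bool" where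
  "smooth_comps A S s \<longleftrightarrow> (\<forall>c\<in>A. smooth_on (snd c ` (fst c \<inter> S)) (\<lambda>x. s (cinv c x) c))"

definition smooth_fun :: "('m, 'n::finite) chart set \<Rightarrow> 'm set \<Rightarrow> ('m \<Rightarrow> real) \<Rightarrow> bool" where
  "smooth_fun A S f \<longleftrightarrow> (\<forall>c\<in>A. smooth_on (snd c ` (fst c \<inter> S)) (f \<circ> cinv c))"

definition vfield :: "('m, 'n::finite) chart set \<Rightarrow> 'm set \<Rightarrow> ('m \<Rightarrow> ('m, 'n) tvec) \<Rightarrow> bool" where
  "vfield A S \<xi> \<longleftrightarrow> (\<forall>p\<in>S. \<xi> p \<in> tangent_space A p) \<and> smooth_comps A S \<xi>"

definition bdry_vfield ::
  "'n::finite \<Rightarrow> ('m, 'n) chart set \<Rightarrow> 'm set \<Rightarrow> ('m \<Rightarrow> ('m, 'n) tvec) \<Rightarrow> bool" where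
  "bdry_vfield k A U \<xi> \<longleftrightarrow> vfield A U \<xi> \<and> (\<forall>p\<in>U \<inter> bdry k A. \<xi> p \<in> bdry_tangent_space k A p)"

definition dens_section ::
  "('m, 'n::finite) chart set \<Rightarrow> real \<Rightarrow> 'm set \<Rightarrow> ('m \<Rightarrow> ('m, 'n) dens) \<Rightarrow> bool" where
  "dens_section A w S s \<longleftrightarrow> (\<forall>p\<in>S. s p \<in> dens_space A w p) \<and> smooth_comps A S s"

text \<open>Density-valued bilinear forms on a family \<open>F\<close> of subspaces of the tangent spaces, along \<open>S\<close>:
  for \<open>F\<close> the tangent spaces these are the smooth sections over \<open>S\<close> of the twofold tensor power of
  the cotangent bundle with weight \<open>w\<close>; for \<open>F\<close> the tangent spaces of the boundary and \<open>S\<close> the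
  boundary, the corresponding object on the boundary.\<close>

definition bilin_on ::
  "('m, 'n) tvec set \<Rightarrow> ('m, 'n) dens set \<Rightarrow>
     (('m, 'n::finite) tvec \<Rightarrow> ('m, 'n) tvec \<Rightarrow> ('m, 'n) dens) \<Rightarrow> bool" where
  "bilin_on T E b \<longleftrightarrow>
     (\<forall>u\<in>T. \<forall>v\<in>T. b u v \<in> E) \<and>
     (\<forall>u\<in>T. \<forall>u'\<in>T. \<forall>v\<in>T. b (fadd u u') v = fadd (b u v) (b u' v) \<and>
                            b v (fadd u u') = fadd (b v u) (b v u')) \<and>
     (\<forall>a. \<forall>u\<in>T. \<forall>v\<in>T. b (fscale a u) v = fscale a (b u v) \<and> b u (fscale a v) = fscale a (b u v))"

definition bilin_section ::
  "('m::topological_space, 'n::finite) chart set \<Rightarrow> real \<Rightarrow> ('m \<Rightarrow> ('m, 'n) tvec set) \<Rightarrow> 'm set \<Rightarrow>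
     ('m \<Rightarrow> ('m, 'n) tvec \<Rightarrow> ('m, 'n) tvec \<Rightarrow> ('m, 'n) dens) \<Rightarrow> bool" where
  "bilin_section A w F S b \<longleftrightarrow>
     (\<forall>p\<in>S. bilin_on (F p) (dens_space A w p) (b p)) \<and>
     (\<forall>V \<xi> \<eta>. open V \<longrightarrow> vfield A (V \<inter> S) \<xi> \<longrightarrow> vfield A (V \<inter> S) \<eta> \<longrightarrow>
        (\<forall>p\<in>V \<inter> S. \<xi> p \<in> F p \<and> \<eta> p \<in> F p) \<longrightarrow>
        dens_section A w (V \<inter> S) (\<lambda>p. b p (\<xi> p) (\<eta> p)))"

text \<open>The differential of a function, defined near \<open>p\<close>, on a tangent vector; by the chain rule the
  choice of chart is irrelevant.\<close>

definition diff_fun :: "('m, 'n::finite) chart set \<Rightarrow> ('m \<Rightarrow> real) \<Rightarrow> 'm \<Rightarrow> ('m, 'n) tvec \<Rightarrow> real" where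
  "diff_fun A f p v = (let c = (SOME c. c \<in> A \<and> p \<in> fst c) in
     frechet_derivative (f \<circ> cinv c) (at (snd c p) within snd c ` fst c) (v c))"

definition lie_bracket ::
  "('m, 'n::finite) chart set \<Rightarrow> ('m \<Rightarrow> ('m, 'n) tvec) \<Rightarrow> ('m \<Rightarrow> ('m, 'n) tvec) \<Rightarrow>
     'm \<Rightarrow> ('m, 'n) tvec" where
  "lie_bracket A \<xi> \<eta> p c = (if c \<in> A \<and> p \<in> fst c then
       frechet_derivative (\<lambda>x. \<eta> (cinv c x) c) (at (snd c p) within snd c ` fst c) (\<xi> p c)
     - frechet_derivative (\<lambda>x. \<xi> (cinv c x) c) (at (snd c p) within snd c ` fst c) (\<eta> p c)
     else 0)"


section \<open>Linear connections\<close>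

text \<open>A linear connection on the open set \<open>M\<close> is a covariant derivative acting on all vector fields on
  open subsets \<open>W\<close> of \<open>M\<close>, compatibly with restrictions.  Vector fields on \<open>W\<close> are total functions
  with irrelevant values outside \<open>W\<close>, and the second clause says that the covariant derivative on \<open>W\<close>
  depends on the restrictions to \<open>W\<close> only.\<close>

type_synonym ('m, 'n) conn =
  "('m \<Rightarrow> ('m, 'n) tvec) \<Rightarrow> ('m \<Rightarrow> ('m, 'n) tvec) \<Rightarrow> 'm \<Rightarrow> ('m, 'n) tvec"

definition linear_connection ::
  "('m::topological_space, 'n::finite) chart set \<Rightarrow> 'm set \<Rightarrow> ('m, 'n) conn \<Rightarrow> bool" where
  "linear_connection A M D \<longleftrightarrow> (\<forall>W. open W \<longrightarrow> W \<subseteq> M \<longrightarrow>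
     (\<forall>\<xi> \<eta>. vfield A W \<xi> \<longrightarrow> vfield A W \<eta> \<longrightarrow> vfield A W (D \<xi> \<eta>)) \<and>
     (\<forall>\<xi> \<xi>' \<eta> \<eta>'. vfield A W \<xi> \<longrightarrow> vfield A W \<xi>' \<longrightarrow> vfield A W \<eta> \<longrightarrow> vfield A W \<eta>' \<longrightarrow>
        (\<forall>p\<in>W. \<xi> p = \<xi>' p \<and> \<eta> p = \<eta>' p) \<longrightarrow> (\<forall>p\<in>W. D \<xi> \<eta> p = D \<xi>' \<eta>' p)) \<and>
     (\<forall>\<xi> \<xi>' \<eta>. vfield A W \<xi> \<longrightarrow> vfield A W \<xi>' \<longrightarrow> vfield A W \<eta> \<longrightarrow>
        (\<forall>p\<in>W. D (\<lambda>q. fadd (\<xi> q) (\<xi>' q)) \<eta> p = fadd (D \<xi> \<eta> p) (D \<xi>' \<eta> p)) \<and>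
        (\<forall>p\<in>W. D \<eta> (\<lambda>q. fadd (\<xi> q) (\<xi>' q)) p = fadd (D \<eta> \<xi> p) (D \<eta> \<xi>' p))) \<and>
     (\<forall>f \<xi> \<eta>. smooth_fun A W f \<longrightarrow> vfield A W \<xi> \<longrightarrow> vfield A W \<eta> \<longrightarrow>
        (\<forall>p\<in>W. D (\<lambda>q. fscale (f q) (\<xi> q)) \<eta> p = fscale (f p) (D \<xi> \<eta> p)) \<and>
        (\<forall>p\<in>W. D \<xi> (\<lambda>q. fscale (f q) (\<eta> q)) p =
           fadd (fscale (diff_fun A f p (\<xi> p)) (\<eta> p)) (fscale (f p) (D \<xi> \<eta> p)))))"

definition torsion_free ::
  "('m::topological_space, 'n::finite) chart set \<Rightarrow> 'm set \<Rightarrow> ('m, 'n) conn \<Rightarrow> bool" where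
  "torsion_free A M D \<longleftrightarrow> (\<forall>W \<xi> \<eta>. open W \<longrightarrow> W \<subseteq> M \<longrightarrow> vfield A W \<xi> \<longrightarrow> vfield A W \<eta> \<longrightarrow>
     (\<forall>p\<in>W. fadd (D \<xi> \<eta> p) (fscale (- 1) (D \<eta> \<xi> p)) = lie_bracket A \<xi> \<eta> p))"

definition coord_field :: "('m, 'n::finite) chart set \<Rightarrow> ('m, 'n) chart \<Rightarrow> 'n \<Rightarrow> 'm \<Rightarrow> ('m, 'n) tvec" where
  "coord_field A c j p d = (if d \<in> A \<and> p \<in> fst c \<inter> fst d then jac c d p (axis j 1) else 0)"

text \<open>The connection induced on densities of weight \<open>w\<close>.  On volume densities \<open>\<mu>\<close> it is obtained from the
  Leibniz rule for \<open>\<mu>\<close> evaluated on the coordinate frame, which gives the derivative of the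
  coordinate expression minus the trace of the connection form times it; the bundle of weight \<open>w\<close> is the
  power \<open>- w / (n + 2)\<close> of the bundle of volume densities.\<close>

definition dens_conn ::
  "('m, 'n::finite) chart set \<Rightarrow> real \<Rightarrow> ('m, 'n) conn \<Rightarrow>
     ('m \<Rightarrow> ('m, 'n) tvec) \<Rightarrow> ('m \<Rightarrow> ('m, 'n) dens) \<Rightarrow> 'm \<Rightarrow> ('m, 'n) dens" where
  "dens_conn A w D \<xi> s p c = (if c \<in> A \<and> p \<in> fst c then
       frechet_derivative (\<lambda>x. s (cinv c x) c) (at (snd c p) within snd c ` fst c) (\<xi> p c)
     + w / (real CARD('n) + 1) * (\<Sum>j\<in>UNIV. D \<xi> (coord_field A c j) p c $ j) * s p c
     else 0)"

definition parallel_dens ::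
  "('m::topological_space, 'n::finite) chart set \<Rightarrow> 'm set \<Rightarrow> real \<Rightarrow> ('m, 'n) conn \<Rightarrow>
     ('m \<Rightarrow> ('m, 'n) dens) \<Rightarrow> bool" where
  "parallel_dens A M w D s \<longleftrightarrow> dens_section A w M s \<and>
     (\<forall>W \<xi>. open W \<longrightarrow> W \<subseteq> M \<longrightarrow> vfield A W \<xi> \<longrightarrow> (\<forall>p\<in>W. dens_conn A w D \<xi> s p = fzero))"

definition nonvanishing :: "'m set \<Rightarrow> ('m \<Rightarrow> ('m, 'n) dens) \<Rightarrow> bool" where
  "nonvanishing S s \<longleftrightarrow> (\<forall>p\<in>S. s p \<noteq> fzero)"

definition special_connection ::
  "('m::topological_space, 'n::finite) chart set \<Rightarrow> 'm set \<Rightarrow> ('m, 'n) conn \<Rightarrow> bool" where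
  "special_connection A M D \<longleftrightarrow> (\<exists>\<mu>. nonvanishing M \<mu> \<and>
     parallel_dens A M (- (real CARD('n) + 1)) D \<mu>)"


section \<open>Projective pre-compactness\<close>

definition defining_fun ::
  "'n::finite \<Rightarrow> ('m::topological_space, 'n) chart set \<Rightarrow> 'm set \<Rightarrow> ('m \<Rightarrow> real) \<Rightarrow> bool" where
  "defining_fun k A U \<rho> \<longleftrightarrow> open U \<and> smooth_fun A U \<rho> \<and> {p \<in> U. \<rho> p = 0} = U \<inter> bdry k A \<and>
     (\<forall>p\<in>U \<inter> bdry k A. \<exists>v\<in>tangent_space A p. diff_fun A \<rho> p v \<noteq> 0)"

definition proj_change :: "('m \<Rightarrow> ('m, 'n::finite) tvec \<Rightarrow> real) \<Rightarrow> ('m, 'n) conn \<Rightarrow> ('m, 'n) conn" where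
  "proj_change \<Upsilon> D \<xi> \<eta> p =
     fadd (D \<xi> \<eta> p) (fadd (fscale (\<Upsilon> p (\<xi> p)) (\<eta> p)) (fscale (\<Upsilon> p (\<eta> p)) (\<xi> p)))"

definition rho_conn :: "('m, 'n::finite) chart set \<Rightarrow> ('m, 'n) conn \<Rightarrow> ('m \<Rightarrow> real) \<Rightarrow> ('m, 'n) conn" where
  "rho_conn A D \<rho> = proj_change (\<lambda>p v. diff_fun A \<rho> p v / \<rho> p) D"

definition fun_boundary_value ::
  "'n::finite \<Rightarrow> ('m, 'n) chart set \<Rightarrow> 'm set \<Rightarrow> ('m \<Rightarrow> real) \<Rightarrow> ('m \<Rightarrow> real) \<Rightarrow> bool" where
  "fun_boundary_value k A U f b \<longleftrightarrow> (\<exists>g. smooth_fun A U g \<and>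
     (\<forall>p\<in>U \<inter> intr k A. g p = f p) \<and> (\<forall>p\<in>U \<inter> bdry k A. g p = b p))"

definition dens_boundary_value ::
  "'n::finite \<Rightarrow> ('m, 'n) chart set \<Rightarrow> real \<Rightarrow> 'm set \<Rightarrow> ('m \<Rightarrow> ('m, 'n) dens) \<Rightarrow>
     ('m \<Rightarrow> ('m, 'n) dens) \<Rightarrow> bool" where
  "dens_boundary_value k A w U s b \<longleftrightarrow> (\<exists>t. dens_section A w U t \<and>
     (\<forall>p\<in>U \<inter> intr k A. t p = s p) \<and> (\<forall>p\<in>U \<inter> bdry k A. t p = b p))"

definition fun_extends ::
  "'n::finite \<Rightarrow> ('m, 'n) chart set \<Rightarrow> 'm set \<Rightarrow> ('m \<Rightarrow> real) \<Rightarrow> bool" where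
  "fun_extends k A U f \<longleftrightarrow> (\<exists>g. smooth_fun A U g \<and> (\<forall>p\<in>U \<inter> intr k A. g p = f p))"

definition vfield_extends ::
  "'n::finite \<Rightarrow> ('m, 'n) chart set \<Rightarrow> 'm set \<Rightarrow> ('m \<Rightarrow> ('m, 'n) tvec) \<Rightarrow> bool" where
  "vfield_extends k A U \<zeta> \<longleftrightarrow> (\<exists>\<theta>. vfield A U \<theta> \<and> (\<forall>p\<in>U \<inter> intr k A. \<theta> p = \<zeta> p))"

definition precompact ::
  "'n::finite \<Rightarrow> ('m::topological_space, 'n) chart set \<Rightarrow> ('m, 'n) conn \<Rightarrow> bool" where
  "precompact k A D \<longleftrightarrow> (\<forall>U \<rho> \<xi> \<eta>. defining_fun k A U \<rho> \<longrightarrow> vfield A U \<xi> \<longrightarrow> vfield A U \<eta> \<longrightarrow>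
     fun_extends k A U (\<lambda>p. diff_fun A \<rho> p (rho_conn A D \<rho> \<xi> \<eta> p)) \<and>
     vfield_extends k A U (\<lambda>p. fscale (\<rho> p) (rho_conn A D \<rho> \<xi> \<eta> p)) \<and>
     (bdry_vfield k A U \<xi> \<or> bdry_vfield k A U \<eta> \<longrightarrow> vfield_extends k A U (rho_conn A D \<rho> \<xi> \<eta>)))"

definition second_deriv ::
  "('m, 'n::finite) chart set \<Rightarrow> real \<Rightarrow> ('m, 'n) conn \<Rightarrow> ('m \<Rightarrow> ('m, 'n) dens) \<Rightarrow>
     ('m \<Rightarrow> ('m, 'n) tvec) \<Rightarrow> ('m \<Rightarrow> ('m, 'n) tvec) \<Rightarrow> 'm \<Rightarrow> ('m, 'n) dens" where
  "second_deriv A w D s \<xi> \<eta> p =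
     fadd (dens_conn A w D \<xi> (dens_conn A w D \<eta> s) p)
          (fscale (- 1) (dens_conn A w D (D \<xi> \<eta>) s p))"

text \<open>\<open>b\<close> is a section over \<open>M\<close> of the twofold tensor power of the cotangent bundle with weight \<open>w\<close>
  whose value on any two vector fields on an open subset is the second covariant derivative.\<close>

definition is_second_deriv ::
  "('m::topological_space, 'n::finite) chart set \<Rightarrow> 'm set \<Rightarrow> real \<Rightarrow> ('m, 'n) conn \<Rightarrow>
     ('m \<Rightarrow> ('m, 'n) dens) \<Rightarrow> ('m \<Rightarrow> ('m, 'n) tvec \<Rightarrow> ('m, 'n) tvec \<Rightarrow> ('m, 'n) dens) \<Rightarrow> bool" where
  "is_second_deriv A M w D s b \<longleftrightarrow> bilin_section A w (tangent_space A) M b \<and>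
     (\<forall>W \<xi> \<eta>. open W \<longrightarrow> W \<subseteq> M \<longrightarrow> vfield A W \<xi> \<longrightarrow> vfield A W \<eta> \<longrightarrow>
        (\<forall>p\<in>W. b p (\<xi> p) (\<eta> p) = second_deriv A w D s \<xi> \<eta> p))"

text \<open>\<open>b\<close> is a smooth section over \<open>U\<close> whose restriction to the interior is the second covariant
  derivative of \<open>\<sigma>\<close> with respect to the connection modified by \<open>\<rho>\<close>; its restriction to the boundary
  is the boundary value.\<close>

definition second_deriv_ext ::
  "'n::finite \<Rightarrow> ('m::topological_space, 'n) chart set \<Rightarrow> ('m, 'n) conn \<Rightarrow> ('m \<Rightarrow> ('m, 'n) dens) \<Rightarrow>
     'm set \<Rightarrow> ('m \<Rightarrow> real) \<Rightarrow> ('m \<Rightarrow> ('m, 'n) tvec \<Rightarrow> ('m, 'n) tvec \<Rightarrow> ('m, 'n) dens) \<Rightarrow> bool" where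
  "second_deriv_ext k A D \<sigma> U \<rho> b \<longleftrightarrow> bilin_section A 1 (tangent_space A) U b \<and>
     is_second_deriv A (U \<inter> intr k A) 1 (rho_conn A D \<rho>) \<sigma> b"

definition symmetric_on ::
  "('m \<Rightarrow> ('m, 'n) tvec set) \<Rightarrow> 'm set \<Rightarrow>
     ('m \<Rightarrow> ('m, 'n) tvec \<Rightarrow> ('m, 'n) tvec \<Rightarrow> ('m, 'n) dens) \<Rightarrow> bool" where
  "symmetric_on F S b \<longleftrightarrow> (\<forall>p\<in>S. \<forall>u\<in>F p. \<forall>v\<in>F p. b p u v = b p v u)"

end

theory Submission
  imports Defs
begin

text \<open>
  Write \<open>\<sigma> = \<rho> (\<sigma> / \<rho>)\<close>.  Since \<open>\<sigma>\<close> is parallel for \<open>\<nabla>\<close> and has weight one, \<open>\<sigma> / \<rho>\<close> is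
  parallel for the modified connection, and therefore the second derivative of \<open>\<sigma>\<close> is
  \<open>(\<xi> (d\<rho> \<eta>) - d\<rho> (\<nabla>\<^sup>\<rho> \<xi> \<eta>)) \<sigma> / \<rho>\<close> (lemma \<open>second_deriv_sigma\<close>).  This is tensorial, and it is symmetric because
  second derivatives of functions commute and the connection has no torsion.

  The boundary behaviour is studied in a chart, with its boundary coordinate \<open>x\<close> as a reference defining
  function.  Pre-compactness says which components of the Christoffel symbols of the connection modified by
  \<open>x\<close> extend smoothly.  In particular their trace does, and this trace is, up to a constant factor, the
  logarithmic derivative of \<open>\<sigma> / x\<close>; solving the resulting linear equation along segments shows that \<open>\<sigma> / x\<close> is
  smooth up to the boundary (lemma \<open>sigma_factor\<close>).  Any other defining function is \<open>\<rho> = x h\<close> with \<open>h\<close> nowhere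
  zero, by Hadamard's lemma, and passing from \<open>x\<close> to \<open>\<rho>\<close> changes the coefficients of the second derivative by
  terms in the derivatives of \<open>h\<close> in which all poles cancel.  What remains has a factor \<open>x\<close>, except for the
  derivative of \<open>h\<close> along \<open>x\<close> times the modified Christoffel symbol.  That term is smooth, and it vanishes on
  the boundary whenever one of the two arguments is tangential.  This gives at once the smooth extension for
  every \<open>\<rho>\<close> and the independence of its boundary value (lemmas \<open>hess_coeff_extends\<close>, \<open>second_deriv_ext_exists\<close>
  and \<open>second_deriv_ext_unique\<close>).

  If \<open>\<eta>\<close> is tangential along the boundary, then \<open>d\<rho> \<eta>\<close> is \<open>\<rho>\<close> times a smooth function \<open>g\<close>, so
  \<open>\<xi> (d\<rho> \<eta>) = (d\<rho> \<xi>) g + \<rho> (\<xi> g)\<close> and \<open>d\<rho> \<xi> d\<rho> \<eta> / \<rho> = (d\<rho> \<xi>) g\<close> agree on the boundary; this is the formula for the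
  boundary value (lemma \<open>boundary_value_mixed\<close>).  If \<open>\<xi>\<close> is tangential as well, \<open>(d\<rho> \<xi>) g\<close> vanishes there too.

  Geometric objects are given by their components in all charts, and identities between them, such as
  transformation laws, reach the boundary from the interior by continuity.
\<close>

section \<open>Continuously differentiable maps\<close>

lemma Ck_on_cong:
  assumes "open S" "Ck_on k S f" "\<And>x. x \<in> S \<Longrightarrow> f x = g x"
  shows "Ck_on k S g"
  using assms(2,3)
proof (induction k arbitrary: f g)
  case 0
  then show ?case by (simp cong: continuous_on_cong)
next
  case (Suc k)
  have d: "g differentiable (at x)" if "x \<in> S" for x
    using Suc.prems that assms(1)
    by (metis Ck_on.simps(2) differentiable_def has_derivative_transform_within_open)
  have e: "frechet_derivative f (at x) = frechet_derivative g (at x)" if "x \<in> S" for x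
    using Suc.prems that assms(1) by (auto intro: frechet_derivative_transform_within_open)
  show ?case
    using Suc.IH[of "\<lambda>x. frechet_derivative f (at x) v" "\<lambda>x. frechet_derivative g (at x) v" for v]
      Suc.prems e d by auto
qed

text \<open>It suffices to exhibit some derivative; the canonical one equals it by uniqueness.\<close>

lemma Ck_on_SucI:
  assumes "open S" "\<And>x. x \<in> S \<Longrightarrow> (f has_derivative f' x) (at x)"
    and "\<And>v. Ck_on k S (\<lambda>x. f' x v)"
  shows "Ck_on (Suc k) S f"
proof -
  have "frechet_derivative f (at x) = f' x" if "x \<in> S" for x
    using assms(2)[OF that] frechet_derivative_at by metis
  then show ?thesis
    using assms by (auto simp: differentiable_def intro: Ck_on_cong[OF assms(1) assms(3)])
qed

lemma Ck_on_has_derivative: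
  "Ck_on (Suc k) S f \<Longrightarrow> x \<in> S \<Longrightarrow> (f has_derivative frechet_derivative f (at x)) (at x)"
  by (simp add: frechet_derivative_works)

lemma Ck_on_SucD: "Ck_on (Suc k) S f \<Longrightarrow> Ck_on k S f"
proof (induction k arbitrary: f)
  case 0
  then show ?case
    by (auto intro!: continuous_at_imp_continuous_on differentiable_imp_continuous_within)
qed auto

lemma Ck_on_continuous: "Ck_on k S f \<Longrightarrow> continuous_on S f"
proof (induction k)
  case (Suc k)
  show ?case by (rule Suc.IH[OF Ck_on_SucD[OF Suc.prems]])
qed simp

lemma Ck_on_subset: "Ck_on k S f \<Longrightarrow> T \<subseteq> S \<Longrightarrow> Ck_on k T f"
  by (induction k arbitrary: f) (auto intro: continuous_on_subset)

lemma Ck_on_const: "Ck_on k S (\<lambda>x. c)"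
  by (induction k arbitrary: c) (auto simp: frechet_derivative_const)

lemma Ck_on_bounded_linear:
  assumes "open S" "bounded_linear f"
  shows "Ck_on k S f"
proof (cases k)
  case 0
  then show ?thesis using assms by (simp add: linear_continuous_on)
next
  case (Suc m)
  show ?thesis
    unfolding Suc using assms
    by (intro Ck_on_SucI[where f' = "\<lambda>_. f"] Ck_on_const bounded_linear_imp_has_derivative)
qed

lemma Ck_on_add:
  assumes "open S"
  shows "Ck_on k S f \<Longrightarrow> Ck_on k S g \<Longrightarrow> Ck_on k S (\<lambda>x. f x + g x)"
proof (induction k arbitrary: f g)
  case (Suc k)
  show ?case
    by (rule Ck_on_SucI[OF assms has_derivative_add[OF
            Ck_on_has_derivative[OF Suc.prems(1)] Ck_on_has_derivative[OF Suc.prems(2)]]])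
       (use Suc in auto)
qed (auto intro: continuous_intros)

lemma Ck_on_sum:
  assumes "open S" "\<And>i. i \<in> I \<Longrightarrow> Ck_on k S (f i)"
  shows "Ck_on k S (\<lambda>x. \<Sum>i\<in>I. f i x)"
  using assms(2)
proof (induction I rule: infinite_finite_induct)
  case (insert i I)
  then show ?case by (simp add: Ck_on_add[OF assms(1)])
qed (simp_all add: Ck_on_const)

lemma Ck_on_scaleR:
  assumes "open S"
  shows "Ck_on k S f \<Longrightarrow> Ck_on k S g \<Longrightarrow> Ck_on k S (\<lambda>x. f x *\<^sub>R g x)"
proof (induction k arbitrary: f g)
  case (Suc k)
  show ?case
    by (rule Ck_on_SucI[OF assms has_derivative_scaleR[OF
            Ck_on_has_derivative[OF Suc.prems(1)] Ck_on_has_derivative[OF Suc.prems(2)]]])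
       (use Suc Ck_on_SucD[OF Suc.prems(1)] Ck_on_SucD[OF Suc.prems(2)] in 
          \<open>auto intro!: Ck_on_add[OF assms]\<close>)
qed (auto intro: continuous_intros)

lemma Ck_on_linear_comp:
  assumes "open S" "bounded_linear l"
  shows "Ck_on k S f \<Longrightarrow> Ck_on k S (\<lambda>x. l (f x))"
proof (induction k arbitrary: f)
  case 0
  then show ?case using assms by (simp add: bounded_linear.continuous_on)
next
  case (Suc k)
  show ?case
    by (rule Ck_on_SucI[OF assms(1) bounded_linear.has_derivative[OF assms(2)
              Ck_on_has_derivative[OF Suc.prems]]])
       (use Suc in auto)
qed

text \<open>Induction on the order: the chain rule expresses the derivative of the composite in the standard basis
  as a sum of products of a derivative of the inner map with a partial derivative of the outer map, and
  both factors are of one order less.\<close>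

lemma Ck_on_compose:
  assumes "open S" "open T"
  shows "Ck_on k S f \<Longrightarrow> Ck_on k T g \<Longrightarrow> f ` S \<subseteq> T \<Longrightarrow> Ck_on k S (\<lambda>x. g (f x))"
proof (induction k arbitrary: g)
  case 0
  then show ?case by (auto intro: continuous_on_compose2)
next
  case (Suc k)
  let ?g' = "\<lambda>y. frechet_derivative g (at y)"
  let ?f' = "\<lambda>x. frechet_derivative f (at x)"
  have comp: "((\<lambda>x. g (f x)) has_derivative (\<lambda>v. ?g' (f x) (?f' x v))) (at x)" if "x \<in> S" for x
    using has_derivative_compose[OF Ck_on_has_derivative[OF Suc.prems(1) that]
        Ck_on_has_derivative[OF Suc.prems(2)]] that Suc.prems(3) by auto
  have eq: "?g' (f x) (?f' x v) = (\<Sum>i\<in>Basis. (?f' x v \<bullet> i) *\<^sub>R ?g' (f x) i)" if "x \<in> S" for x v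
  proof -
    have "f x \<in> T" using that Suc.prems(3) by auto
    then have "linear (?g' (f x))"
      using Ck_on_has_derivative[OF Suc.prems(2)] has_derivative_linear by blast
    then have "?g' (f x) (\<Sum>i\<in>Basis. (?f' x v \<bullet> i) *\<^sub>R i) =
        (\<Sum>i\<in>Basis. (?f' x v \<bullet> i) *\<^sub>R ?g' (f x) i)"
      by (simp add: linear_sum linear_cmul)
    then show ?thesis by (simp add: euclidean_representation)
  qed
  have "Ck_on k S (\<lambda>x. \<Sum>i\<in>Basis. (?f' x v \<bullet> i) *\<^sub>R ?g' (f x) i)" for v
  proof (intro Ck_on_sum Ck_on_scaleR assms)
    fix i :: 'b
    assume "i \<in> Basis"
    show "Ck_on k S (\<lambda>x. ?f' x v \<bullet> i)"
      by (rule Ck_on_linear_comp[OF assms(1) bounded_linear_inner_left])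
        (use Suc.prems(1) in simp)
    show "Ck_on k S (\<lambda>x. ?g' (f x) i)"
      using Suc.IH[of "\<lambda>y. ?g' y i"] Suc.prems Ck_on_SucD[OF Suc.prems(1)] by auto
  qed
  then have "Ck_on k S (\<lambda>x. ?g' (f x) (?f' x v))" for v
    by (rule Ck_on_cong[OF assms(1)]) (simp add: eq)
  then show ?case
    by (intro Ck_on_SucI[OF assms(1) comp])
qed

lemma Ck_on_inverse:
  fixes f :: "'a::euclidean_space \<Rightarrow> real"
  assumes "open S" "\<And>x. x \<in> S \<Longrightarrow> f x \<noteq> 0"
  shows "Ck_on k S f \<Longrightarrow> Ck_on k S (\<lambda>x. inverse (f x))"
proof (induction k)
  case 0
  then show ?case using assms by (auto intro!: continuous_intros)
next
  case (Suc k)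
  show ?case
  proof (rule Ck_on_SucI[OF assms(1)])
    show "((\<lambda>x. inverse (f x)) has_derivative
        (\<lambda>v. - inverse (f x) *\<^sub>R (inverse (f x) *\<^sub>R frechet_derivative f (at x) v))) (at x)"
      if "x \<in> S" for x
      using Deriv.has_derivative_inverse[OF assms(2)[OF that] Ck_on_has_derivative[OF Suc.prems that]]
      by (simp add: mult_ac)
    have "Ck_on k S (\<lambda>x. (-1) *\<^sub>R inverse (f x))"
      by (intro Ck_on_scaleR assms Ck_on_const Suc.IH Ck_on_SucD[OF Suc.prems])
    then have m: "Ck_on k S (\<lambda>x. - inverse (f x))" by simp
    show "Ck_on k S (\<lambda>x. - inverse (f x) *\<^sub>R (inverse (f x) *\<^sub>R frechet_derivative f (at x) v))" for v
      using Suc.IH[OF Ck_on_SucD[OF Suc.prems]] Suc.prems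
      by (intro Ck_on_scaleR assms m) auto
  qed
qed

lemma Ck_on_exp:
  fixes f :: "'a::euclidean_space \<Rightarrow> real"
  assumes "open S"
  shows "Ck_on k S f \<Longrightarrow> Ck_on k S (\<lambda>x. exp (f x))"
proof (induction k)
  case 0
  then show ?case using assms by (auto intro!: continuous_intros)
next
  case (Suc k)
  show ?case
  proof (rule Ck_on_SucI[OF assms(1)])
    show "((\<lambda>x. exp (f x)) has_derivative
        (\<lambda>v. exp (f x) *\<^sub>R frechet_derivative f (at x) v)) (at x)"
      if "x \<in> S" for x
      using has_derivative_exp[OF Ck_on_has_derivative[OF Suc.prems that]]
      by (simp add: mult_ac)
    show "Ck_on k S (\<lambda>x. exp (f x) *\<^sub>R frechet_derivative f (at x) v)" for v
      using Suc.IH[OF Ck_on_SucD[OF Suc.prems]] Suc.prems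
      by (intro Ck_on_scaleR assms) auto
  qed
qed

lemma Ck_on_deriv: "(\<And>k. Ck_on k S f) \<Longrightarrow> Ck_on k S (\<lambda>x. frechet_derivative f (at x) v)"
  using Ck_on.simps(2) by blast

text \<open>Differentiation under the integral sign, iterated.  The integrand is a function on an open subset of
  the product, so that its derivative in the parameter is again an integrand of the same kind.\<close>

lemma Ck_on_integral:
  fixes f :: "'a::euclidean_space \<times> real \<Rightarrow> real"
  assumes "open S" "open V" "S \<times> {0..1} \<subseteq> V"
  shows "Ck_on k V f \<Longrightarrow> Ck_on k S (\<lambda>x. integral {0..1} (\<lambda>t. f (x, t)))"
proof (induction k arbitrary: f)
  case 0
  have "continuous_on (S \<times> cbox 0 1) (\<lambda>(x, t). f (x, t))"
    using 0 assms(3) by (auto intro: continuous_on_subset simp: split_def)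
  from integral_continuous_on_param[OF this] show ?case by simp
next
  case (Suc k)
  let ?f' = "\<lambda>z. frechet_derivative f (at z)"
  have f': "(f has_derivative ?f' z) (at z)" if "z \<in> V" for z
    using Ck_on_has_derivative[OF Suc.prems that] .
  have cf': "continuous_on V (\<lambda>z. ?f' z w)" for w
  proof -
    have "Ck_on k V (\<lambda>z. ?f' z w)" using Suc.prems by (simp only: Ck_on.simps)
    then show ?thesis by (rule Ck_on_continuous)
  qed
  have cf: "continuous_on V f" 
    using f' by (meson continuous_at_imp_continuous_on has_derivative_continuous)
  have bl: "bounded_linear (\<lambda>v. ?f' z (v, 0))" if "z \<in> V" for z
    using bounded_linear_compose[OF has_derivative_bounded_linear[OF f'[OF that]]
        bounded_linear_Pair[OF bounded_linear_ident bounded_linear_zero]] by simp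
  define F where "F x t = Blinfun (\<lambda>v. ?f' (x, t) (v, 0))" for x t
  have F: "blinfun_apply (F x t) = (\<lambda>v. ?f' (x, t) (v, 0))" if "(x, t) \<in> V" for x t
    unfolding F_def using bl[OF that] by (simp add: bounded_linear_Blinfun_apply)
  have Fc: "continuous_on (S \<times> cbox 0 1) (\<lambda>(x, t). F x t)"
  proof (rule continuous_on_blinfun_componentwise)
    fix i :: 'a
    have "continuous_on (S \<times> cbox 0 1) (\<lambda>z. ?f' z (i, 0))"
      using cf' assms(3) by (auto intro: continuous_on_subset)
    then show "continuous_on (S \<times> cbox 0 1) (\<lambda>z. blinfun_apply (case z of (x, t) \<Rightarrow> F x t) i)"
      by (rule continuous_on_eq) (use F assms(3) in auto)
  qed
  have int: "(\<lambda>t. f (x, t)) integrable_on cbox 0 1" if "x \<in> S" for x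
  proof (rule integrable_continuous)
    show "continuous_on (cbox 0 1) (\<lambda>t. f (x, t))"
      using that assms(3)
      by (intro continuous_on_compose2[OF cf]) (auto intro!: continuous_intros)
  qed
  have main: "((\<lambda>x. integral {0..1} (\<lambda>t. f (x, t))) has_derivative
      (\<lambda>v. integral {0..1} (\<lambda>t. ?f' (x, t) (v, 0)))) (at x)" if x: "x \<in> S" for x
  proof -
    obtain e where e: "e > 0" "ball x e \<subseteq> S" 
      using openE[OF assms(1) x] by metis
    have "((\<lambda>x. integral (cbox 0 1) (\<lambda>t. f (x, t))) has_derivative
        blinfun_apply (integral (cbox 0 1) (F x))) (at x within ball x e)"
    proof (rule leibniz_rule[where f = "\<lambda>x t. f (x, t)" and fx = F])
      show "((\<lambda>x. f (x, t)) has_derivative blinfun_apply (F y t)) (at y within ball x e)"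
        if "y \<in> ball x e" "t \<in> cbox 0 1" for y t
      proof -
        have "(y, t) \<in> S \<times> {0..1}" using that e by auto
        then have yt: "(y, t) \<in> V" using assms(3) by blast
        have "((\<lambda>x. f (x, t)) has_derivative (\<lambda>v. ?f' (y, t) (v, 0))) (at y)"
          by (rule has_derivative_compose[where f = "\<lambda>x. (x, t)" and g = f, OF _ f'[OF yt]])
            (intro has_derivative_Pair has_derivative_ident has_derivative_const)
        then show ?thesis using F[OF yt] by (simp add: has_derivative_at_withinI)
      qed
      show "continuous_on (ball x e \<times> cbox 0 1) (\<lambda>(x, t). F x t)"
        by (rule continuous_on_subset[OF Fc]) (use e in auto)
    qed (use e int in auto)
    moreover have "at x within ball x e = at x" using e by (intro at_within_open) auto
    moreover have "blinfun_apply (integral (cbox 0 1) (F x)) =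
        (\<lambda>v. integral {0..1} (\<lambda>t. ?f' (x, t) (v, 0)))"
    proof
      fix v
        have "continuous_on (cbox 0 1) (F x)"
        proof -
          have "continuous_on (cbox 0 1) (\<lambda>t::real. (x, t))" by (intro continuous_intros)
          moreover have "(\<lambda>t. (x, t)) ` cbox 0 1 \<subseteq> S \<times> cbox 0 1" using x by blast
          ultimately show ?thesis using continuous_on_compose2[OF Fc] by fastforce
        qed
        then have "F x integrable_on cbox 0 1" by (rule integrable_continuous)
        then have "blinfun_apply (integral (cbox 0 1) (F x)) v = integral (cbox 0 1) (\<lambda>t. F x t v)"
          using integral_linear[of "F x" "cbox 0 1" "\<lambda>b. blinfun_apply b v"]
          by (simp add: bounded_linear_intros o_def blinfun.bounded_linear_left)
        also have "\<dots> = integral {0..1} (\<lambda>t. ?f' (x, t) (v, 0))"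
        proof -
          have "(x, t) \<in> V" if "t \<in> {0..1}" for t using assms(3) x that by blast
          then show ?thesis by (auto simp: F intro!: Henstock_Kurzweil_Integration.integral_cong)
        qed
        finally show "blinfun_apply (integral (cbox 0 1) (F x)) v = integral {0..1} (\<lambda>t. ?f' (x, t) (v, 0))" .
      qed
    ultimately show ?thesis by simp
  qed
  show ?case
  proof (rule Ck_on_SucI[OF assms(1) main])
    show "Ck_on k S (\<lambda>x. integral {0..1} (\<lambda>t. ?f' (x, t) (v, 0)))" for v
      using Suc.prems by (intro Suc.IH) (simp only: Ck_on.simps)
  qed
qed

text \<open>The mean value theorem applied once in each direction turns the second difference over a small
  parallelogram into a mixed second derivative at some point of it.\<close>

lemma second_difference_mvt:
  fixes f :: "'a::euclidean_space \<Rightarrow> real"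
  assumes "convex S" "Ck_on (Suc (Suc 0)) S f" "t > 0"
    and S: "\<And>a b. 0 \<le> a \<Longrightarrow> a \<le> t \<Longrightarrow> 0 \<le> b \<Longrightarrow> b \<le> t \<Longrightarrow> x + a *\<^sub>R u + b *\<^sub>R v \<in> S"
  shows "\<exists>p\<in>S. f (x + t *\<^sub>R u + t *\<^sub>R v) - f (x + t *\<^sub>R u) - f (x + t *\<^sub>R v) + f x =
    t * t * frechet_derivative (\<lambda>y. frechet_derivative f (at y) u) (at p) v"
proof -
  let ?f' = "\<lambda>y. frechet_derivative f (at y)"
  have f': "(f has_derivative ?f' y) (at y)" if "y \<in> S" for y
    using Ck_on_has_derivative[OF assms(2) that] .
  have fu: "((\<lambda>y. ?f' y u) has_derivative frechet_derivative (\<lambda>y. ?f' y u) (at y)) (at y)" if "y \<in> S" for y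
    using assms(2) that by (intro Ck_on_has_derivative[of 0 S]) simp_all
  have lin: "linear (?f' y)" if "y \<in> S" for y
    using f'[OF that] has_derivative_linear by blast
  have d1: "((\<lambda>a. f (x + a *\<^sub>R u + b *\<^sub>R v)) has_real_derivative ?f' (x + a *\<^sub>R u + b *\<^sub>R v) u) (at a)"
    if "0 \<le> a" "a \<le> t" "0 \<le> b" "b \<le> t" for a b
  proof -
    have y: "x + a *\<^sub>R u + b *\<^sub>R v \<in> S" using S that by auto
    have "((\<lambda>a. f (x + a *\<^sub>R u + b *\<^sub>R v)) has_derivative (\<lambda>h. ?f' (x + a *\<^sub>R u + b *\<^sub>R v) (h *\<^sub>R u))) (at a)"
      by (rule has_derivative_compose[where g = f and f = "\<lambda>a. x + a *\<^sub>R u + b *\<^sub>R v", OF _ f'[OF y]])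
         (auto intro!: derivative_eq_intros)
    then show ?thesis
      by (simp add: has_field_derivative_def linear_cmul[OF lin[OF y]] mult.commute[of _ "?f' _ u"])
  qed
  have "\<exists>c>0. c < t \<and> (f (x + t *\<^sub>R u + t *\<^sub>R v) - f (x + t *\<^sub>R u + 0 *\<^sub>R v)) - (f (x + 0 *\<^sub>R u + t *\<^sub>R v) - f (x + 0 *\<^sub>R u + 0 *\<^sub>R v))
      = (t - 0) * (?f' (x + c *\<^sub>R u + t *\<^sub>R v) u - ?f' (x + c *\<^sub>R u + 0 *\<^sub>R v) u)"
    by (rule MVT2) (use assms(3) in \<open>auto intro!: DERIV_diff d1 d1[of _ 0, simplified]\<close>)
  then obtain c where c: "0 < c" "c < t" 
    and eq1: "f (x + t *\<^sub>R u + t *\<^sub>R v) - f (x + t *\<^sub>R u) - f (x + t *\<^sub>R v) + f x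
      = t * (?f' (x + c *\<^sub>R u + t *\<^sub>R v) u - ?f' (x + c *\<^sub>R u) u)"
    by (auto simp: algebra_simps)
  have d2: "((\<lambda>b. ?f' (x + c *\<^sub>R u + b *\<^sub>R v) u) has_real_derivative
      frechet_derivative (\<lambda>y. ?f' y u) (at (x + c *\<^sub>R u + b *\<^sub>R v)) v) (at b)"
    if "0 \<le> b" "b \<le> t" for b
  proof -
    have y: "x + c *\<^sub>R u + b *\<^sub>R v \<in> S" using S c that by auto
    have "((\<lambda>b. ?f' (x + c *\<^sub>R u + b *\<^sub>R v) u) has_derivative
        (\<lambda>h. frechet_derivative (\<lambda>y. ?f' y u) (at (x + c *\<^sub>R u + b *\<^sub>R v)) (h *\<^sub>R v))) (at b)"
      by (rule has_derivative_compose[where g = "\<lambda>y. ?f' y u" and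
            f = "\<lambda>b. x + c *\<^sub>R u + b *\<^sub>R v", OF _ fu[OF y]])
         (auto intro!: derivative_eq_intros)
    then show ?thesis
      by (simp add: has_field_derivative_def linear_cmul[OF has_derivative_linear[OF fu[OF y]]]
          mult.commute[of _ "frechet_derivative _ _ v"])
  qed
  have "\<exists>b>0. b < t \<and> ?f' (x + c *\<^sub>R u + t *\<^sub>R v) u - ?f' (x + c *\<^sub>R u + 0 *\<^sub>R v) u
      = (t - 0) * frechet_derivative (\<lambda>y. ?f' y u) (at (x + c *\<^sub>R u + b *\<^sub>R v)) v"
    by (rule MVT2) (use assms(3) in \<open>auto intro!: d2 d2[of 0, simplified]\<close>)
  then obtain b where "0 < b" "b < t" "?f' (x + c *\<^sub>R u + t *\<^sub>R v) u - ?f' (x + c *\<^sub>R u) u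
      = t * frechet_derivative (\<lambda>y. ?f' y u) (at (x + c *\<^sub>R u + b *\<^sub>R v)) v"
    by auto
  with eq1 S[of c b] c show ?thesis
    by (intro bexI[of _ "x + c *\<^sub>R u + b *\<^sub>R v"]) auto
qed

text \<open>The second difference is symmetric in the two directions, so both mixed derivatives take equal values
  at points arbitrarily close to \<open>x\<close>; continuity does the rest.\<close>

lemma second_derivative_symmetric:
  fixes f :: "'a::euclidean_space \<Rightarrow> real"
  assumes "open S" "Ck_on (Suc (Suc 0)) S f" "x \<in> S"
  shows "frechet_derivative (\<lambda>y. frechet_derivative f (at y) u) (at x) v =
    frechet_derivative (\<lambda>y. frechet_derivative f (at y) v) (at x) u" (is "?D u v x = ?D v u x")
proof (rule ccontr)
  assume ne: "?D u v x \<noteq> ?D v u x"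
  define e where "e = \<bar>?D u v x - ?D v u x\<bar> / 2"
  have e: "e > 0" using ne by (simp add: e_def)
  have c: "continuous_on S (?D a b)" for a b
    using assms(2) by simp
  have "\<exists>d>0. ball x d \<subseteq> S \<and> (\<forall>p\<in>ball x d. \<bar>?D a b p - ?D a b x\<bar> < e)" for a b
  proof -
    have "isCont (?D a b) x"
      using c assms(1,3) by (simp add: continuous_on_eq_continuous_at)
    then obtain d1 where d1: "d1 > 0" "\<And>p. dist p x < d1 \<Longrightarrow> \<bar>?D a b p - ?D a b x\<bar> < e"
      using e unfolding continuous_at_eps_delta dist_real_def by metis
    obtain d2 where "d2 > 0" "ball x d2 \<subseteq> S"
      using openE[OF assms(1,3)] by metis
    with d1 show ?thesis
      by (intro exI[of _ "min d1 d2"]) (auto simp: dist_commute)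
  qed
  then obtain d1 d2 where d: "d1 > 0" "d2 > 0" "ball x d1 \<subseteq> S" "ball x d2 \<subseteq> S"
    "\<And>p. p \<in> ball x d1 \<Longrightarrow> \<bar>?D u v p - ?D u v x\<bar> < e"
    "\<And>p. p \<in> ball x d2 \<Longrightarrow> \<bar>?D v u p - ?D v u x\<bar> < e"
    by meson
  define r where "r = min d1 d2"
  define t where "t = r / (2 * (norm u + norm v + 1))"
  have r: "r > 0" using d by (simp add: r_def)
  have np: "norm u + norm v + 1 > 0" using norm_ge_zero[of u] norm_ge_zero[of v] by linarith
  have t: "t > 0" using r np by (simp add: t_def)
  have in_ball: "x + a *\<^sub>R u' + b *\<^sub>R v' \<in> ball x r"
    if "0 \<le> a" "a \<le> t" "0 \<le> b" "b \<le> t" "{u', v'} = {u, v}" for a b u' v'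
  proof -
    have "norm (a *\<^sub>R u' + b *\<^sub>R v') \<le> a * norm u' + b * norm v'"
      using norm_triangle_ineq[of "a *\<^sub>R u'" "b *\<^sub>R v'"] that by simp
    also have "\<dots> \<le> t * norm u' + t * norm v'"
      using that by (intro add_mono mult_right_mono) auto
    also have "\<dots> \<le> t * (norm u + norm v + norm u + norm v)"
      using that(5) t by (auto simp: doubleton_eq_iff algebra_simps)
    also have "\<dots> < t * (2 * (norm u + norm v + 1))" using t by (intro mult_strict_left_mono) auto
    also have "\<dots> = r" using np by (simp add: t_def)
    finally have "norm (x - (x + a *\<^sub>R u' + b *\<^sub>R v')) < r"
      by (metis add.assoc add_diff_cancel_left' norm_minus_commute)
    then show ?thesis by (simp add: dist_norm)
  qed
  have Ck: "Ck_on (Suc (Suc 0)) (ball x r) f"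
    by (rule Ck_on_subset[OF assms(2)]) (use d in \<open>auto simp: r_def\<close>)
  obtain p where p: "p \<in> ball x r"
    "f (x + t *\<^sub>R u + t *\<^sub>R v) - f (x + t *\<^sub>R u) - f (x + t *\<^sub>R v) + f x = t * t * ?D u v p"
    using second_difference_mvt[OF convex_ball Ck t in_ball, of u v] by auto
  obtain q where q: "q \<in> ball x r"
    "f (x + t *\<^sub>R v + t *\<^sub>R u) - f (x + t *\<^sub>R v) - f (x + t *\<^sub>R u) + f x = t * t * ?D v u q"
    using second_difference_mvt[OF convex_ball Ck t in_ball, of v u] by (auto simp: insert_commute)
  have "f (x + t *\<^sub>R v + t *\<^sub>R u) = f (x + t *\<^sub>R u + t *\<^sub>R v)"
    by (simp add: algebra_simps)
  then have "t * t * ?D u v p = t * t * ?D v u q"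
    using p(2) q(2) by linarith
  then have "?D u v p = ?D v u q" using t by simp
  moreover have "\<bar>?D u v p - ?D u v x\<bar> < e" "\<bar>?D v u q - ?D v u x\<bar> < e"
    using d p(1) q(1) by (auto simp: r_def)
  moreover have "\<bar>a - b\<bar> < \<bar>b - c\<bar> / 2 \<Longrightarrow> \<not> \<bar>a - c\<bar> < \<bar>b - c\<bar> / 2" for a b c :: real
    using abs_triangle_ineq4[of "a - c" "a - b"] by simp
  ultimately show False unfolding e_def by metis
qed


section \<open>Smooth maps on relatively open subsets of the half-space\<close>

lemma smooth_onI:
  "(\<And>x. x \<in> S \<Longrightarrow> \<exists>V g. open V \<and> x \<in> V \<and> (\<forall>k. Ck_on k V g) \<and> (\<forall>y\<in>V \<inter> S. g y = f y)) \<Longrightarrow>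
    smooth_on S f"
  by (simp add: smooth_on_def)

lemma smooth_onE:
  assumes "smooth_on S f" "x \<in> S"
  obtains V g where "open V" "x \<in> V" "\<And>k. Ck_on k V g" "\<And>y. y \<in> V \<Longrightarrow> y \<in> S \<Longrightarrow> g y = f y"
  using assms unfolding smooth_on_def by (metis IntI)

lemma smooth_on_subset: "smooth_on S f \<Longrightarrow> T \<subseteq> S \<Longrightarrow> smooth_on T f"
proof (rule smooth_onI)
  fix x assume "smooth_on S f" "T \<subseteq> S" "x \<in> T"
  then obtain V g where "open V" "x \<in> V" "\<And>k. Ck_on k V g" "\<And>y. y \<in> V \<Longrightarrow> y \<in> S \<Longrightarrow> g y = f y"
    using smooth_onE[of S f x] by blast
  with \<open>T \<subseteq> S\<close> show "\<exists>V g. open V \<and> x \<in> V \<and> (\<forall>k. Ck_on k V g) \<and> (\<forall>y\<in>V \<inter> T. g y = f y)"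
    by (intro exI[of _ V] exI[of _ g]) auto
qed

lemma smooth_on_cong: "smooth_on S f \<Longrightarrow> (\<And>x. x \<in> S \<Longrightarrow> f x = g x) \<Longrightarrow> smooth_on S g"
  by (simp add: smooth_on_def)

lemma smooth_on_local:
  assumes "\<And>x. x \<in> S \<Longrightarrow> \<exists>V. open V \<and> x \<in> V \<and> smooth_on (S \<inter> V) f"
  shows "smooth_on S f"
proof (rule smooth_onI)
  fix x assume x: "x \<in> S"
  then obtain V where V: "open V" "x \<in> V" "smooth_on (S \<inter> V) f" using assms by blast
  then obtain W g where W: "open W" "x \<in> W" "\<And>k. Ck_on k W g" "\<And>y. y \<in> W \<Longrightarrow> y \<in> S \<inter> V \<Longrightarrow> g y = f y"
    using smooth_onE[OF V(3)] x by blast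
  show "\<exists>V g. open V \<and> x \<in> V \<and> (\<forall>k. Ck_on k V g) \<and> (\<forall>y\<in>V \<inter> S. g y = f y)"
    using V W Ck_on_subset[OF W(3) Int_lower1] by (intro exI[of _ "W \<inter> V"] exI[of _ g]) (simp add: open_Int)
qed

lemma smooth_on_openI: "open S \<Longrightarrow> (\<And>k. Ck_on k S f) \<Longrightarrow> smooth_on S f"
  by (rule smooth_onI) (auto intro!: exI[of _ S])

lemma smooth_on_bounded_linear: "bounded_linear f \<Longrightarrow> smooth_on S f"
  by (rule smooth_on_subset[of UNIV]) (auto intro!: smooth_on_openI Ck_on_bounded_linear)

lemma smooth_on_const: "smooth_on S (\<lambda>x. c)"
  by (rule smooth_on_subset[of UNIV]) (auto intro!: smooth_on_openI Ck_on_const)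

lemma smooth_on_nth: "smooth_on S (\<lambda>x. x $ i)"
  by (rule smooth_on_bounded_linear) (rule bounded_linear_vec_nth)

text \<open>Pointwise operations on smooth maps: the two local extensions are restricted to a common neighbourhood.\<close>

lemma smooth_on_binary:
  fixes S :: "'a::euclidean_space set"
  assumes "smooth_on S f" "smooth_on S g"
    and h: "\<And>(V :: 'a set) f g k. open V \<Longrightarrow> Ck_on k V f \<Longrightarrow> Ck_on k V g \<Longrightarrow> Ck_on k V (\<lambda>x. h (f x) (g x))"
  shows "smooth_on S (\<lambda>x. h (f x) (g x))"
proof (rule smooth_onI)
  fix x assume x: "x \<in> S"
  obtain V f' where V: "open V" "x \<in> V" "\<And>k. Ck_on k V f'" "\<And>y. y \<in> V \<Longrightarrow> y \<in> S \<Longrightarrow> f' y = f y"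
    using smooth_onE[OF assms(1) x] by blast
  obtain W g' where W: "open W" "x \<in> W" "\<And>k. Ck_on k W g'" "\<And>y. y \<in> W \<Longrightarrow> y \<in> S \<Longrightarrow> g' y = g y"
    using smooth_onE[OF assms(2) x] by blast
  have "Ck_on k (V \<inter> W) (\<lambda>x. h (f' x) (g' x))" for k
    by (rule h[OF open_Int[OF V(1) W(1)] Ck_on_subset[OF V(3) Int_lower1]
          Ck_on_subset[OF W(3) Int_lower2]])
  then show "\<exists>V g'. open V \<and> x \<in> V \<and> (\<forall>k. Ck_on k V g') \<and> (\<forall>y\<in>V \<inter> S. g' y = h (f y) (g y))"
    using V W by (intro exI[of _ "V \<inter> W"] exI[of _ "\<lambda>x. h (f' x) (g' x)"]) auto
qed

lemma smooth_on_add: "smooth_on S f \<Longrightarrow> smooth_on S g \<Longrightarrow> smooth_on S (\<lambda>x. f x + g x)"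
  by (rule smooth_on_binary) (auto intro: Ck_on_add)

lemma smooth_on_scaleR: "smooth_on S f \<Longrightarrow> smooth_on S g \<Longrightarrow> smooth_on S (\<lambda>x. f x *\<^sub>R g x)"
  by (rule smooth_on_binary) (auto intro: Ck_on_scaleR)

lemma smooth_on_mult:
  fixes f g :: "'a::euclidean_space \<Rightarrow> real"
  shows "smooth_on S f \<Longrightarrow> smooth_on S g \<Longrightarrow> smooth_on S (\<lambda>x. f x * g x)"
  using smooth_on_scaleR[of S f g] by simp

lemma smooth_on_minus: "smooth_on S f \<Longrightarrow> smooth_on S (\<lambda>x. - f x)"
  using smooth_on_scaleR[OF smooth_on_const[of S "-1"], of f] by simp

lemma smooth_on_diff: "smooth_on S f \<Longrightarrow> smooth_on S g \<Longrightarrow> smooth_on S (\<lambda>x. f x - g x)"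
  using smooth_on_add[of S f "\<lambda>x. - g x"] smooth_on_minus[of S g] by simp

lemma smooth_on_sum:
  "(\<And>i. i \<in> I \<Longrightarrow> smooth_on S (f i)) \<Longrightarrow> smooth_on S (\<lambda>x. \<Sum>i\<in>I. f i x)"
proof (induction I rule: infinite_finite_induct)
  case (insert i I)
  then show ?case by (simp add: smooth_on_add)
qed (simp_all add: smooth_on_const)

lemma smooth_on_continuous: 
  assumes "smooth_on S f" shows "continuous_on S f"
  unfolding continuous_on_eq_continuous_within
proof
  fix x assume x: "x \<in> S"
  obtain V g where V: "open V" "x \<in> V" "\<And>k. Ck_on k V g" "\<And>y. y \<in> V \<Longrightarrow> y \<in> S \<Longrightarrow> g y = f y"
    using smooth_onE[OF assms x] by blast
  then have "continuous (at x) g"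
    using Ck_on_continuous[OF V(3)] by (simp add: continuous_on_eq_continuous_at)
  then have "continuous (at x within S) g" by (rule continuous_at_imp_continuous_at_within)
  moreover obtain d where d: "d > 0" "ball x d \<subseteq> V" using openE[OF V(1,2)] by metis
  ultimately show "continuous (at x within S) f"
    using V(4) x
    by (intro continuous_transform_within[of x S g d f]) (auto simp: dist_commute subset_iff)
qed

lemma smooth_on_compose:
  assumes "smooth_on S f" "smooth_on T g" "\<And>x. x \<in> S \<Longrightarrow> f x \<in> T"
  shows "smooth_on S (\<lambda>x. g (f x))"
proof (rule smooth_onI)
  fix x assume x: "x \<in> S"
  obtain V f' where V: "open V" "x \<in> V" "\<And>k. Ck_on k V f'" "\<And>y. y \<in> V \<Longrightarrow> y \<in> S \<Longrightarrow> f' y = f y"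
    using smooth_onE[OF assms(1) x] by blast
  obtain W g' where W: "open W" "f x \<in> W" "\<And>k. Ck_on k W g'" "\<And>y. y \<in> W \<Longrightarrow> y \<in> T \<Longrightarrow> g' y = g y"
    using smooth_onE[OF assms(2) assms(3)[OF x]] by blast
  define V' where "V' = V \<inter> f' -` W"
  have V': "open V'" unfolding V'_def
    by (rule continuous_open_preimage[OF Ck_on_continuous[OF V(3)] V(1) W(1)])
  have "Ck_on k V' (\<lambda>x. g' (f' x))" for k
    by (rule Ck_on_compose[OF V' W(1) Ck_on_subset[OF V(3)] W(3)]) (auto simp: V'_def)
  then show "\<exists>V h. open V \<and> x \<in> V \<and> (\<forall>k. Ck_on k V h) \<and> (\<forall>y\<in>V \<inter> S. h y = g (f y))"
    using V W V' x assms(3)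
    by (intro exI[of _ "V'"] exI[of _ "\<lambda>x. g' (f' x)"]) (auto simp: V'_def)
qed

lemma smooth_on_vec_nth:
  fixes f :: "'a::euclidean_space \<Rightarrow> real ^ 'n::finite"
  shows "smooth_on S f \<Longrightarrow> smooth_on S (\<lambda>x. f x $ i)"
  by (rule smooth_on_compose[where T = UNIV and g = "\<lambda>x. x $ i", OF _ smooth_on_nth UNIV_I])

lemma smooth_on_inverse:
  fixes f :: "'a::euclidean_space \<Rightarrow> real"
  assumes "smooth_on S f" "\<And>x. x \<in> S \<Longrightarrow> f x \<noteq> 0"
  shows "smooth_on S (\<lambda>x. inverse (f x))"
proof (rule smooth_on_compose[OF assms(1)])
  show "smooth_on (- {0::real}) inverse"
  proof (rule smooth_on_openI)
    show "Ck_on k (- {0::real}) inverse" for k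
      by (rule Ck_on_inverse) (auto intro: Ck_on_bounded_linear bounded_linear_ident)
  qed auto
qed (use assms in auto)

lemma smooth_on_divide:
  fixes f g :: "'a::euclidean_space \<Rightarrow> real"
  shows "smooth_on S f \<Longrightarrow> smooth_on S g \<Longrightarrow> (\<And>x. x \<in> S \<Longrightarrow> g x \<noteq> 0) \<Longrightarrow> smooth_on S (\<lambda>x. f x / g x)"
  unfolding divide_inverse by (intro smooth_on_mult smooth_on_inverse)

text \<open>All coordinate domains are relatively open in one fixed half-space.\<close>

abbreviation hopen :: "'n::finite \<Rightarrow> (real ^ 'n) set \<Rightarrow> bool" where
  "hopen k S \<equiv> openin (top_of_set (half_space k)) S"

lemma hopen_subset: "hopen k S \<Longrightarrow> S \<subseteq> half_space k"
  using openin_imp_subset by blast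

lemma hopen_in_half_space: "hopen k S \<Longrightarrow> x \<in> S \<Longrightarrow> x \<in> half_space k"
  using hopen_subset by blast

lemma hopen_nonneg: "hopen k S \<Longrightarrow> x \<in> S \<Longrightarrow> 0 \<le> x $ k"
  using hopen_subset[of k S] by (auto simp: half_space_def)

lemma hopen_Int_open: "hopen k S \<Longrightarrow> open V \<Longrightarrow> hopen k (S \<inter> V)"
  by (metis openin_Int_open)

lemma hopenE:
  assumes "hopen k S" "x \<in> S"
  obtains e where "e > 0" "ball x e \<inter> half_space k \<subseteq> S"
proof -
  obtain e where e: "e > 0" "\<And>x'. x' \<in> half_space k \<Longrightarrow> dist x' x < e \<Longrightarrow> x' \<in> S"
    using assms unfolding openin_euclidean_subtopology_iff by blast
  then have "ball x e \<inter> half_space k \<subseteq> S" by (auto simp: dist_commute)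
  then show thesis using e that by blast
qed

lemma at_within_hopen: 
  assumes "hopen k S" "x \<in> S"
  shows "at x within S = at x within half_space k"
proof -
  obtain e where "e > 0" "ball x e \<inter> half_space k \<subseteq> S" using hopenE[OF assms] by blast
  then show ?thesis
    using hopen_subset[OF assms(1)] by (intro at_within_nhd[of x "ball x e"]) auto
qed

lemma hopen_interior_open:
  assumes "hopen k S" shows "open (S \<inter> {x. 0 < x $ k})"
proof (rule openI)
  fix x assume x: "x \<in> S \<inter> {x. 0 < x $ k}"
  obtain e where e: "e > 0" "ball x e \<inter> half_space k \<subseteq> S" using hopenE[OF assms] x by blast
  have "open {x :: real^'a. 0 < x $ k}"
    by (simp add: open_Collect_less continuous_on_component)
  then obtain d where "d > 0" "ball x d \<subseteq> {x. 0 < x $ k}" using x openE by blast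
  with e show "\<exists>e>0. ball x e \<subseteq> S \<inter> {x. 0 < x $ k}"
    by (intro exI[of _ "min e d"]) (fastforce simp: half_space_def)
qed

text \<open>Boundary points are approached along the inner normal.  With continuity this is the density argument by
  which identities between smooth objects pass from the interior to the boundary.\<close>

lemma islimpt_interior:
  assumes "hopen k S" "x \<in> S"
  shows "x islimpt S \<inter> {x. 0 < x $ k}"
  unfolding islimpt_approachable
proof (intro allI impI)
  fix d :: real assume d: "d > 0"
  obtain e where e: "e > 0" "ball x e \<inter> half_space k \<subseteq> S" using hopenE[OF assms] by blast
  define y where "y = x + (min d e / 2) *\<^sub>R axis k 1"
  have 1: "dist y x = min d e / 2" using d e by (simp add: y_def dist_norm norm_axis_1)
  have 2: "0 < y $ k" using hopen_nonneg[OF assms] d e by (simp add: y_def axis_def)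
  have "y \<in> S" using e d 1 2 by (auto simp: half_space_def subset_iff dist_commute)
  then show "\<exists>x'\<in>S \<inter> {x. 0 < x $ k}. x' \<noteq> x \<and> dist x' x < d"
    using 1 2 d e by (intro bexI[of _ y]) auto
qed

lemma hopen_continuous_agree:
  fixes f g :: "real ^ 'n::finite \<Rightarrow> 'b::t2_space"
  assumes "hopen k S" "continuous_on S f" "continuous_on S g"
    "\<And>x. x \<in> S \<Longrightarrow> 0 < x $ k \<Longrightarrow> f x = g x" "x \<in> S"
  shows "f x = g x"
proof (rule tendsto_unique)
  let ?F = "at x within S \<inter> {x. 0 < x $ k}"
  show "?F \<noteq> bot" using islimpt_interior[OF assms(1,5)] by (simp add: trivial_limit_within)
  have f: "(f \<longlongrightarrow> f x) ?F" 
    using assms(2,5) unfolding continuous_on_def by (blast intro: tendsto_within_subset)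
  have g: "(g \<longlongrightarrow> g x) ?F" 
    using assms(3,5) unfolding continuous_on_def by (blast intro: tendsto_within_subset)
  have "\<forall>\<^sub>F x in ?F. f x = g x"
    using assms(4) by (auto simp: eventually_at_filter)
  from Lim_transform_eventually[OF f this] show "(g \<longlongrightarrow> f x) ?F" .
  show "(g \<longlongrightarrow> g x) ?F" by (rule g)
qed

text \<open>The derivative within the half-space does not change when the half-space is replaced by a relatively open
  subset, so this one operator replaces the derivatives within the various coordinate domains.  It is
  unique also at boundary points, because inner directions span.\<close>

definition hD :: "'n::finite \<Rightarrow> (real ^ 'n \<Rightarrow> 'b::real_normed_vector) \<Rightarrow> real ^ 'n \<Rightarrow> real ^ 'n \<Rightarrow> 'b" where
  "hD k f x = frechet_derivative f (at x within half_space k)"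

lemma hD_eqI:
  fixes f :: "real ^ 'n::finite \<Rightarrow> 'b::real_normed_vector"
  assumes "(f has_derivative f') (at x within half_space k)" "x \<in> half_space k"
  shows "hD k f x = f'"
  unfolding hD_def
proof (rule frechet_derivative_unique_within[OF _ assms(1)])
  show "(f has_derivative frechet_derivative f (at x within half_space k)) (at x within half_space k)"
    using assms by (metis differentiable_def frechet_derivative_works)
  fix i :: "real ^ 'n" and e :: real
  assume "i \<in> Basis" "e > 0"
  then have "x + (e / 2) *\<^sub>R i \<in> half_space k"
    using assms(2) by (auto simp: half_space_def Basis_vec_def axis_def)
  then show "\<exists>d. 0 < \<bar>d\<bar> \<and> \<bar>d\<bar> < e \<and> x + d *\<^sub>R i \<in> half_space k"
    using \<open>e > 0\<close> by (intro exI[of _ "e / 2"]) auto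
qed

lemma hD_eqI_hopen:
  assumes "(f has_derivative f') (at x within S)" "hopen k S" "x \<in> S"
  shows "hD k f x = f'"
  using assms hopen_subset[OF assms(2)]
  by (intro hD_eqI) (auto simp: at_within_hopen[OF assms(2,3)])

lemma smooth_on_local_derivative:
  assumes "hopen k S" "open V" "\<And>k. Ck_on k V g" "\<And>y. y \<in> V \<Longrightarrow> y \<in> S \<Longrightarrow> g y = f y" "x \<in> V" "x \<in> S"
  shows "(f has_derivative frechet_derivative g (at x)) (at x within half_space k)"
proof -
  have "(g has_derivative frechet_derivative g (at x)) (at x within S \<inter> V)"
    using Ck_on_has_derivative[OF assms(3,5)] by (rule has_derivative_at_withinI)
  then have "(f has_derivative frechet_derivative g (at x)) (at x within S \<inter> V)"
    by (rule has_derivative_transform_within[OF _ zero_less_one]) (use assms in auto)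
  then show ?thesis
    using at_within_hopen[OF hopen_Int_open[OF assms(1,2)]] assms by auto
qed

lemma smooth_on_has_derivative:
  assumes "smooth_on S f" "hopen k S" "x \<in> S"
  shows "(f has_derivative hD k f x) (at x within half_space k)"
proof -
  obtain V g where V: "open V" "x \<in> V" "\<And>k. Ck_on k V g" "\<And>y. y \<in> V \<Longrightarrow> y \<in> S \<Longrightarrow> g y = f y"
    using smooth_onE[OF assms(1,3)] by blast
  have *: "(f has_derivative frechet_derivative g (at x)) (at x within half_space k)"
    using smooth_on_local_derivative[OF assms(2) V(1,3,4,2) assms(3)] .
  moreover have "hD k f x = frechet_derivative g (at x)"
    using hD_eqI[OF *] assms hopen_subset by blast
  ultimately show ?thesis by simp
qed

lemma smooth_on_hD:
  assumes "smooth_on S f" "hopen k S"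
  shows "smooth_on S (\<lambda>x. hD k f x v)"
proof (rule smooth_onI)
  fix x assume x: "x \<in> S"
  obtain V g where V: "open V" "x \<in> V" "\<And>k. Ck_on k V g" "\<And>y. y \<in> V \<Longrightarrow> y \<in> S \<Longrightarrow> g y = f y"
    using smooth_onE[OF assms(1) x] by blast
  have "hD k f y = frechet_derivative g (at y)" if "y \<in> V" "y \<in> S" for y
    by (rule hD_eqI[OF smooth_on_local_derivative[OF assms(2) V(1,3,4) that]
          hopen_in_half_space[OF assms(2) that(2)]])
  then show "\<exists>V g. open V \<and> x \<in> V \<and> (\<forall>k. Ck_on k V g) \<and> (\<forall>y\<in>V \<inter> S. g y = hD k f y v)"
    using V by (intro exI[of _ V] exI[of _ "\<lambda>x. frechet_derivative g (at x) v"])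
      (auto intro: Ck_on_deriv)
qed

lemma hD_cong:
  assumes "hopen k S" "x \<in> S" "\<And>y. y \<in> S \<Longrightarrow> f y = g y"
  shows "hD k f x = hD k g x"
proof -
  have "(f has_derivative d) (at x within S) \<longleftrightarrow> (g has_derivative d) (at x within S)" for d
    using has_derivative_transform[OF assms(2), of f g d] has_derivative_transform[OF assms(2), of g f d]
      assms(3) by auto
  then show ?thesis
    unfolding hD_def frechet_derivative_def at_within_hopen[OF assms(1,2)] by simp
qed

lemma hD_linear: "smooth_on S f \<Longrightarrow> hopen k S \<Longrightarrow> x \<in> S \<Longrightarrow> bounded_linear (hD k f x)"
  using smooth_on_has_derivative has_derivative_bounded_linear by blast

lemma hD_expand:
  assumes "smooth_on S f" "hopen k S" "x \<in> S"
  shows "hD k f x v = (\<Sum>i\<in>UNIV. v $ i *\<^sub>R hD k f x (axis i 1))"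
proof -
  interpret bounded_linear "hD k f x" using hD_linear[OF assms] .
  have "v = (\<Sum>i\<in>UNIV. v $ i *\<^sub>R axis i 1)"
    using basis_expansion[of v] by (simp add: scalar_mult_eq_scaleR)
  then have "hD k f x v = hD k f x (\<Sum>i\<in>UNIV. v $ i *\<^sub>R axis i 1)" by simp
  then show ?thesis by (simp add: sum scaleR)
qed

lemma smooth_on_hD_comp:
  assumes "smooth_on S f" "hopen k S" "smooth_on S w"
  shows "smooth_on S (\<lambda>x. hD k f x (w x))"
proof (rule smooth_on_cong)
  show "smooth_on S (\<lambda>x. \<Sum>i\<in>UNIV. w x $ i *\<^sub>R hD k f x (axis i 1))"
    by (intro smooth_on_sum smooth_on_scaleR smooth_on_hD smooth_on_vec_nth assms)
qed (rule hD_expand[OF assms(1,2), symmetric])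

lemma hD_add:
  assumes "smooth_on S f" "smooth_on S g" "hopen k S" "x \<in> S"
  shows "hD k (\<lambda>x. f x + g x) x v = hD k f x v + hD k g x v"
  by (rule fun_cong[OF hD_eqI[OF has_derivative_add[OF smooth_on_has_derivative[OF assms(1,3,4)]
      smooth_on_has_derivative[OF assms(2,3,4)]]
      hopen_in_half_space[OF assms(3,4)]]])

lemma hD_scaleR:
  assumes "smooth_on S f" "smooth_on S g" "hopen k S" "x \<in> S"
  shows "hD k (\<lambda>x. f x *\<^sub>R g x) x v = f x *\<^sub>R hD k g x v + hD k f x v *\<^sub>R g x"
  by (rule fun_cong[OF hD_eqI[OF has_derivative_scaleR[OF smooth_on_has_derivative[OF assms(1,3,4)]
      smooth_on_has_derivative[OF assms(2,3,4)]]
      hopen_in_half_space[OF assms(3,4)]]])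

lemma hD_mult:
  fixes f g :: "real ^ 'n::finite \<Rightarrow> real"
  assumes "smooth_on S f" "smooth_on S g" "hopen k S" "x \<in> S"
  shows "hD k (\<lambda>x. f x * g x) x v = f x * hD k g x v + hD k f x v * g x"
  using hD_scaleR[OF assms] by simp

lemma hD_const: "x \<in> half_space k \<Longrightarrow> hD k (\<lambda>x. c) x v = 0"
  by (rule fun_cong[OF hD_eqI[OF has_derivative_const]])

lemma hD_nth: "x \<in> half_space k \<Longrightarrow> hD k (\<lambda>x. x $ i) x v = v $ i"
  by (rule fun_cong[OF hD_eqI[OF bounded_linear_imp_has_derivative[OF bounded_linear_vec_nth]]])

lemma hD_vec_nth:
  assumes "smooth_on S f" "hopen k S" "x \<in> S"
  shows "hD k (\<lambda>x. f x $ i) x v = hD k f x v $ i"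
  by (rule fun_cong[OF hD_eqI[OF bounded_linear.has_derivative[OF bounded_linear_vec_nth
      smooth_on_has_derivative[OF assms]]
      hopen_in_half_space[OF assms(2,3)]]])

lemma hD_compose:
  assumes "smooth_on S f" "smooth_on T g" "hopen k S" "hopen k T" "\<And>x. x \<in> S \<Longrightarrow> f x \<in> T" "x \<in> S"
  shows "hD k (\<lambda>x. g (f x)) x = (\<lambda>v. hD k g (f x) (hD k f x v))"
proof (rule hD_eqI_hopen[OF _ assms(3,6)])
  have f: "(f has_derivative hD k f x) (at x within S)"
    using smooth_on_has_derivative[OF assms(1,3,6)] at_within_hopen[OF assms(3,6)] by simp
  have g: "(g has_derivative hD k g (f x)) (at (f x) within T)"
    using smooth_on_has_derivative[OF assms(2,4)] at_within_hopen[OF assms(4)] assms by simp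
  have "f ` S \<subseteq> T" using assms(5) by auto
  then have "(g has_derivative hD k g (f x)) (at (f x) within f ` S)"
    using g has_derivative_subset by blast
  from diff_chain_within[OF f this]
  show "((\<lambda>x. g (f x)) has_derivative (\<lambda>v. hD k g (f x) (hD k f x v))) (at x within S)"
    by (simp add: o_def)
qed

lemma hD_symmetric:
  fixes f :: "real ^ 'n::finite \<Rightarrow> real"
  assumes "smooth_on S f" "hopen k S" "x \<in> S"
  shows "hD k (\<lambda>y. hD k f y u) x v = hD k (\<lambda>y. hD k f y v) x u"
proof -
  obtain V g where V: "open V" "x \<in> V" "\<And>k. Ck_on k V g" "\<And>y. y \<in> V \<Longrightarrow> y \<in> S \<Longrightarrow> g y = f y"
    using smooth_onE[OF assms(1,3)] by blast
  have 1: "frechet_derivative g (at y) = hD k f y" if "y \<in> V" "y \<in> S" for y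
    by (rule hD_eqI[OF smooth_on_local_derivative[OF assms(2) V(1,3,4) that]
          hopen_in_half_space[OF assms(2) that(2)], symmetric])
  have 2: "hD k (\<lambda>y. hD k f y w) x = frechet_derivative (\<lambda>y. frechet_derivative g (at y) w) (at x)" for w
    by (rule hD_eqI[OF smooth_on_local_derivative[OF assms(2) V(1) Ck_on_deriv[OF V(3)] _ V(2) assms(3)]
          hopen_in_half_space[OF assms(2,3)]]) (simp add: 1)
  show ?thesis
    unfolding 2 by (rule second_derivative_symmetric[OF V(1,3,2)])
qed

lemma at_within_half_space_interior:
  fixes x :: "real ^ 'n::finite"
  assumes "0 < x $ k" shows "at x within half_space k = at x"
proof -
  have "hopen k (half_space k \<inter> {x. 0 < x $ k})"
    by (rule hopen_Int_open) (auto simp: open_Collect_less continuous_on_component)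
  moreover have "half_space k \<inter> {x. 0 < x $ k} = {x. 0 < x $ k}" by (auto simp: half_space_def)
  ultimately have "at x within {x. 0 < x $ k} = at x within half_space k"
    using at_within_hopen[of k "{x. 0 < x $ k}" x] assms by simp
  moreover have "at x within {x. 0 < x $ k} = at x"
    by (rule at_within_open) (use assms in \<open>auto simp: open_Collect_less continuous_on_component\<close>)
  ultimately show ?thesis by simp
qed

text \<open>The second derivative of \<open>f\<close> as a quadratic form in coordinates; the last term comes from the
  variable argument \<open>w\<close>.\<close>

lemma hD_of_hD:
  fixes f :: "real ^ 'n::finite \<Rightarrow> real"
  assumes f: "smooth_on S f" and w: "smooth_on S w" and S: "hopen k S" "x \<in> S"
  shows "hD k (\<lambda>x. hD k f x (w x)) x v =
    (\<Sum>i\<in>UNIV. \<Sum>j\<in>UNIV. v $ i * w x $ j * hD k (\<lambda>x. hD k f x (axis j 1)) x (axis i 1)) + hD k f x (hD k w x v)"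
proof -
  let ?fj = "\<lambda>j x. hD k f x (axis j 1)"
  have fj: "smooth_on S (?fj j)" for j by (rule smooth_on_hD[OF f S(1)])
  have wj: "smooth_on S (\<lambda>x. w x $ j)" for j by (rule smooth_on_vec_nth[OF w])
  have "hD k (\<lambda>x. hD k f x (w x)) x v = hD k (\<lambda>x. \<Sum>j\<in>UNIV. w x $ j * ?fj j x) x v"
    by (rule fun_cong[OF hD_cong[OF S]]) (simp add: hD_expand[OF f S(1), of _ "w _"])
  also have "\<dots> = (\<Sum>j\<in>UNIV. w x $ j * hD k (?fj j) x v + hD k w x v $ j * ?fj j x)"
  proof -
    have "((\<lambda>x. \<Sum>j\<in>UNIV. w x $ j * ?fj j x) has_derivative
        (\<lambda>v. \<Sum>j\<in>UNIV. w x $ j * hD k (?fj j) x v + hD k (\<lambda>x. w x $ j) x v * ?fj j x)) (at x within half_space k)"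
      by (intro has_derivative_sum has_derivative_mult smooth_on_has_derivative[OF fj S]
          smooth_on_has_derivative[OF wj S])
    from fun_cong[OF hD_eqI[OF this hopen_in_half_space[OF S]], of v] show ?thesis
      by (simp add: hD_vec_nth[OF w S])
  qed
  also have "\<dots> = (\<Sum>j\<in>UNIV. w x $ j * hD k (?fj j) x v) + hD k f x (hD k w x v)"
    by (simp add: sum.distrib hD_expand[OF f S, of "hD k w x v"])
  also have "(\<Sum>j\<in>UNIV. w x $ j * hD k (?fj j) x v) =
      (\<Sum>j\<in>UNIV. \<Sum>i\<in>UNIV. v $ i * w x $ j * hD k (?fj j) x (axis i 1))"
    by (subst hD_expand[OF fj S]) (simp add: sum_distrib_left mult_ac)
  finally show ?thesis by (subst sum.swap)
qed

lemma sum_axis_axis: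
  fixes H :: "'n::finite \<Rightarrow> 'n \<Rightarrow> real"
  shows "(\<Sum>i'\<in>UNIV. \<Sum>j'\<in>UNIV. axis i 1 $ i' * axis j 1 $ j' * H i' j') = H i j"
proof -
  have "(\<Sum>j'\<in>UNIV. axis i 1 $ i' * axis j 1 $ j' * H i' j') = (if i' = i then H i' j else 0)" for i'
  proof -
    have "axis i 1 $ i' * axis j 1 $ j' * H i' j' = (if j' = j then (if i' = i then H i' j else 0) else 0)" for j'
      by (simp add: axis_def)
    then show ?thesis by simp
  qed
  then show ?thesis by simp
qed


section \<open>Smooth extension to the boundary\<close>

text \<open>Local extensions agree on overlaps, because interior points are dense, and so they patch together.\<close>

lemma smooth_extension_glue:
  fixes f :: "real ^ 'n::finite \<Rightarrow> 'b::real_normed_vector"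
  assumes X: "hopen k X"
    and loc: "\<And>x. x \<in> X \<Longrightarrow> \<exists>V g. open V \<and> x \<in> V \<and> smooth_on (X \<inter> V) g \<and>
       (\<forall>y\<in>X \<inter> V. 0 < y $ k \<longrightarrow> g y = f y)"
  shows "\<exists>F. smooth_on X F \<and> (\<forall>x\<in>X. 0 < x $ k \<longrightarrow> F x = f x)"
proof -
  obtain V g where V: "\<And>x. x \<in> X \<Longrightarrow> open (V x) \<and> x \<in> V x \<and> smooth_on (X \<inter> V x) (g x) \<and>
       (\<forall>y\<in>X \<inter> V x. 0 < y $ k \<longrightarrow> g x y = f y)"
    using loc by metis
  define F where "F x = g x x" for x
  have F: "F y = g x y" if "x \<in> X" "y \<in> X" "y \<in> V x" for x y
    unfolding F_def
  proof (rule hopen_continuous_agree[where f = "g y" and g = "g x" and S = "X \<inter> (V x \<inter> V y)"])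
    show "hopen k (X \<inter> (V x \<inter> V y))" 
      using V[OF that(1)] V[OF that(2)] by (intro hopen_Int_open X open_Int) auto
    show "continuous_on (X \<inter> (V x \<inter> V y)) (g y)" "continuous_on (X \<inter> (V x \<inter> V y)) (g x)"
      using V[OF that(1)] V[OF that(2)]
      by (auto intro!: smooth_on_continuous elim!: smooth_on_subset)
    show "g y z = g x z" if "z \<in> X \<inter> (V x \<inter> V y)" "0 < z $ k" for z
      using that V[OF \<open>x \<in> X\<close>] V[OF \<open>y \<in> X\<close>] by auto
    show "y \<in> X \<inter> (V x \<inter> V y)" using that V[OF that(2)] by auto
  qed
  have "smooth_on X F"
  proof (rule smooth_on_local)
    fix x assume x: "x \<in> X"
    have "smooth_on (X \<inter> V x) F"
      by (rule smooth_on_cong[of _ "g x"]) (use V[OF x] F[OF x] in auto)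
    then show "\<exists>V. open V \<and> x \<in> V \<and> smooth_on (X \<inter> V) F"
      using V[OF x] by (intro exI[of _ "V x"]) simp
  qed
  moreover have "F x = f x" if "x \<in> X" "0 < x $ k" for x
    using V[OF that(1)] that by (auto simp: F_def)
  ultimately show ?thesis by blast
qed

lemma integral_line:
  fixes g :: "real ^ 'n::finite \<Rightarrow> real"
  assumes B: "convex B" "open B" and g: "\<And>v. v \<in> B \<Longrightarrow> (g has_derivative g' v) (at v)"
    and c: "\<And>w. continuous_on B (\<lambda>v. g' v w)" and "x \<in> B" "z \<in> B"
  shows "g x - g z = integral {0..1} (\<lambda>t. g' (z + t *\<^sub>R (x - z)) (x - z))"
proof -
  have line: "z + t *\<^sub>R (x - z) \<in> B" if "t \<in> {0..1}" for t
  proof -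
    have "z + t *\<^sub>R (x - z) = (1 - t) *\<^sub>R z + t *\<^sub>R x" by (simp add: algebra_simps)
    then show ?thesis using convexD[OF B(1), of z x "1 - t" t] assms that by simp
  qed
  have "((\<lambda>t. g' (z + t *\<^sub>R (x - z)) (x - z)) has_integral
      g (z + 1 *\<^sub>R (x - z)) - g (z + 0 *\<^sub>R (x - z))) {0..1}"
  proof (rule fundamental_theorem_of_calculus)
    fix t :: real assume t: "t \<in> {0..1}"
    have "((\<lambda>t. g (z + t *\<^sub>R (x - z))) has_derivative
        (\<lambda>h. g' (z + t *\<^sub>R (x - z)) (h *\<^sub>R (x - z)))) (at t)"
      by (rule has_derivative_compose[where g = g and f = "\<lambda>t. z + t *\<^sub>R (x - z)", OF _ g[OF line[OF t]]])
         (auto intro!: derivative_eq_intros)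
    moreover have "linear (g' (z + t *\<^sub>R (x - z)))" 
      using g[OF line[OF t]] has_derivative_linear by blast
    ultimately show "((\<lambda>t. g (z + t *\<^sub>R (x - z))) has_vector_derivative
        g' (z + t *\<^sub>R (x - z)) (x - z)) (at t within {0..1})"
      by (simp add: has_vector_derivative_def linear_cmul has_derivative_at_withinI)
  qed simp
  then show ?thesis by (simp add: integral_unique)
qed

text \<open>Hadamard's lemma.  Near a boundary point the quotient is the mean of the normal derivative of a local
  extension over the normal segment that starts on the boundary; away from the boundary there is nothing
  to divide by zero.\<close>

lemma smooth_divide_boundary_coordinate:
  fixes f :: "real ^ 'n::finite \<Rightarrow> real"
  assumes X: "hopen k X" and f: "smooth_on X f" and f0: "\<And>x. x \<in> X \<Longrightarrow> x $ k = 0 \<Longrightarrow> f x = 0"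
  shows "\<exists>g. smooth_on X g \<and> (\<forall>x\<in>X. f x = x $ k * g x)"
proof -
  have "\<exists>F. smooth_on X F \<and> (\<forall>x\<in>X. 0 < x $ k \<longrightarrow> F x = f x / x $ k)"
  proof (rule smooth_extension_glue[OF X])
    fix x assume x: "x \<in> X"
    show "\<exists>V g. open V \<and> x \<in> V \<and> smooth_on (X \<inter> V) g \<and> (\<forall>y\<in>X \<inter> V. 0 < y $ k \<longrightarrow> g y = f y / y $ k)"
    proof (cases "x $ k = 0")
      case False
      have "smooth_on (X \<inter> {x. 0 < x $ k}) (\<lambda>x. f x / x $ k)"
        by (intro smooth_on_divide smooth_on_subset[OF f] smooth_on_nth) auto
      moreover have "open {x :: real ^ 'n. 0 < x $ k}"
        by (simp add: open_Collect_less continuous_on_component)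
      ultimately show ?thesis 
        using False hopen_nonneg[OF X x] by (intro exI[of _ "{x. 0 < x $ k}"] exI) auto
    next
      case True
      obtain V g where V: "open V" "x \<in> V" "\<And>k. Ck_on k V g" "\<And>y. y \<in> V \<Longrightarrow> y \<in> X \<Longrightarrow> g y = f y"
        using smooth_onE[OF f x] by blast
      obtain e1 where e1: "e1 > 0" "ball x e1 \<subseteq> V" using openE[OF V(1,2)] by metis
      obtain e2 where e2: "e2 > 0" "ball x e2 \<inter> half_space k \<subseteq> X" using hopenE[OF X x] by blast
      define B where "B = ball x (min e1 e2)"
      have B: "open B" "convex B" "x \<in> B" "B \<subseteq> V" "B \<inter> half_space k \<subseteq> X"
        using e1 e2 by (auto simp: B_def)
      \<comment> \<open>\<open>P\<close> is the projection to the boundary hyperplane, \<open>L\<close> runs along the normal segment from \<open>P y\<close> to \<open>y\<close>.\<close>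
      define P where "P y = y - y $ k *\<^sub>R axis k 1" for y :: "real ^ 'n"
      have P_norm: "norm (P y) \<le> norm y" for y
        unfolding P_def by (rule norm_le_componentwise_cart) (simp add: axis_def)
      have PB: "P y \<in> B" if "y \<in> B" for y
      proof -
        have "P x = x" using True by (simp add: P_def)
        then have "x - P y = P (x - y)" by (simp add: P_def algebra_simps)
        then have "dist x (P y) \<le> dist x y" using P_norm[of "x - y"] by (simp add: dist_norm)
        then show ?thesis using that by (simp add: B_def)
      qed
      have PX: "P y \<in> X" "P y $ k = 0" if "y \<in> B" for y
        using B(5) PB[OF that] by (auto simp: half_space_def P_def axis_def subset_iff)
      define L where "L z = P (fst z) + snd z *\<^sub>R (fst z - P (fst z))" for z :: "(real ^ 'n) \<times> real"
      have bl: "bounded_linear P" 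
        unfolding P_def by (intro bounded_linear_intros bounded_linear_vec_nth)
      have LCk: "Ck_on j UNIV L" for j
        unfolding L_def
        by (intro Ck_on_add Ck_on_scaleR open_UNIV Ck_on_bounded_linear bounded_linear_compose[OF bl]
            bounded_linear_sub bounded_linear_fst bounded_linear_snd)
      have LB: "L (y, t) \<in> B" if "y \<in> B" "t \<in> {0..1}" for y t
      proof -
        have "L (y, t) = (1 - t) *\<^sub>R P y + t *\<^sub>R y" by (simp add: L_def algebra_simps)
        then show ?thesis using convexD[OF B(2) PB[OF that(1)] that(1), of "1 - t" t] that by simp
      qed
      define h where "h y = integral {0..1} (\<lambda>t. frechet_derivative g (at (L (y, t))) (axis k 1))" for y
      have W: "open (L -` B)"
        using continuous_open_preimage[OF Ck_on_continuous[OF LCk] open_UNIV B(1)] by simp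
      have "Ck_on j B h" for j
        unfolding h_def
      proof (rule Ck_on_integral[OF B(1) W])
        show "B \<times> {0..1} \<subseteq> L -` B" using LB by auto
        show "Ck_on j (L -` B) (\<lambda>z. frechet_derivative g (at (L z)) (axis k 1))"
          by (rule Ck_on_compose[OF W B(1) Ck_on_subset[OF LCk]
                Ck_on_subset[OF Ck_on_deriv[OF V(3)] B(4)]]) auto
      qed
      then have "smooth_on (X \<inter> B) h"
        by (intro smooth_on_subset[OF smooth_on_openI[OF B(1)]]) auto
      moreover have "h y = f y / y $ k" if y: "y \<in> X \<inter> B" "0 < y $ k" for y
      proof -
        let ?g' = "\<lambda>v. frechet_derivative g (at v)"
        have gd: "(g has_derivative ?g' v) (at v)" if "v \<in> B" for v
          using Ck_on_has_derivative[OF V(3)] that B(4) by blast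
        have "g y - g (P y) = integral {0..1} (\<lambda>t. ?g' (P y + t *\<^sub>R (y - P y)) (y - P y))"
          by (rule integral_line[OF B(2,1) gd
                continuous_on_subset[OF Ck_on_continuous[OF Ck_on_deriv[OF V(3)]] B(4)]])
             (use y PB in auto)
        also have "\<dots> = integral {0..1} (\<lambda>t. y $ k * ?g' (L (y, t)) (axis k 1))"
        proof (rule Henstock_Kurzweil_Integration.integral_cong)
          fix t :: real assume t: "t \<in> {0..1}"
          have "linear (?g' (L (y, t)))"
            using gd[OF LB] y t has_derivative_linear by blast
          then show "?g' (P y + t *\<^sub>R (y - P y)) (y - P y) = y $ k * ?g' (L (y, t)) (axis k 1)"
            by (simp add: L_def linear_cmul P_def)
        qed
        also have "\<dots> = y $ k * h y" by (simp add: h_def)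
        finally have "f y = y $ k * h y"
          using V(4) f0 PX PB B(4) y by (auto simp: subset_iff)
        then show ?thesis using y by simp
      qed
      ultimately show ?thesis using B by (intro exI[of _ B] exI[of _ h]) auto
    qed
  qed
  then obtain F where F: "smooth_on X F" "\<And>x. x \<in> X \<Longrightarrow> 0 < x $ k \<Longrightarrow> F x = f x / x $ k" by blast
  have "f x = x $ k * F x" if "x \<in> X" for x
  proof (cases "x $ k = 0")
    case True
    then show ?thesis using f0 that by simp
  next
    case False
    then show ?thesis using F(2)[OF that] hopen_nonneg[OF X that] by simp
  qed
  with F(1) show ?thesis by blast
qed

lemma hD_boundary_vanishing:
  fixes g :: "real ^ 'n::finite \<Rightarrow> real"
  assumes "hopen k X" "smooth_on X g" "\<And>x. x \<in> X \<Longrightarrow> f x = x $ k * g x" "x \<in> X"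
  shows "hD k f x v = v $ k * g x + x $ k * hD k g x v"
proof -
  have "hD k f x v = hD k (\<lambda>x. x $ k * g x) x v"
    using hD_cong[OF assms(1,4,3)] by simp
  also have "\<dots> = x $ k * hD k g x v + hD k (\<lambda>x. x $ k) x v * g x"
    by (rule hD_mult[OF smooth_on_nth assms(2,1,4)])
  finally show ?thesis using hD_nth[OF hopen_in_half_space[OF assms(1,4)]] by simp
qed

text \<open>The factor by which the solution differs from the exponential has derivative zero.\<close>

lemma linear_ode_segment:
  fixes \<phi> a :: "real \<Rightarrow> real"
  assumes a: "continuous_on {0..1} a"
    and \<phi>: "\<And>t. t \<in> {0..1} \<Longrightarrow> (\<phi> has_real_derivative a t * \<phi> t) (at t within {0..1})"
  shows "\<phi> 1 = \<phi> 0 * exp (integral {0..1} a)"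
proof -
  define I where "I t = integral {0..t} a" for t
  have I: "(I has_real_derivative a t) (at t within {0..1})" if "t \<in> {0..1}" for t
    unfolding I_def using integral_has_real_derivative[OF a that] .
  define \<psi> where "\<psi> t = \<phi> t * exp (- I t)" for t
  have "(\<psi> has_real_derivative 0) (at t within {0..1})" if "t \<in> {0..1}" for t
    unfolding \<psi>_def
    by (rule derivative_eq_intros \<phi>[OF that] I[OF that] refl | simp add: algebra_simps)+
  then have "\<psi> 0 = \<psi> 1"
    using has_derivative_zero_unique[OF convex_real_interval(5), of 0 1 \<psi> 0 1]
    by (simp add: has_field_derivative_def lambda_zero)
  then have "\<phi> 0 = \<phi> 1 * exp (- integral {0..1} a)"
    by (simp add: \<psi>_def I_def)
  then show ?thesis by (simp add: exp_minus)
qed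

text \<open>Restricted to a segment that starts at a fixed interior point, the system is a scalar linear differential
  equation, so \<open>y\<close> is a constant times the exponential of a line integral of the coefficients.  With the coefficients
  replaced by local extensions this formula is smooth on a full ball around a boundary point, although the
  extended coefficients need not form a gradient outside the half-space.\<close>

lemma linear_equation_extends:
  fixes y :: "real ^ 'n::finite \<Rightarrow> real" and a :: "'n \<Rightarrow> real ^ 'n \<Rightarrow> real"
  assumes X: "hopen k X" and a: "\<And>i. smooth_on X (a i)"
    and y: "\<And>x. x \<in> X \<Longrightarrow> 0 < x $ k \<Longrightarrow> (y has_derivative (\<lambda>v. (\<Sum>i\<in>UNIV. v $ i * a i x) * y x)) (at x)"
  shows "\<exists>F. smooth_on X F \<and> (\<forall>x\<in>X. 0 < x $ k \<longrightarrow> F x = y x)"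
proof (rule smooth_extension_glue[OF X])
  fix x assume x: "x \<in> X"
  have "\<exists>V g. open V \<and> x \<in> V \<and> (\<forall>j. Ck_on j V g) \<and> (\<forall>z\<in>V \<inter> X. g z = a i z)" for i
    using a[of i] x by (simp add: smooth_on_def)
  then obtain V g where V: "\<And>i. open (V i)" "\<And>i. x \<in> V i" "\<And>i j. Ck_on j (V i) (g i)"
    "\<And>i z. z \<in> V i \<Longrightarrow> z \<in> X \<Longrightarrow> g i z = a i z"
    by (metis IntI)
  have "open (\<Inter>i. V i)" "x \<in> (\<Inter>i. V i)" using V by (auto intro: open_INT)
  then obtain e1 where e1: "e1 > 0" "ball x e1 \<subseteq> (\<Inter>i. V i)" using openE by metis
  obtain e2 where e2: "e2 > 0" "ball x e2 \<inter> half_space k \<subseteq> X" using hopenE[OF X x] by blast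
  define e where "e = min e1 e2"
  define B where "B = ball x e"
  have e: "e > 0" using e1 e2 by (simp add: e_def)
  have B: "open B" "convex B" "x \<in> B" "B \<subseteq> V i" "B \<inter> half_space k \<subseteq> X" for i
    using e1 e2 by (auto simp: B_def e_def)
  \<comment> \<open>The base point of the segments lies in the interior, hence so do all segments to interior points.\<close>
  define z where "z = x + (e / 2) *\<^sub>R axis k 1"
  have z: "z \<in> B" "0 < z $ k"
    using e hopen_nonneg[OF X x] by (simp add: z_def B_def dist_norm norm_axis_1, simp add: z_def axis_def)
  define L where "L w = z + snd w *\<^sub>R (fst w - z)" for w :: "(real ^ 'n) \<times> real"
  have cz: "Ck_on j UNIV (\<lambda>w. fst w - z)" for j
    using Ck_on_add[OF open_UNIV Ck_on_bounded_linear[OF open_UNIV bounded_linear_fst] Ck_on_const[of _ _ "- z"]]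
    by simp
  have LCk: "Ck_on j UNIV L" for j
    unfolding L_def
    by (intro Ck_on_add Ck_on_scaleR open_UNIV Ck_on_const cz Ck_on_bounded_linear bounded_linear_snd)
  have Lconv: "L (v, t) = (1 - t) *\<^sub>R z + t *\<^sub>R v" for v t by (simp add: L_def algebra_simps)
  have LB: "L (v, t) \<in> B" if "v \<in> B" "t \<in> {0..1}" for v t
    using convexD[OF B(2) z(1) that(1), of "1 - t" t] that by (simp add: Lconv)
  have Lpos: "0 < L (v, t) $ k" if "0 < v $ k" "t \<in> {0..1}" for v t
  proof (cases "t = 0")
    case True
    then show ?thesis using z by (simp add: Lconv)
  next
    case False
    then have "0 < t * v $ k" "0 \<le> (1 - t) * z $ k" using that z by auto
    then show ?thesis by (simp add: Lconv)
  qed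
  define h where "h v t = (\<Sum>i\<in>UNIV. (fst (v, t) - z) $ i * g i (L (v, t)))" for v t
  define F where "F v = y z * exp (integral {0..1} (h v))" for v
  have W: "open (L -` B)"
    using continuous_open_preimage[OF Ck_on_continuous[OF LCk] open_UNIV B(1)] by simp
  have hCk: "Ck_on j (L -` B) (\<lambda>w. h (fst w) (snd w))" for j
    unfolding h_def prod.collapse real_scaleR_def[symmetric]
  proof (intro Ck_on_sum W Ck_on_scaleR)
    fix i
    show "Ck_on j (L -` B) (\<lambda>w. (fst w - z) $ i)"
      by (rule Ck_on_linear_comp[OF W bounded_linear_vec_nth Ck_on_subset[OF cz subset_UNIV]])
    show "Ck_on j (L -` B) (\<lambda>w. g i (L w))"
      by (rule Ck_on_compose[OF W B(1) Ck_on_subset[OF LCk subset_UNIV] Ck_on_subset[OF V(3) B(4)]]) auto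
  qed
  have "Ck_on j B (\<lambda>v. integral {0..1} (\<lambda>t. h (fst (v, t)) (snd (v, t))))" for j
    by (rule Ck_on_integral[OF B(1) W _ hCk]) (use LB in auto)
  then have "Ck_on j B (\<lambda>v. y z *\<^sub>R exp (integral {0..1} (h v)))" for j
    by (intro Ck_on_scaleR Ck_on_const Ck_on_exp B(1)) simp
  then have "Ck_on j B F" for j by (simp add: F_def[abs_def])
  then have "smooth_on (X \<inter> B) F"
    by (intro smooth_on_subset[OF smooth_on_openI[OF B(1)]]) auto
  moreover have "F v = y v" if v: "v \<in> X \<inter> B" "0 < v $ k" for v
  proof -
    have LX: "L (v, t) \<in> X" if "t \<in> {0..1}" for t
      using B(5) LB[of v t] Lpos[OF v(2) that] v that by (auto simp: half_space_def subset_iff)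
    have "y (L (v, 1)) = y (L (v, 0)) * exp (integral {0..1} (h v))"
    proof (rule linear_ode_segment)
      show "continuous_on {0..1} (h v)"
      proof -
        have "continuous_on {0..1} (\<lambda>t. (v, t))" by (intro continuous_intros)
        then have "continuous_on {0..1} (\<lambda>t. h (fst (v, t)) (snd (v, t)))"
          by (rule continuous_on_compose2[OF Ck_on_continuous[OF hCk]]) (use LB v in auto)
        then show ?thesis by simp
      qed
      fix t :: real assume t: "t \<in> {0..1}"
      let ?p = "L (v, t)"
      have "((\<lambda>t. y (L (v, t))) has_derivative
          (\<lambda>r. (\<Sum>i\<in>UNIV. (r *\<^sub>R (v - z)) $ i * a i ?p) * y ?p)) (at t)"
        by (rule has_derivative_compose[where g = y and f = "\<lambda>t. L (v, t)", OF _ y[OF LX[OF t] Lpos[OF v(2) t]]])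
           (auto intro!: derivative_eq_intros simp: L_def)
      moreover have "(\<Sum>i\<in>UNIV. (r *\<^sub>R (v - z)) $ i * a i ?p) = r * h v t" for r
      proof -
        have "a i ?p = g i ?p" for i
          using V(4) B(4) LB[of v t] LX[OF t] v t by (metis IntD2 subsetD)
        then show ?thesis by (simp add: h_def sum_distrib_left algebra_simps)
      qed
      ultimately have "((\<lambda>t. y (L (v, t))) has_derivative (\<lambda>r. (r * h v t) * y ?p)) (at t)"
        by simp
      then have "((\<lambda>t. y (L (v, t))) has_real_derivative h v t * y ?p) (at t)"
        unfolding has_field_derivative_def by (rule has_derivative_eq_rhs) (simp add: fun_eq_iff)
      then show "((\<lambda>t. y (L (v, t))) has_real_derivative h v t * y ?p) (at t within {0..1})"
        by (rule has_field_derivative_at_within)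
    qed
    then show ?thesis by (simp add: F_def Lconv)
  qed
  ultimately show "\<exists>V g. open V \<and> x \<in> V \<and> smooth_on (X \<inter> V) g \<and> (\<forall>v\<in>X \<inter> V. 0 < v $ k \<longrightarrow> g v = y v)"
    using B by (intro exI[of _ B] exI[of _ F]) auto
qed


section \<open>Charts and natural bundles\<close>

text \<open>Charts are pairs; quantifiers over them are kept intact.\<close>

declare split_paired_All [simp del] split_paired_Ex [simp del]

abbreviation cimg :: "('m, 'n::finite) chart \<Rightarrow> 'm set \<Rightarrow> (real ^ 'n) set" where
  "cimg c S \<equiv> snd c ` (fst c \<inter> S)"

lemma fadd_apply [simp]: "fadd u v c = u c + v c" by (simp add: fadd_def)
lemma fscale_apply [simp]: "fscale a u c = a *\<^sub>R u c" by (simp add: fscale_def)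
lemma fzero_apply [simp]: "fzero c = 0" by (simp add: fzero_def)

definition const_field :: "('m, 'n::finite) chart set \<Rightarrow> ('m, 'n) chart \<Rightarrow> real ^ 'n \<Rightarrow> 'm \<Rightarrow> ('m, 'n) tvec" where
  "const_field A c u p d = (if d \<in> A \<and> p \<in> fst c \<inter> fst d then jac c d p u else 0)"

lemma coord_field_const_field: "coord_field A c j = const_field A c (axis j 1)"
  by (simp add: fun_eq_iff coord_field_def const_field_def)

locale boundary_manifold =
  fixes k :: "'n::finite" and A :: "('m::{t2_space,second_countable_topology}, 'n) chart set"
  assumes atlas: "smooth_atlas k A"
begin

abbreviation "M \<equiv> intr k A"

lemma chartD: "c \<in> A \<Longrightarrow> is_chart k c"
  using atlas by (simp add: smooth_atlas_def)

lemma chart_open: "c \<in> A \<Longrightarrow> open (fst c)"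
  using chartD by (auto simp: is_chart_def)

lemma chart_exists: "\<exists>c\<in>A. p \<in> fst c"
  using atlas by (auto simp: smooth_atlas_def)

lemma cinv_snd [simp]: "c \<in> A \<Longrightarrow> p \<in> fst c \<Longrightarrow> cinv c (snd c p) = p"
  using chartD[of c] by (auto simp: is_chart_def homeomorphism_def)

lemma snd_cinv [simp]: "c \<in> A \<Longrightarrow> x \<in> cimg c S \<Longrightarrow> snd c (cinv c x) = x"
  by auto

lemma cinv_in: "c \<in> A \<Longrightarrow> x \<in> cimg c S \<Longrightarrow> cinv c x \<in> fst c \<inter> S"
  by auto

lemma hopen_cimg: 
  assumes c: "c \<in> A" and S: "open S"
  shows "hopen k (cimg c S)"
proof -
  have "is_chart k c" using chartD[OF c] .
  then have X: "hopen k (snd c ` fst c)" and cont: "continuous_on (snd c ` fst c) (cinv c)"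
    by (auto simp: is_chart_def homeomorphism_def)
  have "cimg c S = snd c ` fst c \<inter> cinv c -` S"
    using c by auto
  then have "openin (top_of_set (snd c ` fst c)) (cimg c S)"
    using continuous_openin_preimage_gen[OF cont S] by simp
  then show ?thesis using X openin_trans by blast
qed

lemma hopen_chart: "c \<in> A \<Longrightarrow> hopen k (snd c ` fst c)"
  using hopen_cimg[of c UNIV] by simp

lemma at_chart: "c \<in> A \<Longrightarrow> p \<in> fst c \<Longrightarrow> at (snd c p) within snd c ` fst c = at (snd c p) within half_space k"
  by (rule at_within_hopen[OF hopen_chart]) auto

lemma transition_smooth:
  assumes "c \<in> A" "d \<in> A" shows "smooth_on (cimg c (fst d)) (\<lambda>x. snd d (cinv c x))"
  using atlas assms by (auto simp: smooth_atlas_def o_def)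

lemma transition_in: "c \<in> A \<Longrightarrow> d \<in> A \<Longrightarrow> x \<in> cimg c (S \<inter> fst d) \<Longrightarrow> snd d (cinv c x) \<in> cimg d (S \<inter> fst c)"
  by auto

lemma jac_eq:
  assumes "c \<in> A" "d \<in> A" "p \<in> fst c" "p \<in> fst d"
  shows "jac c d p = hD k (\<lambda>x. snd d (cinv c x)) (snd c p)"
proof -
  have "snd c p \<in> cimg c (fst d)" using assms by auto
  then show ?thesis
    by (simp only: jac_def hD_def o_def at_within_hopen[OF hopen_cimg[OF assms(1) chart_open[OF assms(2)]]])
qed

lemma jac_linear:
  assumes "c \<in> A" "d \<in> A" "p \<in> fst c" "p \<in> fst d"
  shows "bounded_linear (jac c d p)"
  unfolding jac_eq[OF assms]
  by (rule hD_linear[OF transition_smooth[OF assms(1,2)] hopen_cimg[OF assms(1) chart_open[OF assms(2)]]])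
     (use assms in auto)

lemma jac_self [simp]:
  assumes "c \<in> A" "p \<in> fst c" shows "jac c c p v = v"
proof -
  have x: "snd c p \<in> snd c ` fst c" using assms by auto
  have "jac c c p v = hD k (\<lambda>x. x) (snd c p) v"
    unfolding jac_eq[OF assms(1,1,2,2)]
    by (rule fun_cong[OF hD_cong[OF hopen_chart[OF assms(1)] x]]) (use assms in auto)
  also have "\<dots> = v"
    by (rule fun_cong[OF hD_eqI[OF has_derivative_ident hopen_in_half_space[OF hopen_chart[OF assms(1)] x]]])
  finally show ?thesis .
qed

lemma jac_comp:
  assumes "c \<in> A" "d \<in> A" "e \<in> A" "p \<in> fst c" "p \<in> fst d" "p \<in> fst e"
  shows "jac d e p (jac c d p v) = jac c e p v"
proof -
  let ?f = "\<lambda>x. snd d (cinv c x)" and ?g = "\<lambda>x. snd e (cinv d x)"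
  let ?S = "cimg c (fst e \<inter> fst d)" and ?T = "cimg d (fst e \<inter> fst c)"
  have hS: "hopen k ?S" and hT: "hopen k ?T" 
    by (intro hopen_cimg assms open_Int chart_open)+
  have x: "snd c p \<in> ?S" using assms by auto
  have f: "smooth_on ?S ?f" 
    by (rule smooth_on_subset[OF transition_smooth[OF assms(1,2)]]) auto
  have g: "smooth_on ?T ?g" 
    by (rule smooth_on_subset[OF transition_smooth[OF assms(2,3)]]) auto
  have "hD k (\<lambda>x. snd e (cinv c x)) (snd c p) = hD k (\<lambda>x. ?g (?f x)) (snd c p)"
    by (rule hD_cong[OF hS x]) (use assms in auto)
  also have "\<dots> = (\<lambda>v. hD k ?g (?f (snd c p)) (hD k ?f (snd c p) v))"
    by (rule hD_compose[OF f g hS hT transition_in[OF assms(1,2)] x])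
  finally show ?thesis
    using assms by (simp add: jac_eq)
qed

text \<open>Membership in the boundary is defined by one chart; it can be tested in any chart.  If \<open>p\<close> had an interior
  image in another chart, then the boundary coordinate would have a local minimum there, so its
  differential would vanish, which is impossible for a component of an invertible Jacobian.\<close>

lemma bdry_iff:
  assumes c: "c \<in> A" "p \<in> fst c"
  shows "p \<in> bdry k A \<longleftrightarrow> snd c p $ k = 0"
proof
  assume "snd c p $ k = 0"
  then show "p \<in> bdry k A" using c by (auto simp: bdry_def)
next
  assume "p \<in> bdry k A"
  then obtain d where d: "d \<in> A" "p \<in> fst d" "snd d p $ k = 0" by (auto simp: bdry_def)
  show "snd c p $ k = 0"
  proof (rule ccontr)
    assume ne: "snd c p $ k \<noteq> 0"
    let ?X = "cimg c (fst d)"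
    have X: "hopen k ?X" using hopen_cimg[OF c(1) chart_open[OF d(1)]] .
    have x: "snd c p \<in> ?X" using c d by auto
    have pos: "0 < snd c p $ k" using ne hopen_nonneg[OF X x] by simp
    let ?O = "?X \<inter> {x. 0 < x $ k}" and ?f = "\<lambda>x. snd d (cinv c x) $ k"
    have O: "open ?O" "snd c p \<in> ?O" using hopen_interior_open[OF X] x pos by auto
    have f: "smooth_on ?X ?f" by (rule smooth_on_vec_nth[OF transition_smooth[OF c(1) d(1)]])
    have "at (snd c p) within half_space k = at (snd c p) within ?O"
      using at_within_hopen[OF hopen_Int_open[OF X], of "{x. 0 < x $ k}"] O 
      by (simp add: open_Collect_less continuous_on_component)
    also have "\<dots> = at (snd c p)" using at_within_open[OF O(2,1)] .
    finally have "(?f has_derivative hD k ?f (snd c p)) (at (snd c p))"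
      using smooth_on_has_derivative[OF f X x] by simp
    moreover have "\<forall>y\<in>?O. ?f (snd c p) \<le> ?f y"
    proof
      fix y assume "y \<in> ?O"
      then have "snd d (cinv c y) \<in> snd d ` fst d" using c by auto
      then have "0 \<le> ?f y" using hopen_nonneg[OF hopen_chart[OF d(1)]] by blast
      then show "?f (snd c p) \<le> ?f y" using c d by simp
    qed
    ultimately have "hD k ?f (snd c p) = (\<lambda>v. 0)"
      using differential_zero_maxmin[OF O(2,1)] by blast
    then have "hD k ?f (snd c p) v = 0" for v by (rule fun_cong)
    then have "jac c d p v $ k = 0" for v
      unfolding jac_eq[OF c(1) d(1) c(2) d(2)]
      using hD_vec_nth[OF transition_smooth[OF c(1) d(1)] X x, of k v] by metis
    then have "axis k (1::real) $ k = 0"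
      using jac_comp[OF d(1) c(1) d(1) d(2) c(2) d(2), of "axis k 1"] d by (metis jac_self)
    then show False by (simp add: axis_def)
  qed
qed

lemma intr_iff:
  assumes "c \<in> A" "p \<in> fst c"
  shows "p \<in> M \<longleftrightarrow> 0 < snd c p $ k"
  using bdry_iff[OF assms] hopen_nonneg[OF hopen_chart[OF assms(1)], of "snd c p"] assms
  by (auto simp: intr_def)

lemma cimg_intr_iff: "c \<in> A \<Longrightarrow> x \<in> cimg c (U \<inter> M) \<longleftrightarrow> x \<in> cimg c U \<and> 0 < x $ k"
  using intr_iff[of c "cinv c x"] by auto

lemma open_intr: "open M"
proof -
  have "p \<in> M \<longleftrightarrow> p \<in> (\<Union>c\<in>A. fst c \<inter> snd c -` {x. 0 < x $ k})" for p
  proof -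
    obtain c where "c \<in> A" "p \<in> fst c" using chart_exists by blast
    then show ?thesis using intr_iff[of _ p] by fastforce
  qed
  then have "M = (\<Union>c\<in>A. fst c \<inter> snd c -` {x. 0 < x $ k})" by (rule set_eqI)
  moreover have "open (fst c \<inter> snd c -` {x. 0 < x $ k})" if "c \<in> A" for c
  proof (rule continuous_open_preimage)
    show "continuous_on (fst c) (snd c)"
      using chartD[OF that] by (auto simp: is_chart_def homeomorphism_def)
  qed (use that in \<open>auto simp: chart_open open_Collect_less continuous_on_component\<close>)
  ultimately show ?thesis by auto
qed

text \<open>Changes of coordinates preserve the boundary, hence their derivatives preserve its tangent hyperplane.\<close>

lemma jac_bdry:
  assumes c: "c \<in> A" "p \<in> fst c" and d: "d \<in> A" "p \<in> fst d" and p: "p \<in> bdry k A" and v: "v $ k = 0"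
  shows "jac c d p v $ k = 0"
proof -
  let ?X = "cimg c (fst d)" and ?f = "\<lambda>x. snd d (cinv c x) $ k"
  have X: "hopen k ?X" using hopen_cimg[OF c(1) chart_open[OF d(1)]] .
  have x: "snd c p \<in> ?X" using c d by auto
  have f: "smooth_on ?X ?f" by (rule smooth_on_vec_nth[OF transition_smooth[OF c(1) d(1)]])
  have "?f y = 0" if "y \<in> ?X" "y $ k = 0" for y
    using that c d bdry_iff[OF c(1), of "cinv c y"] bdry_iff[OF d(1), of "cinv c y"] by auto
  then obtain g where g: "smooth_on ?X g" "\<And>y. y \<in> ?X \<Longrightarrow> ?f y = y $ k * g y"
    using smooth_divide_boundary_coordinate[OF X f] by blast
  have "hD k ?f (snd c p) v = 0"
    using hD_boundary_vanishing[OF X g x] v p bdry_iff[OF c] by simp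
  then show ?thesis
    unfolding jac_eq[OF c(1) d(1) c(2) d(2)]
    using hD_vec_nth[OF transition_smooth[OF c(1) d(1)] X x, of k v] by metis
qed

lemma smooth_fun_chartD: "smooth_fun A S f \<Longrightarrow> c \<in> A \<Longrightarrow> smooth_on (cimg c S) (\<lambda>x. f (cinv c x))"
  by (simp add: smooth_fun_def o_def)

lemma smooth_fun_subset: "smooth_fun A S f \<Longrightarrow> T \<subseteq> S \<Longrightarrow> smooth_fun A T f"
  unfolding smooth_fun_def by (meson Int_mono image_mono order_refl smooth_on_subset)

lemma smooth_comps_subset: "smooth_comps A S f \<Longrightarrow> T \<subseteq> S \<Longrightarrow> smooth_comps A T f"
  unfolding smooth_comps_def by (meson Int_mono image_mono order_refl smooth_on_subset)

lemma vfield_subset: "vfield A S \<xi> \<Longrightarrow> T \<subseteq> S \<Longrightarrow> vfield A T \<xi>"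
  using smooth_comps_subset[of S \<xi> T] by (auto simp: vfield_def)

lemma vfield_chartD: "vfield A S \<xi> \<Longrightarrow> c \<in> A \<Longrightarrow> smooth_on (cimg c S) (\<lambda>x. \<xi> (cinv c x) c)"
  by (simp add: vfield_def smooth_comps_def)

lemma vfield_tangent: "vfield A S \<xi> \<Longrightarrow> p \<in> S \<Longrightarrow> \<xi> p \<in> tangent_space A p"
  by (simp add: vfield_def)

lemma smooth_fun_chartI:
  assumes c: "c \<in> A" "S \<subseteq> fst c" and f: "smooth_on (cimg c S) (\<lambda>x. f (cinv c x))"
  shows "smooth_fun A S f"
  unfolding smooth_fun_def o_def
proof
  fix d assume d: "d \<in> A"
  have "smooth_on (cimg d S) (\<lambda>x. f (cinv c (snd c (cinv d x))))"
  proof (rule smooth_on_compose[OF smooth_on_subset[OF transition_smooth[OF d c(1)]] f])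
    show "cimg d S \<subseteq> cimg d (fst c)" using c by auto
    show "snd c (cinv d x) \<in> cimg c S" if "x \<in> cimg d S" for x using that c d by auto
  qed
  then show "smooth_on (cimg d S) (\<lambda>x. f (cinv d x))"
  proof (rule smooth_on_cong)
    fix x assume "x \<in> cimg d S"
    then have "cinv d x \<in> fst c" using cinv_in[OF d] c(2) by blast
    then show "f (cinv c (snd c (cinv d x))) = f (cinv d x)" using c(1) by simp
  qed
qed

lemma tangent_transform:
  "v \<in> tangent_space A p \<Longrightarrow> c \<in> A \<Longrightarrow> d \<in> A \<Longrightarrow> p \<in> fst c \<Longrightarrow> p \<in> fst d \<Longrightarrow> v d = jac c d p (v c)"
  unfolding tangent_space_def by blast

lemma tangent_supp: "v \<in> tangent_space A p \<Longrightarrow> \<not> (c \<in> A \<and> p \<in> fst c) \<Longrightarrow> v c = 0"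
  unfolding tangent_space_def fibre_supp_def by blast

lemma dens_supp: "s \<in> dens_space A w p \<Longrightarrow> \<not> (c \<in> A \<and> p \<in> fst c) \<Longrightarrow> s c = 0"
  unfolding dens_space_def fibre_supp_def by blast

text \<open>For a set inside one chart domain, smoothness in that chart suffices: the components in other charts are
  obtained by the Jacobian, which depends smoothly on the point.\<close>

lemma vfield_chartI:
  assumes c: "c \<in> A" "S \<subseteq> fst c" "open S" and t: "\<And>p. p \<in> S \<Longrightarrow> \<xi> p \<in> tangent_space A p"
    and s: "smooth_on (cimg c S) (\<lambda>x. \<xi> (cinv c x) c)"
  shows "vfield A S \<xi>"
  unfolding vfield_def smooth_comps_def
proof (intro conjI ballI)
  fix d assume d: "d \<in> A"
  let ?T = "cimg c (S \<inter> fst d)"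
  have G: "smooth_on ?T (\<lambda>x. hD k (\<lambda>x. snd d (cinv c x)) x (\<xi> (cinv c x) c))"
  proof (rule smooth_on_hD_comp)
    show "smooth_on ?T (\<lambda>x. snd d (cinv c x))"
      by (rule smooth_on_subset[OF transition_smooth[OF c(1) d]]) auto
    show "hopen k ?T" by (intro hopen_cimg c d open_Int chart_open)
    show "smooth_on ?T (\<lambda>x. \<xi> (cinv c x) c)"
      by (rule smooth_on_subset[OF s]) auto
  qed
  have "smooth_on (cimg d S) (\<lambda>y. hD k (\<lambda>x. snd d (cinv c x)) (snd c (cinv d y)) (\<xi> (cinv c (snd c (cinv d y))) c))"
  proof (rule smooth_on_compose[OF smooth_on_subset[OF transition_smooth[OF d c(1)]] G])
    show "cimg d S \<subseteq> cimg d (fst c)" using c by auto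
    show "snd c (cinv d x) \<in> ?T" if "x \<in> cimg d S" for x using that c d by auto
  qed
  then show "smooth_on (cimg d S) (\<lambda>x. \<xi> (cinv d x) d)"
  proof (rule smooth_on_cong)
    fix y assume "y \<in> cimg d S"
    then obtain p where p: "p \<in> S" "p \<in> fst d" "y = snd d p" by auto
    have "\<xi> p d = jac c d p (\<xi> p c)"
      using tangent_transform[OF t[OF p(1)] c(1) d] p c by auto
    moreover have "p \<in> fst c" using p c by auto
    ultimately show "hD k (\<lambda>x. snd d (cinv c x)) (snd c (cinv d y)) (\<xi> (cinv c (snd c (cinv d y))) c) = \<xi> (cinv d y) d"
      using p c d by (simp add: jac_eq)
  qed
qed (rule t)

lemma tangent_add: 
  assumes "u \<in> tangent_space A p" "v \<in> tangent_space A p" shows "fadd u v \<in> tangent_space A p"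
proof -
  have "fadd u v d = jac c d p (fadd u v c)" if "c \<in> A" "d \<in> A" "p \<in> fst c \<inter> fst d" for c d
    using that tangent_transform[OF assms(1), of c d] tangent_transform[OF assms(2), of c d]
      linear_add[OF bounded_linear.linear[OF jac_linear[of c d p]]] by simp
  moreover have "fibre_supp A p (fadd u v)"
    using assms by (simp add: tangent_space_def fibre_supp_def)
  ultimately show ?thesis unfolding tangent_space_def by blast
qed

lemma tangent_scale: 
  assumes "u \<in> tangent_space A p" shows "fscale a u \<in> tangent_space A p"
proof -
  have "fscale a u d = jac c d p (fscale a u c)" if "c \<in> A" "d \<in> A" "p \<in> fst c \<inter> fst d" for c d
    using that tangent_transform[OF assms(1), of c d]
      linear_cmul[OF bounded_linear.linear[OF jac_linear[of c d p]]] by simp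
  moreover have "fibre_supp A p (fscale a u)"
    using assms by (simp add: tangent_space_def fibre_supp_def)
  ultimately show ?thesis unfolding tangent_space_def by blast
qed

lemma tangent_eqI:
  assumes "u \<in> tangent_space A p" "v \<in> tangent_space A p" "c \<in> A" "p \<in> fst c" "u c = v c"
  shows "u = v"
proof
  fix d show "u d = v d"
  proof (cases "d \<in> A \<and> p \<in> fst d")
    case True
    then show ?thesis
      using tangent_transform[OF assms(1,3), of d] tangent_transform[OF assms(2,3), of d] assms(4,5)
      by simp
  next
    case False
    then show ?thesis using tangent_supp[OF assms(1)] tangent_supp[OF assms(2)] by simp
  qed
qed

lemma vfield_add: "vfield A S \<xi> \<Longrightarrow> vfield A S \<eta> \<Longrightarrow> vfield A S (\<lambda>p. fadd (\<xi> p) (\<eta> p))"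
  by (simp add: vfield_def smooth_comps_def tangent_add smooth_on_add)

lemma vfield_scale: "smooth_fun A S f \<Longrightarrow> vfield A S \<xi> \<Longrightarrow> vfield A S (\<lambda>p. fscale (f p) (\<xi> p))"
  by (simp add: vfield_def smooth_comps_def smooth_fun_def o_def tangent_scale smooth_on_scaleR)

lemma const_field_self [simp]: "c \<in> A \<Longrightarrow> p \<in> fst c \<Longrightarrow> const_field A c u p c = u"
  by (simp add: const_field_def)

lemma const_field_tangent:
  assumes "c \<in> A" "p \<in> fst c" shows "const_field A c u p \<in> tangent_space A p"
proof -
  have "const_field A c u p e = jac d e p (const_field A c u p d)"
    if "d \<in> A" "e \<in> A" "p \<in> fst d \<inter> fst e" for d e
    using that assms jac_comp[of c d e p u] by (simp add: const_field_def)
  moreover have "fibre_supp A p (const_field A c u p)"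
    by (simp add: fibre_supp_def const_field_def)
  ultimately show ?thesis unfolding tangent_space_def by blast
qed

lemma const_field_vfield:
  assumes "c \<in> A" "open S" "S \<subseteq> fst c" shows "vfield A S (const_field A c u)"
proof (rule vfield_chartI[OF assms(1,3,2)])
  show "const_field A c u p \<in> tangent_space A p" if "p \<in> S" for p
    by (rule const_field_tangent) (use assms that in auto)
  show "smooth_on (cimg c S) (\<lambda>x. const_field A c u (cinv c x) c)"
  proof (rule smooth_on_cong[OF smooth_on_const[of _ u]])
    show "u = const_field A c u (cinv c x) c" if "x \<in> cimg c S" for x
      using cinv_in[OF assms(1) that] assms(1) by simp
  qed
qed

lemma const_field_eq:
  "v \<in> tangent_space A p \<Longrightarrow> c \<in> A \<Longrightarrow> p \<in> fst c \<Longrightarrow> const_field A c (v c) p = v"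
  by (rule tangent_eqI[OF const_field_tangent]) auto

lemma const_field_bdry:
  assumes "c \<in> A" "u $ k = 0" "open S" "S \<subseteq> fst c"
  shows "bdry_vfield k A S (const_field A c u)"
proof -
  have "const_field A c u p d $ k = 0" if "d \<in> A" "p \<in> fst d" "p \<in> S \<inter> bdry k A" for d p
    using that assms jac_bdry[OF assms(1) _ that(1,2) _ assms(2)] by (auto simp: const_field_def)
  moreover have "const_field A c u p \<in> tangent_space A p" if "p \<in> S" for p
    using const_field_tangent[OF assms(1)] assms(4) that by blast
  ultimately show ?thesis
    unfolding bdry_vfield_def bdry_tangent_space_def
    using const_field_vfield[OF assms(1,3,4)] by blast
qed

lemma bdry_tangent_chart:
  assumes "c \<in> A" "p \<in> fst c" "u \<in> bdry_tangent_space k A p" shows "u c $ k = 0" "u \<in> tangent_space A p"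
  using assms by (auto simp: bdry_tangent_space_def)

text \<open>The chart chosen in the definition of the differential is arbitrary, by the chain rule.\<close>

lemma diff_fun_chart:
  assumes f: "smooth_fun A S f" "open S" "p \<in> S" and c: "c \<in> A" "p \<in> fst c" and v: "v \<in> tangent_space A p"
  shows "diff_fun A f p v = hD k (\<lambda>x. f (cinv c x)) (snd c p) (v c)"
proof -
  define d where "d = (SOME d. d \<in> A \<and> p \<in> fst d)"
  have d: "d \<in> A" "p \<in> fst d"
    using someI_ex[of "\<lambda>d. d \<in> A \<and> p \<in> fst d"] chart_exists[of p] unfolding d_def by blast+
  let ?X = "cimg c (S \<inter> fst d)" and ?Y = "cimg d (S \<inter> fst c)"
  have X: "hopen k ?X" and Y: "hopen k ?Y" by (intro hopen_cimg c d f open_Int chart_open)+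
  have x: "snd c p \<in> ?X" using c d f by auto
  have "hD k (\<lambda>x. f (cinv c x)) (snd c p) = hD k (\<lambda>x. f (cinv d (snd d (cinv c x)))) (snd c p)"
    by (rule hD_cong[OF X x]) (use c d in auto)
  also have "\<dots> = (\<lambda>w. hD k (\<lambda>y. f (cinv d y)) (snd d (cinv c (snd c p))) (hD k (\<lambda>x. snd d (cinv c x)) (snd c p) w))"
  proof (rule hD_compose[OF _ _ X Y transition_in[OF c(1) d(1)] x])
    show "smooth_on ?X (\<lambda>x. snd d (cinv c x))"
      by (rule smooth_on_subset[OF transition_smooth[OF c(1) d(1)]]) auto
    show "smooth_on ?Y (\<lambda>y. f (cinv d y))"
      by (rule smooth_on_subset[OF smooth_fun_chartD[OF f(1) d(1)]]) auto
  qed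
  finally have "hD k (\<lambda>x. f (cinv c x)) (snd c p) (v c) = hD k (\<lambda>y. f (cinv d y)) (snd d p) (v d)"
    using c d tangent_transform[OF v c(1) d(1) c(2) d(2)] by (simp add: jac_eq)
  moreover have "diff_fun A f p v = hD k (\<lambda>y. f (cinv d y)) (snd d p) (v d)"
    unfolding diff_fun_def Let_def d_def[symmetric] at_chart[OF d] hD_def by (simp add: o_def)
  ultimately show ?thesis by simp
qed

lemma diff_fun_smooth:
  assumes f: "smooth_fun A S f" "open S" and \<xi>: "vfield A S \<xi>"
  shows "smooth_fun A S (\<lambda>p. diff_fun A f p (\<xi> p))"
  unfolding smooth_fun_def o_def
proof
  fix c assume c: "c \<in> A"
  show "smooth_on (cimg c S) (\<lambda>x. diff_fun A f (cinv c x) (\<xi> (cinv c x)))"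
  proof (rule smooth_on_cong)
    show "smooth_on (cimg c S) (\<lambda>x. hD k (\<lambda>x. f (cinv c x)) x (\<xi> (cinv c x) c))"
      by (intro smooth_on_hD_comp smooth_fun_chartD[OF f(1) c] vfield_chartD[OF \<xi> c] hopen_cimg c f)
    show "hD k (\<lambda>x. f (cinv c x)) x (\<xi> (cinv c x) c) = diff_fun A f (cinv c x) (\<xi> (cinv c x))"
      if "x \<in> cimg c S" for x
      using that c diff_fun_chart[OF f _ c _ vfield_tangent[OF \<xi>]] by auto
  qed
qed

lemma chart_coordinate_smooth: "c \<in> A \<Longrightarrow> smooth_fun A (fst c) (\<lambda>p. snd c p $ k)"
  by (rule smooth_fun_chartI[OF _ subset_refl]) (auto intro: smooth_on_cong[OF smooth_on_nth[of _ k]])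

lemma diff_chart_coordinate:
  assumes "c \<in> A" "p \<in> fst c" "v \<in> tangent_space A p"
  shows "diff_fun A (\<lambda>p. snd c p $ k) p v = v c $ k"
proof -
  have x: "snd c p \<in> snd c ` fst c" using assms by auto
  have "hD k (\<lambda>x. snd c (cinv c x) $ k) (snd c p) = hD k (\<lambda>x. x $ k) (snd c p)"
    by (rule hD_cong[OF hopen_chart[OF assms(1)] x]) (use assms in auto)
  then show ?thesis
    using diff_fun_chart[OF chart_coordinate_smooth[OF assms(1)] chart_open[OF assms(1)] assms(2,1,2,3)]
      hD_nth[OF hopen_in_half_space[OF hopen_chart[OF assms(1)] x]] by simp
qed

lemma chart_coordinate_defining:
  assumes c: "c \<in> A" shows "defining_fun k A (fst c) (\<lambda>p. snd c p $ k)"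
  unfolding defining_fun_def
proof (intro conjI ballI)
  show "open (fst c)" "smooth_fun A (fst c) (\<lambda>p. snd c p $ k)"
    using chart_open[OF c] chart_coordinate_smooth[OF c] by auto
  show "{p \<in> fst c. snd c p $ k = 0} = fst c \<inter> bdry k A" using bdry_iff[OF c] by auto
  fix p assume "p \<in> fst c \<inter> bdry k A"
  then show "\<exists>v\<in>tangent_space A p. diff_fun A (\<lambda>p. snd c p $ k) p v \<noteq> 0"
    using diff_chart_coordinate[OF c] const_field_tangent[OF c]
    by (intro bexI[of _ "const_field A c (axis k 1) p"]) (auto simp: c axis_def)
qed

text \<open>Every defining function is compared with the boundary coordinate of a chart.  The quotient exists by
  Hadamard's lemma; on the boundary it is non-zero because there it is the normal derivative of \<open>\<rho>\<close>.\<close>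

lemma defining_fun_factor:
  assumes \<rho>: "defining_fun k A U \<rho>" and c: "c \<in> A"
  shows "\<exists>h. smooth_on (cimg c U) h \<and> (\<forall>x\<in>cimg c U. \<rho> (cinv c x) = x $ k * h x \<and> h x \<noteq> 0)"
proof -
  have U: "open U" "smooth_fun A U \<rho>" "{p \<in> U. \<rho> p = 0} = U \<inter> bdry k A"
    and nz: "\<And>p. p \<in> U \<inter> bdry k A \<Longrightarrow> \<exists>v\<in>tangent_space A p. diff_fun A \<rho> p v \<noteq> 0"
    using \<rho> by (auto simp: defining_fun_def)
  have X: "hopen k (cimg c U)" using hopen_cimg[OF c U(1)] .
  have 0: "\<rho> (cinv c x) = 0 \<longleftrightarrow> x $ k = 0" if "x \<in> cimg c U" for x
  proof -
    have "cinv c x \<in> fst c" "cinv c x \<in> U" "snd c (cinv c x) = x" using that c by auto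
    then show ?thesis using U(3) bdry_iff[OF c, of "cinv c x"] by fastforce
  qed
  obtain h where h: "smooth_on (cimg c U) h" "\<And>x. x \<in> cimg c U \<Longrightarrow> \<rho> (cinv c x) = x $ k * h x"
    using smooth_divide_boundary_coordinate[OF X smooth_fun_chartD[OF U(2) c]] 0 by blast
  have "h x \<noteq> 0" if x: "x \<in> cimg c U" for x
  proof (cases "x $ k = 0")
    case False
    then show ?thesis using 0[OF x] h(2)[OF x] by auto
  next
    case True
    obtain p where p: "p \<in> U" "p \<in> fst c" "x = snd c p" using x by auto
    then have "p \<in> bdry k A" using True bdry_iff[OF c] by auto
    then obtain v where v: "v \<in> tangent_space A p" "diff_fun A \<rho> p v \<noteq> 0" using nz p by blast
    then show ?thesis
      using diff_fun_chart[OF U(2,1) p(1) c p(2) v(1)] hD_boundary_vanishing[OF X h x] True p(3) by auto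
  qed
  with h show ?thesis by blast
qed

lemma dens_eqI:
  assumes "s \<in> dens_space A w p" "t \<in> dens_space A w p" "\<And>c. c \<in> A \<Longrightarrow> p \<in> fst c \<Longrightarrow> s c = t c"
  shows "s = t"
proof
  fix c show "s c = t c"
  proof (cases "c \<in> A \<and> p \<in> fst c")
    case False
    then show ?thesis using dens_supp[OF assms(1)] dens_supp[OF assms(2)] by simp
  qed (simp add: assms(3))
qed

lemma dens_transform:
  "s \<in> dens_space A w p \<Longrightarrow> c \<in> A \<Longrightarrow> d \<in> A \<Longrightarrow> p \<in> fst c \<Longrightarrow> p \<in> fst d \<Longrightarrow>
    s d = \<bar>det (matrix (jac c d p))\<bar> powr (w / (real CARD('n) + 1)) * s c"
  unfolding dens_space_def by blast

lemma dens_scale: 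
  assumes "s \<in> dens_space A w p" shows "fscale a s \<in> dens_space A w p"
proof -
  have "fscale a s d = \<bar>det (matrix (jac c d p))\<bar> powr (w / (real CARD('n) + 1)) * fscale a s c"
    if "c \<in> A" "d \<in> A" "p \<in> fst c \<inter> fst d" for c d
    using that dens_transform[OF assms, of c d] by simp
  moreover have "fibre_supp A p (fscale a s)"
    using assms by (simp add: dens_space_def fibre_supp_def)
  ultimately show ?thesis unfolding dens_space_def by blast
qed

end


section \<open>Connections in charts\<close>

locale connection_manifold = boundary_manifold k A
  for k :: "'n::finite" and A :: "('m::{t2_space,second_countable_topology}, 'n) chart set" +
  fixes D :: "('m, 'n) conn"
  assumes lin: "linear_connection A (intr k A) D"
begin

lemma conn_vfield:
  assumes "open W" "W \<subseteq> M" "vfield A W \<xi>" "vfield A W \<eta>"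
  shows "vfield A W (D \<xi> \<eta>)"
  using lin[unfolded linear_connection_def, rule_format, OF assms(1,2), THEN conjunct1] assms by blast

lemma conn_cong:
  assumes "open W" "W \<subseteq> M" "vfield A W \<xi>" "vfield A W \<xi>'" "vfield A W \<eta>" "vfield A W \<eta>'"
    "\<And>q. q \<in> W \<Longrightarrow> \<xi> q = \<xi>' q" "\<And>q. q \<in> W \<Longrightarrow> \<eta> q = \<eta>' q" "p \<in> W"
  shows "D \<xi> \<eta> p = D \<xi>' \<eta>' p"
  using lin[unfolded linear_connection_def, rule_format, OF assms(1,2), THEN conjunct2, THEN conjunct1,
      rule_format, OF assms(3-6) _ assms(9)] assms(7,8) by blast

lemma conn_add:
  assumes "open W" "W \<subseteq> M" "vfield A W \<xi>" "vfield A W \<xi>'" "vfield A W \<eta>" "p \<in> W"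
  shows "D (\<lambda>q. fadd (\<xi> q) (\<xi>' q)) \<eta> p = fadd (D \<xi> \<eta> p) (D \<xi>' \<eta> p)"
    and "D \<eta> (\<lambda>q. fadd (\<xi> q) (\<xi>' q)) p = fadd (D \<eta> \<xi> p) (D \<eta> \<xi>' p)"
proof -
  note * = lin[unfolded linear_connection_def, rule_format, OF assms(1,2), THEN conjunct2, THEN conjunct2,
      THEN conjunct1, rule_format, OF assms(3-5)]
  show "D (\<lambda>q. fadd (\<xi> q) (\<xi>' q)) \<eta> p = fadd (D \<xi> \<eta> p) (D \<xi>' \<eta> p)"
    using *[THEN conjunct1] assms(6) by blast
  show "D \<eta> (\<lambda>q. fadd (\<xi> q) (\<xi>' q)) p = fadd (D \<eta> \<xi> p) (D \<eta> \<xi>' p)"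
    using *[THEN conjunct2] assms(6) by blast
qed

lemma conn_scale:
  assumes "open W" "W \<subseteq> M" "smooth_fun A W f" "vfield A W \<xi>" "vfield A W \<eta>" "p \<in> W"
  shows "D (\<lambda>q. fscale (f q) (\<xi> q)) \<eta> p = fscale (f p) (D \<xi> \<eta> p)"
    and "D \<xi> (\<lambda>q. fscale (f q) (\<eta> q)) p = fadd (fscale (diff_fun A f p (\<xi> p)) (\<eta> p)) (fscale (f p) (D \<xi> \<eta> p))"
proof -
  note * = lin[unfolded linear_connection_def, rule_format, OF assms(1,2), THEN conjunct2, THEN conjunct2,
      THEN conjunct2, rule_format, OF assms(3-5)]
  show "D (\<lambda>q. fscale (f q) (\<xi> q)) \<eta> p = fscale (f p) (D \<xi> \<eta> p)"
    using *[THEN conjunct1] assms(6) by blast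
  show "D \<xi> (\<lambda>q. fscale (f q) (\<eta> q)) p = fadd (fscale (diff_fun A f p (\<xi> p)) (\<eta> p)) (fscale (f p) (D \<xi> \<eta> p))"
    using *[THEN conjunct2] assms(6) by blast
qed

text \<open>Sums over a part \<open>F\<close> of the frame allow induction, since additivity of a connection is stated for two fields.\<close>

definition frame_part :: "('m, 'n) chart \<Rightarrow> 'n set \<Rightarrow> ('m \<Rightarrow> ('m, 'n) tvec) \<Rightarrow> 'm \<Rightarrow> ('m, 'n) tvec" where
  "frame_part c F \<xi> p = (\<lambda>d. \<Sum>i\<in>F. \<xi> p c $ i *\<^sub>R coord_field A c i p d)"

lemma frame_part_insert:
  "i \<notin> F \<Longrightarrow> frame_part c (insert i F) \<xi> =
    (\<lambda>p. fadd (fscale (\<xi> p c $ i) (coord_field A c i p)) (frame_part c F \<xi> p))"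
  by (simp add: frame_part_def fun_eq_iff)

lemma component_smooth:
  assumes "c \<in> A" "W \<subseteq> fst c" "vfield A W \<xi>"
  shows "smooth_fun A W (\<lambda>p. \<xi> p c $ i)"
  by (rule smooth_fun_chartI[OF assms(1,2) smooth_on_vec_nth[OF vfield_chartD[OF assms(3,1)]]])

lemma coord_field_vfield: "c \<in> A \<Longrightarrow> open W \<Longrightarrow> W \<subseteq> fst c \<Longrightarrow> vfield A W (coord_field A c i)"
  unfolding coord_field_const_field by (rule const_field_vfield)

lemma frame_part_vfield:
  assumes "c \<in> A" "open W" "W \<subseteq> fst c" "vfield A W \<xi>"
  shows "vfield A W (frame_part c F \<xi>)"
proof (induction F rule: infinite_finite_induct)
  case (insert i F)
  show ?case
    unfolding frame_part_insert[OF insert(2)]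
    by (intro vfield_add vfield_scale component_smooth coord_field_vfield assms insert)
next
  case empty
  have eq: "frame_part c {} \<xi> = (\<lambda>p. fscale 0 (\<xi> p))" by (simp add: frame_part_def fun_eq_iff)
  have "smooth_fun A W (\<lambda>_. 0)" by (simp add: smooth_fun_def o_def smooth_on_const)
  then show ?case unfolding eq using vfield_scale[of W "\<lambda>_. 0" \<xi>] assms(4) by blast
qed simp

lemma frame_part_UNIV:
  assumes "c \<in> A" "p \<in> fst c" "\<xi> p \<in> tangent_space A p"
  shows "frame_part c UNIV \<xi> p = \<xi> p"
proof
  fix d
  show "frame_part c UNIV \<xi> p d = \<xi> p d"
  proof (cases "d \<in> A \<and> p \<in> fst d")
    case True
    then have l: "linear (jac c d p)" using jac_linear assms bounded_linear.linear by blast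
    have "frame_part c UNIV \<xi> p d = jac c d p (\<Sum>i\<in>UNIV. \<xi> p c $ i *\<^sub>R axis i 1)"
      using True assms by (simp add: frame_part_def coord_field_def linear_sum[OF l] linear_cmul[OF l])
    also have "(\<Sum>i\<in>UNIV. \<xi> p c $ i *\<^sub>R axis i 1) = \<xi> p c"
      using basis_expansion[of "\<xi> p c"] by (simp add: scalar_mult_eq_scaleR)
    finally show ?thesis using tangent_transform[OF assms(3,1)] True assms(2) by simp
  next
    case False
    then show ?thesis using tangent_supp[OF assms(3)] by (auto simp: frame_part_def coord_field_def)
  qed
qed

definition christoffel :: "('m, 'n) chart \<Rightarrow> 'n \<Rightarrow> 'n \<Rightarrow> real ^ 'n \<Rightarrow> real ^ 'n" where
  "christoffel c i j x = D (coord_field A c i) (coord_field A c j) (cinv c x) c"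

lemma conn_frame_part_left:
  assumes c: "c \<in> A" and W: "open W" "W \<subseteq> M" "W \<subseteq> fst c" and v: "vfield A W \<xi>" "vfield A W \<eta>" and p: "p \<in> W"
  shows "D (frame_part c F \<xi>) \<eta> p c = (\<Sum>i\<in>F. \<xi> p c $ i *\<^sub>R D (coord_field A c i) \<eta> p c)"
proof (induction F rule: infinite_finite_induct)
  case (insert i F)
  note f = coord_field_vfield[OF c W(1,3), of i] component_smooth[OF c W(3) v(1), of i]
  show ?case
    unfolding frame_part_insert[OF insert(2)]
      conn_add(1)[OF W(1,2) vfield_scale[OF f(2,1)] frame_part_vfield[OF c W(1,3) v(1)] v(2) p]
      conn_scale(1)[OF W(1,2) f(2,1) v(2) p]
    using insert by simp
next
  case empty
  have eq: "frame_part c {} \<xi> = (\<lambda>p. fscale 0 (\<xi> p))" by (simp add: frame_part_def fun_eq_iff)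
  have 0: "smooth_fun A W (\<lambda>_. 0)" by (simp add: smooth_fun_def o_def smooth_on_const)
  show ?case unfolding eq conn_scale(1)[OF W(1,2) 0 v p] by simp
qed simp

lemma conn_frame_part_right:
  assumes c: "c \<in> A" and W: "open W" "W \<subseteq> M" "W \<subseteq> fst c" and v: "vfield A W \<xi>" "vfield A W \<eta>" and p: "p \<in> W"
  shows "D \<xi> (frame_part c F \<eta>) p c =
    (\<Sum>j\<in>F. diff_fun A (\<lambda>q. \<eta> q c $ j) p (\<xi> p) *\<^sub>R axis j 1 + \<eta> p c $ j *\<^sub>R D \<xi> (coord_field A c j) p c)"
proof (induction F rule: infinite_finite_induct)
  case (insert j F)
  note f = coord_field_vfield[OF c W(1,3), of j] component_smooth[OF c W(3) v(2), of j]
  have "coord_field A c j p c = axis j 1" using c W(3) p by (simp add: coord_field_const_field subset_iff)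
  then show ?case
    unfolding frame_part_insert[OF insert(2)]
      conn_add(2)[OF W(1,2) vfield_scale[OF f(2,1)] frame_part_vfield[OF c W(1,3) v(2)] v(1) p]
      conn_scale(2)[OF W(1,2) f(2) v(1) f(1) p]
    using insert by simp
next
  case empty
  have eq: "frame_part c {} \<eta> = (\<lambda>p. fscale 0 (\<eta> p))" by (simp add: frame_part_def fun_eq_iff)
  have 0: "smooth_fun A W (\<lambda>_. 0)" by (simp add: smooth_fun_def o_def smooth_on_const)
  have "diff_fun A (\<lambda>_. 0) p (\<xi> p) = 0"
  proof -
    have "snd c p \<in> half_space k"
      using hopen_in_half_space[OF hopen_chart[OF c]] p W(3) by blast
    then show ?thesis
      using diff_fun_chart[OF 0 W(1) p c _ vfield_tangent[OF v(1) p]] W(3) p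
        hD_const[of "snd c p" k "0::real" "\<xi> p c"] by auto
  qed
  then show ?case unfolding eq conn_scale(2)[OF W(1,2) 0 v p] by simp
qed simp

text \<open>Both fields are expanded in the coordinate frame; the first summand comes from the Leibniz rule for the
  components of the second field.\<close>

lemma conn_chart:
  assumes W: "open W" "W \<subseteq> M" and v: "vfield A W \<xi>" "vfield A W \<eta>" and p: "p \<in> W" and c: "c \<in> A" "p \<in> fst c"
  shows "D \<xi> \<eta> p c = hD k (\<lambda>x. \<eta> (cinv c x) c) (snd c p) (\<xi> p c) +
    (\<Sum>i\<in>UNIV. \<Sum>j\<in>UNIV. (\<xi> p c $ i * \<eta> p c $ j) *\<^sub>R christoffel c i j (snd c p))"
proof -
  let ?W = "W \<inter> fst c" and ?x = "snd c p"
  have W': "open ?W" "?W \<subseteq> M" "?W \<subseteq> fst c" "p \<in> ?W" using W p c chart_open[OF c(1)] by auto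
  have v': "vfield A ?W \<xi>" "vfield A ?W \<eta>" using v vfield_subset by blast+
  have X: "hopen k (cimg c ?W)" "?x \<in> cimg c ?W" using hopen_cimg[OF c(1) W'(1)] c p by auto
  note fp = frame_part_vfield[OF c(1) W'(1,3)]
  have t: "\<xi> q \<in> tangent_space A q" "\<eta> q \<in> tangent_space A q" if "q \<in> W" for q
    using v vfield_tangent that by blast+
  have fj: "vfield A ?W (coord_field A c j)" for j using coord_field_vfield[OF c(1) W'(1,3)] .
  have dj: "D \<xi> (coord_field A c j) p c = (\<Sum>i\<in>UNIV. \<xi> p c $ i *\<^sub>R christoffel c i j ?x)" for j
  proof -
    have "D \<xi> (coord_field A c j) p = D (frame_part c UNIV \<xi>) (coord_field A c j) p"
      using conn_cong[where p = p, OF W'(1,2) v'(1) fp[OF v'(1), of UNIV] fj fj] W'(4) frame_part_UNIV[where \<xi> = \<xi>, OF c(1) _ t(1)] by simp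
    then show ?thesis
      using conn_frame_part_left[OF c(1) W'(1-3) v'(1) fj W'(4)] c by (simp add: christoffel_def)
  qed
  have "D \<xi> \<eta> p c = D \<xi> (frame_part c UNIV \<eta>) p c"
    using conn_cong[where p = p, OF W'(1,2) v'(1,1) v'(2) fp[OF v'(2), of UNIV]] W'(4) frame_part_UNIV[where \<xi> = \<eta>, OF c(1) _ t(2)] by simp
  also have "\<dots> = (\<Sum>j\<in>UNIV. diff_fun A (\<lambda>q. \<eta> q c $ j) p (\<xi> p) *\<^sub>R axis j 1 + \<eta> p c $ j *\<^sub>R D \<xi> (coord_field A c j) p c)"
    by (rule conn_frame_part_right[OF c(1) W'(1-3) v' W'(4)])
  also have "\<dots> = (\<Sum>j\<in>UNIV. hD k (\<lambda>x. \<eta> (cinv c x) c) ?x (\<xi> p c) $ j *\<^sub>R axis j 1) + (\<Sum>j\<in>UNIV. \<eta> p c $ j *\<^sub>R D \<xi> (coord_field A c j) p c)"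
    unfolding sum.distrib
    using diff_fun_chart[OF component_smooth[OF c(1) W'(3) v'(2)] W'(1,4) c t(1)[OF p]]
      hD_vec_nth[OF vfield_chartD[OF v'(2) c(1)] X] by simp
  also have "(\<Sum>j\<in>UNIV. hD k (\<lambda>x. \<eta> (cinv c x) c) ?x (\<xi> p c) $ j *\<^sub>R axis j 1) = hD k (\<lambda>x. \<eta> (cinv c x) c) ?x (\<xi> p c)"
    using basis_expansion[of "hD k (\<lambda>x. \<eta> (cinv c x) c) ?x (\<xi> p c)"] by (simp add: scalar_mult_eq_scaleR)
  also have "(\<Sum>j\<in>UNIV. \<eta> p c $ j *\<^sub>R D \<xi> (coord_field A c j) p c) =
      (\<Sum>i\<in>UNIV. \<Sum>j\<in>UNIV. (\<xi> p c $ i * \<eta> p c $ j) *\<^sub>R christoffel c i j ?x)"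
    unfolding dj scaleR_sum_right by (subst sum.swap) (simp add: mult.commute)
  finally show ?thesis .
qed

text \<open>The Lie brackets of coordinate fields vanish, their components being constant.\<close>

lemma christoffel_symmetric:
  assumes tf: "torsion_free A M D" and c: "c \<in> A" "x \<in> snd c ` fst c" "0 < x $ k"
  shows "christoffel c i j x = christoffel c j i x"
proof -
  let ?W = "fst c \<inter> M" and ?p = "cinv c x"
  have p: "?p \<in> fst c" "snd c ?p = x" using c by auto
  have W: "open ?W" "?W \<subseteq> M" "?p \<in> ?W" 
    using chart_open[OF c(1)] open_intr p intr_iff[OF c(1) p(1)] c(3) by auto
  have f: "vfield A ?W (coord_field A c i)" for i
    using coord_field_vfield[OF c(1) W(1)] by simp
  have 0: "hD k (\<lambda>y. coord_field A c i (cinv c y) c) x v = 0" for i v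
  proof -
    have "hD k (\<lambda>y. coord_field A c i (cinv c y) c) x = hD k (\<lambda>y. axis i 1) x"
      by (rule hD_cong[OF hopen_chart[OF c(1)] c(2)]) (use c(1) in \<open>auto simp: coord_field_const_field\<close>)
    then show ?thesis using hD_const[OF hopen_in_half_space[OF hopen_chart[OF c(1)] c(2)]] by metis
  qed
  have "fadd (D (coord_field A c i) (coord_field A c j) ?p) (fscale (- 1) (D (coord_field A c j) (coord_field A c i) ?p))
      = lie_bracket A (coord_field A c i) (coord_field A c j) ?p"
    using tf[unfolded torsion_free_def] W f by blast
  then have "christoffel c i j x - christoffel c j i x = lie_bracket A (coord_field A c i) (coord_field A c j) ?p c"
    by (metis (no_types, lifting) christoffel_def fadd_apply fscale_apply scaleR_minus1_left uminus_add_conv_diff add.commute)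
  also have "\<dots> = 0"
    using at_chart[OF c(1) p(1)] 0 p c by (simp add: lie_bracket_def hD_def)
  finally show ?thesis by simp
qed

lemma rho_conn_chart:
  "rho_conn A D \<rho> \<xi> \<eta> p c = D \<xi> \<eta> p c + (diff_fun A \<rho> p (\<xi> p) / \<rho> p) *\<^sub>R \<eta> p c + (diff_fun A \<rho> p (\<eta> p) / \<rho> p) *\<^sub>R \<xi> p c"
  by (simp add: rho_conn_def proj_change_def)

lemma rho_conn_vfield:
  assumes W: "open W" "W \<subseteq> M" and v: "vfield A W \<xi>" "vfield A W \<eta>"
    and \<rho>: "smooth_fun A W \<rho>" "\<And>p. p \<in> W \<Longrightarrow> \<rho> p \<noteq> 0"
  shows "vfield A W (rho_conn A D \<rho> \<xi> \<eta>)"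
proof -
  have q: "smooth_fun A W (\<lambda>p. diff_fun A \<rho> p (\<zeta> p) / \<rho> p)" if "vfield A W \<zeta>" for \<zeta>
    unfolding smooth_fun_def o_def
  proof
    fix c assume c: "c \<in> A"
    show "smooth_on (cimg c W) (\<lambda>x. diff_fun A \<rho> (cinv c x) (\<zeta> (cinv c x)) / \<rho> (cinv c x))"
      by (intro smooth_on_divide smooth_fun_chartD[OF diff_fun_smooth[OF \<rho>(1) W(1) that] c]
          smooth_fun_chartD[OF \<rho>(1) c]) (use \<rho>(2) c in auto)
  qed
  have "rho_conn A D \<rho> \<xi> \<eta> = (\<lambda>p. fadd (D \<xi> \<eta> p) (fadd (fscale (diff_fun A \<rho> p (\<xi> p) / \<rho> p) (\<eta> p))
      (fscale (diff_fun A \<rho> p (\<eta> p) / \<rho> p) (\<xi> p))))"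
    by (simp add: fun_eq_iff rho_conn_def proj_change_def)
  then show ?thesis
    using vfield_add[OF conn_vfield[OF W v] vfield_add[OF vfield_scale[OF q[OF v(1)] v(2)] vfield_scale[OF q[OF v(2)] v(1)]]]
    by simp
qed

end


section \<open>The second derivative of the parallel density\<close>

locale precompact_manifold = connection_manifold k A D
  for k :: "'n::finite" and A :: "('m::{t2_space,second_countable_topology}, 'n) chart set" and D +
  fixes \<sigma> :: "'m \<Rightarrow> ('m, 'n) dens"
  assumes tf: "torsion_free A (intr k A) D"
    and pre: "precompact k A D"
    and par: "parallel_dens A (intr k A) 1 D \<sigma>"
begin

lemma sigma_dens: "p \<in> M \<Longrightarrow> \<sigma> p \<in> dens_space A 1 p"
  using par by (auto simp: parallel_dens_def dens_section_def)

lemma sigma_smooth: "c \<in> A \<Longrightarrow> smooth_on (cimg c M) (\<lambda>x. \<sigma> (cinv c x) c)"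
  using par by (auto simp: parallel_dens_def dens_section_def smooth_comps_def)

lemma dens_conn_chart:
  assumes "c \<in> A" "p \<in> fst c"
  shows "dens_conn A 1 E \<xi> s p c = hD k (\<lambda>x. s (cinv c x) c) (snd c p) (\<xi> p c) +
    (\<Sum>j\<in>UNIV. E \<xi> (coord_field A c j) p c $ j) / (real CARD('n) + 1) * s p c"
  using assms by (simp add: dens_conn_def at_chart hD_def)

lemma sigma_deriv:
  assumes "open W" "W \<subseteq> M" "vfield A W \<xi>" "p \<in> W" "c \<in> A" "p \<in> fst c"
  shows "hD k (\<lambda>x. \<sigma> (cinv c x) c) (snd c p) (\<xi> p c) =
    - ((\<Sum>j\<in>UNIV. D \<xi> (coord_field A c j) p c $ j) / (real CARD('n) + 1) * \<sigma> p c)"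
proof -
  have "dens_conn A 1 D \<xi> \<sigma> p = fzero"
    using par assms unfolding parallel_dens_def by blast
  then have "dens_conn A 1 D \<xi> \<sigma> p c = 0" by simp
  then show ?thesis using dens_conn_chart[OF assms(5,6), of D \<xi> \<sigma>] by linarith
qed

lemma defining_fun_interior:
  assumes "defining_fun k A U \<rho>" "W \<subseteq> U \<inter> M" "open W"
  shows "smooth_fun A W \<rho>" "\<And>p. p \<in> W \<Longrightarrow> \<rho> p \<noteq> 0"
proof -
  show "smooth_fun A W \<rho>"
    using assms smooth_fun_subset[of U \<rho> W] by (auto simp: defining_fun_def)
  show "\<rho> p \<noteq> 0" if "p \<in> W" for p
    using that assms unfolding defining_fun_def intr_def by blast
qed

text \<open>The first term of the modification contributes the form once for each of the \<open>CARD('n)\<close> frame vectors and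
  the second term contributes it once more, which is why weight one is the weight in which the change is by \<open>d\<rho> / \<rho>\<close> itself.\<close>

lemma rho_conn_trace:
  assumes \<rho>: "defining_fun k A U \<rho>" and W: "open W" "W \<subseteq> U \<inter> M" and \<xi>: "vfield A W \<xi>"
    and p: "p \<in> W" and c: "c \<in> A" "p \<in> fst c"
  shows "(\<Sum>j\<in>UNIV. rho_conn A D \<rho> \<xi> (coord_field A c j) p c $ j) =
    (\<Sum>j\<in>UNIV. D \<xi> (coord_field A c j) p c $ j) + (real CARD('n) + 1) * (diff_fun A \<rho> p (\<xi> p) / \<rho> p)"
proof -
  note s = defining_fun_interior[OF \<rho> W(2,1)]
  have cf: "coord_field A c j p c = axis j 1" for j using c by (simp add: coord_field_const_field)
  have dj: "diff_fun A \<rho> p (coord_field A c j p) = hD k (\<lambda>x. \<rho> (cinv c x)) (snd c p) (axis j 1)" for j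
    using diff_fun_chart[OF s(1) W(1) p c const_field_tangent[OF c]] c by (simp add: coord_field_const_field)
  have x: "snd c p \<in> cimg c W" using c p by auto
  have d: "diff_fun A \<rho> p (\<xi> p) = (\<Sum>j\<in>UNIV. \<xi> p c $ j * diff_fun A \<rho> p (coord_field A c j p))"
    using diff_fun_chart[OF s(1) W(1) p c vfield_tangent[OF \<xi> p]]
      hD_expand[OF smooth_fun_chartD[OF s(1) c(1)] hopen_cimg[OF c(1) W(1)] x, of "\<xi> p c"]
    by (simp add: dj)
  have "(\<Sum>j\<in>UNIV. rho_conn A D \<rho> \<xi> (coord_field A c j) p c $ j) =
    (\<Sum>j\<in>UNIV. D \<xi> (coord_field A c j) p c $ j) + (\<Sum>j\<in>(UNIV::'n set). diff_fun A \<rho> p (\<xi> p) / \<rho> p)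
     + (\<Sum>j\<in>UNIV. diff_fun A \<rho> p (coord_field A c j p) / \<rho> p * \<xi> p c $ j)"
    by (simp add: rho_conn_chart cf sum.distrib)
  also have "(\<Sum>j\<in>UNIV. diff_fun A \<rho> p (coord_field A c j p) / \<rho> p * \<xi> p c $ j) = diff_fun A \<rho> p (\<xi> p) / \<rho> p"
    unfolding d sum_divide_distrib by (simp add: mult_ac)
  finally show ?thesis by (simp add: algebra_simps add_divide_distrib)
qed

lemma rho_conn_sigma:
  assumes \<rho>: "defining_fun k A U \<rho>" and W: "open W" "W \<subseteq> U \<inter> M" and \<xi>: "vfield A W \<xi>"
    and p: "p \<in> W" and c: "c \<in> A" "p \<in> fst c"
  shows "dens_conn A 1 (rho_conn A D \<rho>) \<xi> \<sigma> p c = diff_fun A \<rho> p (\<xi> p) / \<rho> p * \<sigma> p c"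
proof -
  have WM: "W \<subseteq> M" using W by auto
  define n where "n = real CARD('n) + 1"
  have n: "n \<noteq> 0" by (simp add: n_def add_eq_0_iff)
  show ?thesis
    unfolding dens_conn_chart[OF c] rho_conn_trace[OF assms] sigma_deriv[OF W(1) WM \<xi> p c] n_def[symmetric]
    using n by (simp add: add_divide_distrib distrib_right)
qed

text \<open>The density \<open>\<sigma> / \<rho>\<close> is parallel for the modified connection, so differentiating
  \<open>\<sigma> = \<rho> (\<sigma> / \<rho>)\<close> twice differentiates only the factor \<open>\<rho>\<close>.\<close>

lemma second_deriv_sigma:
  assumes \<rho>: "defining_fun k A U \<rho>" and W: "open W" "W \<subseteq> U \<inter> M" and v: "vfield A W \<xi>" "vfield A W \<eta>"
    and p: "p \<in> W"
  shows "second_deriv A 1 (rho_conn A D \<rho>) \<sigma> \<xi> \<eta> p =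
    fscale (diff_fun A (\<lambda>q. diff_fun A \<rho> q (\<eta> q)) p (\<xi> p) - diff_fun A \<rho> p (rho_conn A D \<rho> \<xi> \<eta> p))
      (fscale (1 / \<rho> p) (\<sigma> p))"
proof
  fix c
  show "second_deriv A 1 (rho_conn A D \<rho>) \<sigma> \<xi> \<eta> p c =
    fscale (diff_fun A (\<lambda>q. diff_fun A \<rho> q (\<eta> q)) p (\<xi> p) - diff_fun A \<rho> p (rho_conn A D \<rho> \<xi> \<eta> p))
      (fscale (1 / \<rho> p) (\<sigma> p)) c"
  proof (cases "c \<in> A \<and> p \<in> fst c")
    case False
    then show ?thesis
      using dens_supp[OF sigma_dens[of p] False] W p by (auto simp: second_deriv_def dens_conn_def)
  next
    case True
    then have c: "c \<in> A" "p \<in> fst c" by auto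
    have WM: "W \<subseteq> M" using W by auto
    note s = defining_fun_interior[OF \<rho> W(2,1)]
    let ?E = "rho_conn A D \<rho>" and ?x = "snd c p"
    let ?X = "cimg c W"
    define F where "F x = diff_fun A \<rho> (cinv c x) (\<eta> (cinv c x))" for x
    define R where "R x = \<rho> (cinv c x)" for x
    define S where "S x = \<sigma> (cinv c x) c" for x
    \<comment> \<open>Near \<open>p\<close> the first covariant derivative in direction \<open>\<eta>\<close> is \<open>q \<sigma>\<close>.\<close>
    define q where "q x = F x / R x" for x
    have X: "hopen k ?X" "?x \<in> ?X" using hopen_cimg[OF c(1) W(1)] c p by auto
    have smF: "smooth_fun A W (\<lambda>q. diff_fun A \<rho> q (\<eta> q))" by (rule diff_fun_smooth[OF s(1) W(1) v(2)])
    have F: "smooth_on ?X F" unfolding F_def by (rule smooth_fun_chartD[OF smF c(1)])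
    have R: "smooth_on ?X R" unfolding R_def by (rule smooth_fun_chartD[OF s(1) c(1)])
    have Rnz: "R x \<noteq> 0" if "x \<in> ?X" for x using that c s(2) by (auto simp: R_def)
    have S: "smooth_on ?X S" unfolding S_def
      by (rule smooth_on_subset[OF sigma_smooth[OF c(1)]]) (use WM in auto)
    have q: "smooth_on ?X q" unfolding q_def by (rule smooth_on_divide[OF F R Rnz])
    have dF: "hD k F ?x (\<xi> p c) = diff_fun A (\<lambda>q. diff_fun A \<rho> q (\<eta> q)) p (\<xi> p)"
      unfolding F_def using diff_fun_chart[OF smF W(1) p c vfield_tangent[OF v(1) p]] by simp
    have dR: "hD k R ?x (\<xi> p c) = diff_fun A \<rho> p (\<xi> p)"
      unfolding R_def using diff_fun_chart[OF s(1) W(1) p c vfield_tangent[OF v(1) p]] by simp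
    have "hD k F ?x (\<xi> p c) = hD k (\<lambda>x. q x * R x) ?x (\<xi> p c)"
      by (rule fun_cong[OF hD_cong[OF X]]) (use Rnz in \<open>simp add: q_def\<close>)
    also have "\<dots> = q ?x * hD k R ?x (\<xi> p c) + hD k q ?x (\<xi> p c) * R ?x"
      by (rule hD_mult[OF q R X])
    finally have dq: "hD k q ?x (\<xi> p c) * R ?x = hD k F ?x (\<xi> p c) - q ?x * hD k R ?x (\<xi> p c)" by simp
    have inner: "dens_conn A 1 ?E \<eta> \<sigma> (cinv c x) c = q x * S x" if x: "x \<in> ?X" for x
    proof -
      have "cinv c x \<in> W" "cinv c x \<in> fst c" using x c by auto
      from rho_conn_sigma[OF \<rho> W v(2) this(1) c(1) this(2)] show ?thesis
        by (simp add: q_def F_def R_def S_def)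
    qed
    define T where "T = (\<Sum>j\<in>UNIV. D \<xi> (coord_field A c j) p c $ j)"
    define n where "n = real CARD('n) + 1"
    have n: "n > 0" by (simp add: n_def)
    have dS: "hD k S ?x (\<xi> p c) = - (T / n * S ?x)"
      using sigma_deriv[OF W(1) WM v(1) p c] c by (simp add: T_def n_def S_def[abs_def])
    have "hD k (\<lambda>x. dens_conn A 1 ?E \<eta> \<sigma> (cinv c x) c) ?x (\<xi> p c) = hD k (\<lambda>x. q x * S x) ?x (\<xi> p c)"
      by (rule fun_cong[OF hD_cong[OF X inner]])
    also have "\<dots> = q ?x * hD k S ?x (\<xi> p c) + hD k q ?x (\<xi> p c) * S ?x"
      by (rule hD_mult[OF q S X])
    finally have dqS: "hD k (\<lambda>x. dens_conn A 1 ?E \<eta> \<sigma> (cinv c x) c) ?x (\<xi> p c) =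
        q ?x * - (T / n * S ?x) + hD k q ?x (\<xi> p c) * S ?x"
      unfolding dS .
    have "dens_conn A 1 ?E \<eta> \<sigma> p c = q ?x * S ?x" using inner[OF X(2)] c by simp
    then have "dens_conn A 1 ?E \<xi> (dens_conn A 1 ?E \<eta> \<sigma>) p c =
       q ?x * - (T / n * S ?x) + hD k q ?x (\<xi> p c) * S ?x
        + (T + n * (hD k R ?x (\<xi> p c) / R ?x)) / n * (q ?x * S ?x)"
      using dens_conn_chart[OF c, of ?E \<xi> "dens_conn A 1 ?E \<eta> \<sigma>"] rho_conn_trace[OF \<rho> W v(1) p c] dqS c
      by (simp add: T_def n_def dR R_def)
    also have "\<dots> = (hD k q ?x (\<xi> p c) * R ?x + q ?x * hD k R ?x (\<xi> p c)) / R ?x * S ?x"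
      using n Rnz[OF X(2)] by (simp add: field_simps)
    also have "\<dots> = hD k F ?x (\<xi> p c) / R ?x * S ?x" unfolding dq by simp
    finally have 1: "dens_conn A 1 ?E \<xi> (dens_conn A 1 ?E \<eta> \<sigma>) p c = hD k F ?x (\<xi> p c) / R ?x * S ?x" .
    have 2: "dens_conn A 1 ?E (?E \<xi> \<eta>) \<sigma> p c = diff_fun A \<rho> p (?E \<xi> \<eta> p) / \<rho> p * \<sigma> p c"
      by (rule rho_conn_sigma[OF \<rho> W rho_conn_vfield[OF W(1) WM v s] p c])
    show ?thesis
      using c unfolding second_deriv_def fadd_apply fscale_apply 1 2 dF
      by (simp add: R_def S_def diff_divide_distrib algebra_simps)
  qed
qed

text \<open>The coefficients, in the coordinate frame, of the second derivative of \<open>\<sigma>\<close>, written with the Christoffel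
  symbols of the unmodified connection; the last term in the bracket is the effect of the modification.\<close>

definition hess_coeff :: "('m, 'n) chart \<Rightarrow> ('m \<Rightarrow> real) \<Rightarrow> 'n \<Rightarrow> 'n \<Rightarrow> real ^ 'n \<Rightarrow> real" where
  "hess_coeff c \<rho> i j x = (let R = \<lambda>x. \<rho> (cinv c x) in
    (hD k (\<lambda>x. hD k R x (axis j 1)) x (axis i 1) - hD k R x (christoffel c i j x)
      - 2 * hD k R x (axis i 1) * hD k R x (axis j 1) / R x) * \<sigma> (cinv c x) c / R x)"

lemma second_deriv_sigma_chart:
  assumes \<rho>: "defining_fun k A U \<rho>" and W: "open W" "W \<subseteq> U \<inter> M" and v: "vfield A W \<xi>" "vfield A W \<eta>"
    and p: "p \<in> W" and c: "c \<in> A" "p \<in> fst c"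
  shows "second_deriv A 1 (rho_conn A D \<rho>) \<sigma> \<xi> \<eta> p c =
    (\<Sum>i\<in>UNIV. \<Sum>j\<in>UNIV. \<xi> p c $ i * \<eta> p c $ j * hess_coeff c \<rho> i j (snd c p))"
proof -
  have WM: "W \<subseteq> M" using W by auto
  note s = defining_fun_interior[OF \<rho> W(2,1)]
  let ?x = "snd c p" and ?X = "cimg c W"
  define R where "R x = \<rho> (cinv c x)" for x
  define Ri where "Ri i = hD k R ?x (axis i 1)" for i
  define w where "w x = \<eta> (cinv c x) c" for x
  let ?R2 = "\<lambda>i j. hD k (\<lambda>x. hD k R x (axis j 1)) ?x (axis i 1)"
  have X: "hopen k ?X" "?x \<in> ?X" using hopen_cimg[OF c(1) W(1)] c p by auto
  have R: "smooth_on ?X R" unfolding R_def by (rule smooth_fun_chartD[OF s(1) c(1)])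
  have w: "smooth_on ?X w" unfolding w_def by (rule vfield_chartD[OF v(2) c(1)])
  have wx: "w ?x = \<eta> p c" using c by (simp add: w_def)
  have smF: "smooth_fun A W (\<lambda>q. diff_fun A \<rho> q (\<eta> q))" by (rule diff_fun_smooth[OF s(1) W(1) v(2)])
  have "diff_fun A (\<lambda>q. diff_fun A \<rho> q (\<eta> q)) p (\<xi> p) =
      hD k (\<lambda>x. diff_fun A \<rho> (cinv c x) (\<eta> (cinv c x))) ?x (\<xi> p c)"
    by (rule diff_fun_chart[OF smF W(1) p c vfield_tangent[OF v(1) p]])
  also have "\<dots> = hD k (\<lambda>x. hD k R x (w x)) ?x (\<xi> p c)"
  proof (rule fun_cong[OF hD_cong[OF X]])
    fix y assume y: "y \<in> ?X"
    then have "cinv c y \<in> W" "cinv c y \<in> fst c" "snd c (cinv c y) = y" using c by auto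
    then show "diff_fun A \<rho> (cinv c y) (\<eta> (cinv c y)) = hD k R y (w y)"
      using diff_fun_chart[OF s(1) W(1) _ c(1) _ vfield_tangent[OF v(2)], of "cinv c y"]
      by (simp add: R_def[abs_def] w_def)
  qed
  also have "\<dots> = (\<Sum>i\<in>UNIV. \<Sum>j\<in>UNIV. \<xi> p c $ i * \<eta> p c $ j * ?R2 i j) + hD k R ?x (hD k w ?x (\<xi> p c))"
    using hD_of_hD[OF R w X, of "\<xi> p c"] wx by simp
  finally have 1: "diff_fun A (\<lambda>q. diff_fun A \<rho> q (\<eta> q)) p (\<xi> p) = \<dots>" .
  have lin: "linear (hD k R ?x)" using hD_linear[OF R X] bounded_linear.linear by blast
  have d: "diff_fun A \<rho> p u = hD k R ?x (u c)" if "u \<in> tangent_space A p" for u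
    using diff_fun_chart[OF s(1) W(1) p c that] by (simp add: R_def[abs_def])
  have e: "hD k R ?x u = (\<Sum>i\<in>UNIV. u $ i * Ri i)" for u
    using hD_expand[OF R X, of u] by (simp add: Ri_def)
  let ?G = "\<Sum>i\<in>UNIV. \<Sum>j\<in>UNIV. (\<xi> p c $ i * \<eta> p c $ j) *\<^sub>R christoffel c i j ?x"
  have "diff_fun A \<rho> p (rho_conn A D \<rho> \<xi> \<eta> p) = hD k R ?x (rho_conn A D \<rho> \<xi> \<eta> p c)"
    by (rule d[OF vfield_tangent[OF rho_conn_vfield[OF W(1) WM v s] p]])
  also have "\<dots> = hD k R ?x (hD k w ?x (\<xi> p c)) + hD k R ?x ?G + 2 * hD k R ?x (\<xi> p c) * hD k R ?x (\<eta> p c) / \<rho> p"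
    unfolding rho_conn_chart conn_chart[OF W(1) WM v p c] d[OF vfield_tangent[OF v(1) p]] d[OF vfield_tangent[OF v(2) p]]
    by (simp add: linear_add[OF lin] linear_cmul[OF lin] w_def[abs_def])
  also have "hD k R ?x ?G = (\<Sum>i\<in>UNIV. \<Sum>j\<in>UNIV. \<xi> p c $ i * \<eta> p c $ j * hD k R ?x (christoffel c i j ?x))"
    by (simp add: linear_sum[OF lin] linear_cmul[OF lin])
  also have "2 * hD k R ?x (\<xi> p c) * hD k R ?x (\<eta> p c) / \<rho> p =
      (\<Sum>i\<in>UNIV. \<Sum>j\<in>UNIV. \<xi> p c $ i * \<eta> p c $ j * (2 * Ri i * Ri j / \<rho> p))"
  proof -
    have "hD k R ?x (\<xi> p c) * hD k R ?x (\<eta> p c) = (\<Sum>i\<in>UNIV. \<Sum>j\<in>UNIV. (\<xi> p c $ i * Ri i) * (\<eta> p c $ j * Ri j))"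
      unfolding e sum_product ..
    then have "2 * hD k R ?x (\<xi> p c) * hD k R ?x (\<eta> p c) / \<rho> p =
      (2 / \<rho> p) * (\<Sum>i\<in>UNIV. \<Sum>j\<in>UNIV. (\<xi> p c $ i * Ri i) * (\<eta> p c $ j * Ri j))" by simp
    then show ?thesis by (simp add: sum_distrib_left mult_ac)
  qed
  finally have 2: "diff_fun A \<rho> p (rho_conn A D \<rho> \<xi> \<eta> p) = hD k R ?x (hD k w ?x (\<xi> p c)) +
      (\<Sum>i\<in>UNIV. \<Sum>j\<in>UNIV. \<xi> p c $ i * \<eta> p c $ j * hD k R ?x (christoffel c i j ?x)) +
      (\<Sum>i\<in>UNIV. \<Sum>j\<in>UNIV. \<xi> p c $ i * \<eta> p c $ j * (2 * Ri i * Ri j / \<rho> p))" .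
  have Rx: "R ?x = \<rho> p" using c by (simp add: R_def)
  have h: "hess_coeff c \<rho> i j ?x = (?R2 i j - hD k R ?x (christoffel c i j ?x) - 2 * Ri i * Ri j / \<rho> p) * (\<sigma> p c / \<rho> p)" for i j
    using c by (simp add: hess_coeff_def Let_def R_def[abs_def] Ri_def)
  have "second_deriv A 1 (rho_conn A D \<rho>) \<sigma> \<xi> \<eta> p c =
    (\<Sum>i\<in>UNIV. \<Sum>j\<in>UNIV. \<xi> p c $ i * \<eta> p c $ j *
      (?R2 i j - hD k R ?x (christoffel c i j ?x) - 2 * Ri i * Ri j / \<rho> p)) * (\<sigma> p c / \<rho> p)"
    unfolding second_deriv_sigma[OF \<rho> W v p] 1 2 fscale_apply
    by (simp add: sum_subtractf right_diff_distrib)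
  then show ?thesis
    by (simp add: h sum_distrib_right sum_divide_distrib mult.assoc)
qed

text \<open>The Christoffel symbols of the connection modified by the boundary coordinate \<open>x $ k\<close> of the chart.\<close>

definition mod_christoffel :: "('m, 'n) chart \<Rightarrow> 'n \<Rightarrow> 'n \<Rightarrow> real ^ 'n \<Rightarrow> real ^ 'n" where
  "mod_christoffel c i j x = christoffel c i j x + (axis i 1 $ k / x $ k) *\<^sub>R axis j 1 + (axis j 1 $ k / x $ k) *\<^sub>R axis i 1"

lemma mod_christoffel_eq:
  assumes c: "c \<in> A" and x: "x \<in> snd c ` fst c" "0 < x $ k"
  shows "rho_conn A D (\<lambda>p. snd c p $ k) (coord_field A c i) (coord_field A c j) (cinv c x) c = mod_christoffel c i j x"
    and "rho_conn A D (\<lambda>p. snd c p $ k) (coord_field A c i) (coord_field A c j) (cinv c x) \<in> tangent_space A (cinv c x)"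
proof -
  let ?p = "cinv c x" and ?W = "fst c \<inter> M"
  have p: "?p \<in> fst c" "snd c ?p = x" using c x by auto
  have W: "open ?W" "?W \<subseteq> M" "?p \<in> ?W"
    using chart_open[OF c] open_intr p intr_iff[OF c p(1)] x by auto
  have f: "vfield A ?W (coord_field A c i)" for i by (rule coord_field_vfield[OF c W(1)]) auto
  have cf: "coord_field A c j ?p c = axis j 1" for j using c p by (simp add: coord_field_const_field)
  have dj: "diff_fun A (\<lambda>p. snd c p $ k) ?p (coord_field A c j ?p) = axis j 1 $ k" for j
    using diff_chart_coordinate[OF c p(1) vfield_tangent[OF f W(3)]] cf by simp
  show "rho_conn A D (\<lambda>p. snd c p $ k) (coord_field A c i) (coord_field A c j) ?p c = mod_christoffel c i j x"
    unfolding rho_conn_chart dj cf p(2) mod_christoffel_def christoffel_def ..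
  have "vfield A ?W (rho_conn A D (\<lambda>p. snd c p $ k) (coord_field A c i) (coord_field A c j))"
    by (rule rho_conn_vfield[OF W(1,2) f f])
       (rule defining_fun_interior[OF chart_coordinate_defining[OF c] subset_refl W(1)]; assumption)+
  then show "rho_conn A D (\<lambda>p. snd c p $ k) (coord_field A c i) (coord_field A c j) ?p \<in> tangent_space A ?p"
    using vfield_tangent W(3) by blast
qed

text \<open>The three conditions of pre-compactness for the boundary coordinate of the chart and coordinate fields.
  Coordinate fields other than the \<open>k\<close>-th are tangent to the boundary.\<close>

lemma mod_christoffel_extends:
  assumes c: "c \<in> A"
  shows "\<exists>G. smooth_on (snd c ` fst c) G \<and> (\<forall>x\<in>snd c ` fst c. 0 < x $ k \<longrightarrow> G x = mod_christoffel c i j x $ k)"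
    and "\<exists>T. smooth_on (snd c ` fst c) T \<and> (\<forall>x\<in>snd c ` fst c. 0 < x $ k \<longrightarrow> T x = x $ k *\<^sub>R mod_christoffel c i j x)"
    and "i \<noteq> k \<or> j \<noteq> k \<Longrightarrow>
      \<exists>\<gamma>. smooth_on (snd c ` fst c) \<gamma> \<and> (\<forall>x\<in>snd c ` fst c. 0 < x $ k \<longrightarrow> \<gamma> x = mod_christoffel c i j x)"
proof -
  let ?\<rho> = "\<lambda>p. snd c p $ k" and ?X = "snd c ` fst c"
  let ?E = "rho_conn A D ?\<rho> (coord_field A c i) (coord_field A c j)"
  have f: "vfield A (fst c) (coord_field A c i)" for i
    by (rule coord_field_vfield[OF c chart_open[OF c] subset_refl])
  note pr = pre[unfolded precompact_def, rule_format, OF chart_coordinate_defining[OF c] f[of i] f[of j]]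
  have I: "cinv c x \<in> fst c \<inter> M" "snd c (cinv c x) = x" if "x \<in> ?X" "0 < x $ k" for x
    using that c intr_iff[OF c, of "cinv c x"] by auto
  note E = mod_christoffel_eq[OF c]
  show "\<exists>G. smooth_on ?X G \<and> (\<forall>x\<in>?X. 0 < x $ k \<longrightarrow> G x = mod_christoffel c i j x $ k)"
  proof -
    obtain g where g: "smooth_fun A (fst c) g" "\<And>p. p \<in> fst c \<inter> M \<Longrightarrow> g p = diff_fun A ?\<rho> p (?E p)"
      using pr unfolding fun_extends_def by blast
    have "smooth_on ?X (\<lambda>x. g (cinv c x))" using smooth_fun_chartD[OF g(1) c] by simp
    moreover have "g (cinv c x) = mod_christoffel c i j x $ k" if "x \<in> ?X" "0 < x $ k" for x
      using g(2)[OF I(1)[OF that]] I[OF that] diff_chart_coordinate[OF c _ E(2)[OF that]] E(1)[OF that] by simp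
    ultimately show ?thesis by blast
  qed
  show "\<exists>T. smooth_on ?X T \<and> (\<forall>x\<in>?X. 0 < x $ k \<longrightarrow> T x = x $ k *\<^sub>R mod_christoffel c i j x)"
  proof -
    obtain g where g: "vfield A (fst c) g" "\<And>p. p \<in> fst c \<inter> M \<Longrightarrow> g p = fscale (?\<rho> p) (?E p)"
      using pr unfolding vfield_extends_def by blast
    have "smooth_on ?X (\<lambda>x. g (cinv c x) c)" using vfield_chartD[OF g(1) c] by simp
    moreover have "g (cinv c x) c = x $ k *\<^sub>R mod_christoffel c i j x" if "x \<in> ?X" "0 < x $ k" for x
      using g(2)[OF I(1)[OF that]] I[OF that] E(1)[OF that] by simp
    ultimately show ?thesis by blast
  qed
  assume ij: "i \<noteq> k \<or> j \<noteq> k"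
  have b: "bdry_vfield k A (fst c) (coord_field A c i)" if "i \<noteq> k" for i
    unfolding coord_field_const_field
    by (rule const_field_bdry[OF c _ chart_open[OF c] subset_refl]) (use that in \<open>simp add: axis_def\<close>)
  show "\<exists>\<gamma>. smooth_on ?X \<gamma> \<and> (\<forall>x\<in>?X. 0 < x $ k \<longrightarrow> \<gamma> x = mod_christoffel c i j x)"
  proof -
    obtain g where g: "vfield A (fst c) g" "\<And>p. p \<in> fst c \<inter> M \<Longrightarrow> g p = ?E p"
      using pr b ij unfolding vfield_extends_def by blast
    have "smooth_on ?X (\<lambda>x. g (cinv c x) c)" using vfield_chartD[OF g(1) c] by simp
    moreover have "g (cinv c x) c = mod_christoffel c i j x" if "x \<in> ?X" "0 < x $ k" for x
      using g(2)[OF I(1)[OF that]] I[OF that] E(1)[OF that] by simp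
    ultimately show ?thesis by blast
  qed
qed

lemma sigma_frame_deriv:
  assumes c: "c \<in> A" and x: "x \<in> snd c ` fst c" "0 < x $ k"
  shows "hD k (\<lambda>x. \<sigma> (cinv c x) c) x (axis i 1) =
    (axis i 1 $ k / x $ k - (\<Sum>j\<in>UNIV. mod_christoffel c i j x $ j) / (real CARD('n) + 1)) * \<sigma> (cinv c x) c"
proof -
  let ?p = "cinv c x" and ?W = "fst c \<inter> M"
  define n where "n = real CARD('n) + 1"
  have n: "n \<noteq> 0" by (simp add: n_def add_eq_0_iff)
  have p: "?p \<in> fst c" "snd c ?p = x" using c x by auto
  have W: "open ?W" "?W \<subseteq> M" "?p \<in> ?W"
    using chart_open[OF c] open_intr p intr_iff[OF c p(1)] x by auto
  have f: "vfield A ?W (coord_field A c i)" by (rule coord_field_vfield[OF c W(1)]) auto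
  have cf: "coord_field A c i ?p c = axis i 1" using c p by (simp add: coord_field_const_field)
  have "(\<Sum>j\<in>UNIV. axis j 1 $ k * (axis i 1 :: real ^ 'n) $ j) = axis i 1 $ k"
    by (subst sum.remove[of _ k]) (auto simp: axis_def intro!: sum.neutral)
  then have ax: "(\<Sum>j\<in>UNIV. axis j 1 $ k / x $ k * (axis i 1 :: real ^ 'n) $ j) = axis i 1 $ k / x $ k"
    by (simp add: sum_divide_distrib[symmetric])
  have "(\<Sum>j\<in>UNIV. mod_christoffel c i j x $ j) =
      (\<Sum>j\<in>UNIV. christoffel c i j x $ j) + (\<Sum>j\<in>(UNIV::'n set). axis i 1 $ k / x $ k) + axis i 1 $ k / x $ k"
    by (simp only: mod_christoffel_def vector_add_component vector_scaleR_component real_scaleR_def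
        sum.distrib ax axis_nth mult_1_right)
  also have "\<dots> = (\<Sum>j\<in>UNIV. christoffel c i j x $ j) + n * (axis i 1 $ k / x $ k)"
    by (simp add: n_def distrib_right add_divide_distrib)
  finally have t: "(\<Sum>j\<in>UNIV. christoffel c i j x $ j) = (\<Sum>j\<in>UNIV. mod_christoffel c i j x $ j) - n * (axis i 1 $ k / x $ k)"
    by linarith
  show ?thesis
    using sigma_deriv[OF W(1,2) f W(3) c p(1)] n
    unfolding p(2) cf christoffel_def[symmetric] t n_def[symmetric]
    by (simp add: diff_divide_distrib left_diff_distrib)
qed

text \<open>The quotient of \<open>\<sigma>\<close> by the boundary coordinate is parallel for the modified connection, so its logarithmic
  derivative is a multiple of the trace of the modified Christoffel symbols.  That trace extends smoothly:
  the entries with \<open>j \<noteq> k\<close> involve a tangential coordinate field, and the entry with \<open>j = k\<close> is the normal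
  component.\<close>

lemma sigma_factor:
  assumes c: "c \<in> A"
  shows "\<exists>y. smooth_on (snd c ` fst c) y \<and> (\<forall>x\<in>snd c ` fst c. 0 < x $ k \<longrightarrow> \<sigma> (cinv c x) c = x $ k * y x)"
proof -
  let ?X = "snd c ` fst c" and ?I = "cimg c M"
  define n where "n = real CARD('n) + 1"
  have "\<exists>a. smooth_on ?X a \<and> (\<forall>x\<in>?X. 0 < x $ k \<longrightarrow> a x = mod_christoffel c i j x $ j)" for i j
  proof (cases "j = k")
    case True
    then show ?thesis using mod_christoffel_extends(1)[OF c] by blast
  next
    case False
    then obtain \<gamma> where "smooth_on ?X \<gamma>" "\<forall>x\<in>?X. 0 < x $ k \<longrightarrow> \<gamma> x = mod_christoffel c i j x"
      using mod_christoffel_extends(3)[OF c] by blast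
    then show ?thesis by (intro exI[of _ "\<lambda>x. \<gamma> x $ j"]) (auto intro: smooth_on_vec_nth)
  qed
  then obtain a where a: "\<And>i j. smooth_on ?X (a i j)"
    "\<And>i j x. x \<in> ?X \<Longrightarrow> 0 < x $ k \<Longrightarrow> a i j x = mod_christoffel c i j x $ j" by metis
  define t where "t i x = (- 1 / n) * (\<Sum>j\<in>UNIV. a i j x)" for i x
  define y where "y x = \<sigma> (cinv c x) c / x $ k" for x
  have X: "hopen k ?X" by (rule hopen_chart[OF c])
  have I: "hopen k ?I" by (rule hopen_cimg[OF c open_intr])
  have Ix: "x \<in> ?I \<longleftrightarrow> x \<in> ?X \<and> 0 < x $ k" for x using cimg_intr_iff[OF c, of x UNIV] by simp
  have y: "smooth_on ?I y" unfolding y_def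
    by (intro smooth_on_divide sigma_smooth[OF c] smooth_on_nth) (use Ix in auto)
  have "\<exists>F. smooth_on ?X F \<and> (\<forall>x\<in>?X. 0 < x $ k \<longrightarrow> F x = y x)"
  proof (rule linear_equation_extends[OF X, where a = t])
    show "smooth_on ?X (t i)" for i
      unfolding t_def by (intro smooth_on_mult smooth_on_const smooth_on_sum a)
    fix x assume x: "x \<in> ?X" "0 < x $ k"
    have xI: "x \<in> ?I" using x Ix by simp
    let ?s = "\<lambda>x. \<sigma> (cinv c x) c"
    have s: "?s x = x $ k * y x" if "x \<in> ?I" for x using that Ix by (simp add: y_def)
    have "hD k y x v = (\<Sum>i\<in>UNIV. v $ i * t i x) * y x" for v
    proof -
      have "v $ k * y x + x $ k * hD k y x v = hD k ?s x v"
        using hD_boundary_vanishing[OF I y s xI, of v] by simp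
      also have "\<dots> = (\<Sum>i\<in>UNIV. v $ i * ((axis i 1 $ k / x $ k + t i x) * ?s x))"
        unfolding hD_expand[OF sigma_smooth[OF c] I xI, of v]
        by (rule sum.cong) (simp_all add: sigma_frame_deriv[OF c x] t_def a(2)[OF x] n_def)
      also have "\<dots> = (\<Sum>i\<in>UNIV. v $ i * axis i 1 $ k) / x $ k * ?s x + (\<Sum>i\<in>UNIV. v $ i * t i x) * ?s x"
        by (simp add: distrib_left distrib_right sum.distrib sum_distrib_right sum_divide_distrib mult.assoc)
      also have "(\<Sum>i\<in>UNIV. v $ i * axis i 1 $ k) = v $ k"
        by (subst sum.remove[of _ k]) (auto simp: axis_def intro!: sum.neutral)
      finally have "x $ k * hD k y x v = x $ k * ((\<Sum>i\<in>UNIV. v $ i * t i x) * y x)"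
        using x(2) s[OF xI] by (simp add: mult_ac)
      then show ?thesis using x(2) by simp
    qed
    then have "hD k y x = (\<lambda>v. (\<Sum>i\<in>UNIV. v $ i * t i x) * y x)" by (rule ext)
    then show "(y has_derivative (\<lambda>v. (\<Sum>i\<in>UNIV. v $ i * t i x) * y x)) (at x)"
      using smooth_on_has_derivative[OF y I xI] at_within_half_space_interior[OF x(2)] by simp
  qed
  then show ?thesis unfolding y_def by (metis less_irrefl nonzero_mult_div_cancel_left times_divide_eq_right)
qed

lemma hess_coeff_symmetric:
  assumes \<rho>: "defining_fun k A U \<rho>" and c: "c \<in> A" and x: "x \<in> cimg c U" "0 < x $ k"
  shows "hess_coeff c \<rho> i j x = hess_coeff c \<rho> j i x"
proof -
  have U: "open U" "smooth_fun A U \<rho>" using \<rho> by (auto simp: defining_fun_def)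
  have "hD k (\<lambda>x. hD k (\<lambda>x. \<rho> (cinv c x)) x (axis j 1)) x (axis i 1) =
      hD k (\<lambda>x. hD k (\<lambda>x. \<rho> (cinv c x)) x (axis i 1)) x (axis j 1)"
    by (rule hD_symmetric[OF smooth_fun_chartD[OF U(2) c] hopen_cimg[OF c U(1)] x(1)])
  moreover have "christoffel c i j x = christoffel c j i x"
    by (rule christoffel_symmetric[OF tf c _ x(2)]) (use x in auto)
  ultimately show ?thesis by (simp add: hess_coeff_def Let_def mult.commute mult.left_commute)
qed

text \<open>The computation behind the comparison of defining functions.  With \<open>\<rho> = x h\<close>, where \<open>x\<close> is the boundary
  coordinate, and \<open>\<sigma> = x y\<close>, the letters stand for: \<open>a\<close> and \<open>b\<close> the boundary coordinates of the two frame
  vectors, \<open>hi\<close>, \<open>hj\<close>, \<open>hij\<close> the derivatives of \<open>h\<close>, \<open>G\<close> the normal component of the modified Christoffel symbol,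
  and \<open>T\<close> the derivative of \<open>h\<close> along \<open>x\<close> times that symbol.  All poles in \<open>x\<close> cancel.\<close>

lemma hess_coeff_algebra:
  fixes x h y a b G T hi hj hij :: real
  assumes "x \<noteq> 0" "h \<noteq> 0"
  shows "(b * hi + a * hj + x * hij - ((G - 2 * a * b / x) * h + (T - a * hj - b * hi))
      - 2 * (a * h + x * hi) * (b * h + x * hj) / (x * h)) * (x * y) / (x * h) =
    (x * hij / h - G - T / h - 2 * x * hi * hj / (h * h)) * y"
  using assms by (simp add: field_simps)

text \<open>The right-hand side of the preceding identity is smooth up to the boundary, since \<open>h\<close> vanishes nowhere.
  At \<open>x = 0\<close> it becomes \<open>(- G - T / h) y\<close>, in which only \<open>T / h\<close> involves the defining function; and \<open>T\<close> vanishes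
  there as soon as one of the two frame vectors is tangential, because then the modified symbol itself is
  smooth.\<close>

lemma hess_coeff_extends:
  assumes c: "c \<in> A"
  shows "\<exists>\<beta>0. (\<forall>i j. smooth_on (snd c ` fst c) (\<beta>0 i j)) \<and>
    (\<forall>U \<rho>. defining_fun k A U \<rho> \<longrightarrow> (\<exists>\<beta>. \<forall>i j. smooth_on (cimg c U) (\<beta> i j) \<and>
      (\<forall>x\<in>cimg c U. 0 < x $ k \<longrightarrow> \<beta> i j x = hess_coeff c \<rho> i j x) \<and>
      (\<forall>x\<in>cimg c U. x $ k = 0 \<and> (i \<noteq> k \<or> j \<noteq> k) \<longrightarrow> \<beta> i j x = \<beta>0 i j x)))"
proof -
  let ?X = "snd c ` fst c"
  have X: "hopen k ?X" by (rule hopen_chart[OF c])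
  obtain G where G: "\<And>i j. smooth_on ?X (G i j)"
      "\<And>i j x. x \<in> ?X \<Longrightarrow> 0 < x $ k \<Longrightarrow> G i j x = mod_christoffel c i j x $ k"
    using mod_christoffel_extends(1)[OF c] by metis
  obtain T where T: "\<And>i j. smooth_on ?X (T i j)"
      "\<And>i j x. x \<in> ?X \<Longrightarrow> 0 < x $ k \<Longrightarrow> T i j x = x $ k *\<^sub>R mod_christoffel c i j x"
    using mod_christoffel_extends(2)[OF c] by metis
  have T0: "T i j x = 0" if ij: "i \<noteq> k \<or> j \<noteq> k" and x: "x \<in> ?X" "x $ k = 0" for i j x
  proof -
    obtain \<gamma> where \<gamma>: "smooth_on ?X \<gamma>" "\<And>x. x \<in> ?X \<Longrightarrow> 0 < x $ k \<Longrightarrow> \<gamma> x = mod_christoffel c i j x"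
      using mod_christoffel_extends(3)[OF c ij] by blast
    have "T i j x = x $ k *\<^sub>R \<gamma> x"
      by (rule hopen_continuous_agree[where f = "T i j" and g = "\<lambda>x. x $ k *\<^sub>R \<gamma> x", OF X])
         (use T \<gamma> x in \<open>auto intro!: smooth_on_continuous smooth_on_scaleR smooth_on_nth\<close>)
    then show ?thesis using x by simp
  qed
  obtain y where y: "smooth_on ?X y" "\<And>x. x \<in> ?X \<Longrightarrow> 0 < x $ k \<Longrightarrow> \<sigma> (cinv c x) c = x $ k * y x"
    using sigma_factor[OF c] by blast
  have "\<exists>\<beta>. \<forall>i j. smooth_on (cimg c U) (\<beta> i j) \<and>
      (\<forall>x\<in>cimg c U. 0 < x $ k \<longrightarrow> \<beta> i j x = hess_coeff c \<rho> i j x) \<and>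
      (\<forall>x\<in>cimg c U. x $ k = 0 \<and> (i \<noteq> k \<or> j \<noteq> k) \<longrightarrow> \<beta> i j x = - G i j x * y x)"
    if \<rho>: "defining_fun k A U \<rho>" for U \<rho>
  proof -
    let ?Y = "cimg c U"
    have U: "open U" "smooth_fun A U \<rho>" using \<rho> by (auto simp: defining_fun_def)
    have Y: "hopen k ?Y" "?Y \<subseteq> ?X" using hopen_cimg[OF c U(1)] by auto
    obtain h where h: "smooth_on ?Y h" "\<And>x. x \<in> ?Y \<Longrightarrow> \<rho> (cinv c x) = x $ k * h x" "\<And>x. x \<in> ?Y \<Longrightarrow> h x \<noteq> 0"
      using defining_fun_factor[OF \<rho> c] by blast
    let ?e = "\<lambda>i. axis i 1 :: real ^ 'n"
    let ?h1 = "\<lambda>i x. hD k h x (?e i)"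
    let ?h2 = "\<lambda>i j x. hD k (?h1 j) x (?e i)"
    have h1: "smooth_on ?Y (?h1 i)" for i by (rule smooth_on_hD[OF h(1) Y(1)])
    have h2: "smooth_on ?Y (?h2 i j)" for i j by (rule smooth_on_hD[OF h1 Y(1)])
    define \<beta> where "\<beta> i j x = (x $ k * ?h2 i j x / h x - G i j x - hD k h x (T i j x) / h x
      - 2 * x $ k * ?h1 i x * ?h1 j x / (h x * h x)) * y x" for i j x
    have "smooth_on ?Y (\<beta> i j)" for i j
      unfolding \<beta>_def
      by (intro smooth_on_mult smooth_on_diff smooth_on_divide smooth_on_nth smooth_on_const h h1 h2
          smooth_on_hD_comp[OF h(1) Y(1)] smooth_on_subset[OF y(1) Y(2)] smooth_on_subset[OF G(1) Y(2)]
          smooth_on_subset[OF T(1) Y(2)]) (use h(3) in auto)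
    moreover have "\<beta> i j x = hess_coeff c \<rho> i j x" if x: "x \<in> ?Y" "0 < x $ k" for i j x
    proof -
      define R where "R x = \<rho> (cinv c x)" for x
      have xX: "x \<in> ?X" using x Y by blast
      let ?a = "?e i $ k" and ?b = "?e j $ k"
      have R: "R x = x $ k * h x" if "x \<in> ?Y" for x using h(2)[OF that] by (simp add: R_def)
      have dR: "hD k R x v = v $ k * h x + x $ k * hD k h x v" if "x \<in> ?Y" for x v
        by (rule hD_boundary_vanishing[OF Y(1) h(1) R that])
      have "hD k (\<lambda>x. hD k R x (?e j)) x (?e i) = hD k (\<lambda>x. ?b * h x + x $ k * ?h1 j x) x (?e i)"
        by (rule fun_cong[OF hD_cong[OF Y(1) x(1) dR]])
      also have "\<dots> = hD k (\<lambda>x. ?b * h x) x (?e i) + hD k (\<lambda>x. x $ k * ?h1 j x) x (?e i)"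
        by (rule hD_add[OF _ _ Y(1) x(1)]) (intro smooth_on_mult smooth_on_const smooth_on_nth h h1)+
      also have "hD k (\<lambda>x. ?b * h x) x (?e i) = ?b * ?h1 i x"
        using hD_mult[OF smooth_on_const h(1) Y(1) x(1), of ?b "?e i"]
          hD_const[OF hopen_in_half_space[OF Y(1) x(1)], of ?b "?e i"] by simp
      also have "hD k (\<lambda>x. x $ k * ?h1 j x) x (?e i) = ?a * ?h1 j x + x $ k * ?h2 i j x"
        by (rule hD_boundary_vanishing[OF Y(1) h1 refl x(1)])
      finally have R2: "hD k (\<lambda>x. hD k R x (?e j)) x (?e i) = ?b * ?h1 i x + ?a * ?h1 j x + x $ k * ?h2 i j x"
        by simp
      have lin: "linear (hD k h x)" using hD_linear[OF h(1) Y(1) x(1)] bounded_linear.linear by blast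
      have "x $ k *\<^sub>R christoffel c i j x = T i j x - ?a *\<^sub>R ?e j - ?b *\<^sub>R ?e i"
        using x(2) T(2)[OF xX x(2), of i j] by (simp add: mod_christoffel_def scaleR_add_right)
      then have "x $ k * hD k h x (christoffel c i j x) = hD k h x (T i j x - ?a *\<^sub>R ?e j - ?b *\<^sub>R ?e i)"
        using linear_cmul[OF lin, of "x $ k"] by (metis real_scaleR_def)
      also have "\<dots> = hD k h x (T i j x) - ?a * ?h1 j x - ?b * ?h1 i x"
        by (simp add: linear_diff[OF lin] linear_cmul[OF lin])
      finally have R1: "hD k R x (christoffel c i j x) =
          (G i j x - 2 * ?a * ?b / x $ k) * h x + (hD k h x (T i j x) - ?a * ?h1 j x - ?b * ?h1 i x)"
        using dR[OF x(1), of "christoffel c i j x"] G(2)[OF xX x(2), of i j]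
        by (simp add: mod_christoffel_def)
      have "hess_coeff c \<rho> i j x =
        (hD k (\<lambda>x. hD k R x (?e j)) x (?e i) - hD k R x (christoffel c i j x)
          - 2 * hD k R x (?e i) * hD k R x (?e j) / R x) * \<sigma> (cinv c x) c / R x"
        by (simp add: hess_coeff_def Let_def R_def[abs_def])
      also have "\<dots> = \<beta> i j x"
        unfolding R2 R1
        unfolding dR[OF x(1)] R[OF x(1)] y(2)[OF xX x(2)] \<beta>_def
        by (rule hess_coeff_algebra) (use x h(3) in auto)
      finally show ?thesis ..
    qed
    moreover have "\<beta> i j x = - G i j x * y x" if x: "x \<in> ?Y" "x $ k = 0" "i \<noteq> k \<or> j \<noteq> k" for i j x
    proof -
      have "hD k h x 0 = 0"
        using hD_linear[OF h(1) Y(1) x(1)] by (simp add: bounded_linear.linear linear_0)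
      moreover have "T i j x = 0" using T0[OF x(3)] x Y by blast
      ultimately show ?thesis using x by (simp add: \<beta>_def)
    qed
    ultimately show ?thesis by blast
  qed
  moreover have "smooth_on ?X (\<lambda>x. - G i j x * y x)" for i j
    by (intro smooth_on_mult smooth_on_minus G y)
  ultimately show ?thesis by (intro exI[of _ "\<lambda>i j x. - G i j x * y x"]) simp
qed

end


section \<open>The boundary value of the Hessian\<close>

context boundary_manifold
begin

lemma det_jac_nonzero:
  assumes "c \<in> A" "d \<in> A" "p \<in> fst c" "p \<in> fst d"
  shows "det (matrix (jac c d p)) \<noteq> 0"
proof -
  have l: "linear (jac c d p)" "linear (jac d c p)"
    using jac_linear assms bounded_linear.linear by blast+
  have "jac d c p \<circ> jac c d p = id"
    using jac_comp[OF assms(1,2,1,3,4,3)] assms by (simp add: fun_eq_iff)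
  then have "matrix (jac d c p) ** matrix (jac c d p) = mat 1"
    using matrix_compose[OF l] matrix_id_mat_1 by (metis id_def)
  then show ?thesis
    by (metis det_I det_mul mult_zero_right zero_neq_one)
qed

lemma det_jac_continuous:
  assumes "c \<in> A" "d \<in> A"
  shows "continuous_on (cimg c (fst d)) (\<lambda>x. det (matrix (jac c d (cinv c x))))"
proof -
  have "continuous_on (cimg c (fst d)) (\<lambda>x. jac c d (cinv c x) (axis j 1) $ i)" for i j
  proof (rule continuous_on_eq[OF smooth_on_continuous])
    show "smooth_on (cimg c (fst d)) (\<lambda>x. hD k (\<lambda>x. snd d (cinv c x)) x (axis j 1) $ i)"
      by (intro smooth_on_vec_nth smooth_on_hD transition_smooth hopen_cimg chart_open assms)
    show "hD k (\<lambda>x. snd d (cinv c x)) x (axis j 1) $ i = jac c d (cinv c x) (axis j 1) $ i"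
      if "x \<in> cimg c (fst d)" for x
      using cinv_in[OF assms(1) that] snd_cinv[OF assms(1) that] jac_eq[OF assms, of "cinv c x"] by simp
  qed
  then show ?thesis
    unfolding det_def matrix_def by (simp add: continuous_intros)
qed

lemma bilin_frame:
  assumes B: "bilin_on (tangent_space A p) E B" and c: "c \<in> A" "p \<in> fst c"
    and u: "u \<in> tangent_space A p" and v: "v \<in> tangent_space A p"
  shows "B u v d = (\<Sum>i\<in>UNIV. \<Sum>j\<in>UNIV. u c $ i * v c $ j * B (coord_field A c i p) (coord_field A c j p) d)"
proof -
  let ?e = "\<lambda>i. coord_field A c i p"
  have e: "?e i \<in> tangent_space A p" for i
    unfolding coord_field_const_field by (rule const_field_tangent[OF c])
  define P where "P F w = (\<lambda>d. \<Sum>i\<in>F. w c $ i *\<^sub>R ?e i d)" for F and w :: "('m, 'n) tvec"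
  have ins: "P (insert i F) w = fadd (fscale (w c $ i) (?e i)) (P F w)" if "i \<notin> F" for i F w
    using that by (simp add: P_def fun_eq_iff)
  have emp: "P {} w = fscale 0 w" for w by (simp add: P_def fun_eq_iff)
  have add: "B (fadd u u') v = fadd (B u v) (B u' v)" "B v (fadd u u') = fadd (B v u) (B v u')"
    if "u \<in> tangent_space A p" "u' \<in> tangent_space A p" "v \<in> tangent_space A p" for u u' v
    using B that unfolding bilin_on_def by blast+
  have scale: "B (fscale a u) v = fscale a (B u v)" "B u (fscale a v) = fscale a (B u v)"
    if "u \<in> tangent_space A p" "v \<in> tangent_space A p" for u v a
    using B that unfolding bilin_on_def by blast+
  have PT: "P F w \<in> tangent_space A p" if "w \<in> tangent_space A p" for F w
  proof (induction F rule: infinite_finite_induct)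
    case (insert i F)
    show ?case unfolding ins[OF insert(2)] by (intro tangent_add tangent_scale e insert)
  next
    case empty
    show ?case unfolding emp by (rule tangent_scale[OF that])
  qed simp
  have left: "B (P F u) v d = (\<Sum>i\<in>F. u c $ i * B (?e i) v d)" if v: "v \<in> tangent_space A p" for F v
  proof (induction F rule: infinite_finite_induct)
    case (insert i F)
    show ?case
      unfolding ins[OF insert(2)] add(1)[OF tangent_scale[OF e] PT[OF u] v] scale(1)[OF e v]
      using insert by simp
  next
    case empty
    show ?case unfolding emp scale(1)[OF u v] by simp
  qed simp
  have right: "B w (P F v) d = (\<Sum>j\<in>F. v c $ j * B w (?e j) d)" if w: "w \<in> tangent_space A p" for F w
  proof (induction F rule: infinite_finite_induct)
    case (insert i F)
    show ?case
      unfolding ins[OF insert(2)] add(2)[OF tangent_scale[OF e] PT[OF v] w] scale(2)[OF w e]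
      using insert by simp
  next
    case empty
    show ?case unfolding emp scale(2)[OF w v] by simp
  qed simp
  have full: "P UNIV w = w" if w: "w \<in> tangent_space A p" for w
  proof (rule tangent_eqI[OF PT[OF w] w c])
    show "P UNIV w c = w c"
      using basis_expansion[of "w c"] c by (simp add: P_def coord_field_const_field scalar_mult_eq_scaleR)
  qed
  have "B u v d = B (P UNIV u) (P UNIV v) d" by (simp add: full u v)
  also have "\<dots> = (\<Sum>i\<in>UNIV. u c $ i * (\<Sum>j\<in>UNIV. v c $ j * B (?e i) (?e j) d))"
    by (simp add: left[OF PT[OF v]] right[OF e])
  finally show ?thesis by (simp add: sum_distrib_left mult.assoc)
qed

end

context precompact_manifold
begin

lemma second_deriv_ext_bilin:
  assumes "second_deriv_ext k A D \<sigma> U \<rho> b" "p \<in> U"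
  shows "bilin_on (tangent_space A p) (dens_space A 1 p) (b p)"
proof -
  have "bilin_section A 1 (tangent_space A) U b" using assms(1) by (simp add: second_deriv_ext_def)
  then have "\<forall>p\<in>U. bilin_on (tangent_space A p) (dens_space A 1 p) (b p)"
    unfolding bilin_section_def by (rule conjunct1)
  then show ?thesis using assms(2) by (rule bspec)
qed

lemma bilin_on_value: "bilin_on T E b \<Longrightarrow> u \<in> T \<Longrightarrow> v \<in> T \<Longrightarrow> b u v \<in> E"
  unfolding bilin_on_def by (drule conjunct1) blast

text \<open>A smooth extension is determined by its values in the interior, so its coefficients in the frame are
  the extended ones.\<close>

lemma second_deriv_ext_chart:
  assumes \<rho>: "defining_fun k A U \<rho>" and b: "second_deriv_ext k A D \<sigma> U \<rho> b" and c: "c \<in> A"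
    and \<beta>: "\<And>i j. smooth_on (cimg c U) (\<beta> i j)"
      "\<And>i j x. x \<in> cimg c U \<Longrightarrow> 0 < x $ k \<Longrightarrow> \<beta> i j x = hess_coeff c \<rho> i j x"
    and p: "p \<in> U" "p \<in> fst c" and u: "u \<in> tangent_space A p" and v: "v \<in> tangent_space A p"
  shows "b p u v c = (\<Sum>i\<in>UNIV. \<Sum>j\<in>UNIV. u c $ i * v c $ j * \<beta> i j (snd c p))"
proof -
  let ?e = "coord_field A c"
  have U: "open U" using \<rho> by (simp add: defining_fun_def)
  have sec: "bilin_section A 1 (tangent_space A) U b"
    and sd: "is_second_deriv A (U \<inter> M) 1 (rho_conn A D \<rho>) \<sigma> b"
    using b by (auto simp: second_deriv_ext_def)
  have bil: "bilin_on (tangent_space A p) (dens_space A 1 p) (b p)"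
    by (rule second_deriv_ext_bilin[OF b p(1)])
  have W0: "open (fst c \<inter> U)" using chart_open[OF c] U by auto
  have f0: "vfield A (fst c \<inter> U) (?e i)" for i by (rule coord_field_vfield[OF c W0]) auto
  have "b p (?e i p) (?e j p) c = \<beta> i j (snd c p)" for i j
  proof -
    let ?B = "\<lambda>x. b (cinv c x) (?e i (cinv c x)) (?e j (cinv c x)) c"
    have "dens_section A 1 (fst c \<inter> U) (\<lambda>p. b p (?e i p) (?e j p))"
      using sec[unfolded bilin_section_def, THEN conjunct2, rule_format, OF chart_open[OF c] f0 f0]
        vfield_tangent[OF f0] by blast
    then have "smooth_on (cimg c (fst c \<inter> U)) ?B"
      using c unfolding dens_section_def smooth_comps_def by blast
    then have B: "smooth_on (cimg c U) ?B" by simp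
    have "?B (snd c p) = \<beta> i j (snd c p)"
    proof (rule hopen_continuous_agree[where f = ?B and g = "\<beta> i j", OF hopen_cimg[OF c U] smooth_on_continuous[OF B]
          smooth_on_continuous[OF \<beta>(1)]])
      fix x assume x: "x \<in> cimg c U" "0 < x $ k"
      let ?W = "fst c \<inter> (U \<inter> M)" and ?q = "cinv c x"
      have q: "?q \<in> fst c" "?q \<in> U" "snd c ?q = x" using x c by auto
      have W: "open ?W" "?W \<subseteq> U \<inter> M" "?q \<in> ?W"
        using chart_open[OF c] U open_intr q x intr_iff[OF c q(1)] by auto
      have f: "vfield A ?W (?e i)" for i by (rule coord_field_vfield[OF c W(1)]) auto
      have "b ?q (?e i ?q) (?e j ?q) = second_deriv A 1 (rho_conn A D \<rho>) \<sigma> (?e i) (?e j) ?q"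
        using sd[unfolded is_second_deriv_def, THEN conjunct2, rule_format, OF W(1,2) f f W(3)] .
      then have "?B x = (\<Sum>i'\<in>UNIV. \<Sum>j'\<in>UNIV. axis i 1 $ i' * axis j 1 $ j' * hess_coeff c \<rho> i' j' x)"
        using second_deriv_sigma_chart[OF \<rho> W(1,2) f f W(3) c q(1), of i j] q c
        by (simp add: coord_field_const_field)
      also have "\<dots> = hess_coeff c \<rho> i j x" by (rule sum_axis_axis)
      finally show "?B x = \<beta> i j x" using \<beta>(2)[OF x] by simp
    qed (use p in auto)
    then show ?thesis using p c by simp
  qed
  then show ?thesis
    unfolding bilin_frame[OF bil c p(2) u v] by simp
qed

text \<open>The coefficients found in the single charts define a bilinear form, because their transformation law
  holds in the interior and extends to the boundary by continuity.\<close>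

lemma second_deriv_ext_exists:
  assumes \<rho>: "defining_fun k A U \<rho>"
  shows "\<exists>b. second_deriv_ext k A D \<sigma> U \<rho> b \<and> symmetric_on (tangent_space A) U b"
proof -
  have U: "open U" using \<rho> by (simp add: defining_fun_def)
  have "\<exists>\<beta>. \<forall>i j. smooth_on (cimg c U) (\<beta> i j) \<and> (\<forall>x\<in>cimg c U. 0 < x $ k \<longrightarrow> \<beta> i j x = hess_coeff c \<rho> i j x)"
    if "c \<in> A" for c
    using hess_coeff_extends[OF that] \<rho> by meson
  then obtain \<beta> where \<beta>: "\<And>c i j. c \<in> A \<Longrightarrow> smooth_on (cimg c U) (\<beta> c i j)"
    "\<And>c i j x. c \<in> A \<Longrightarrow> x \<in> cimg c U \<Longrightarrow> 0 < x $ k \<Longrightarrow> \<beta> c i j x = hess_coeff c \<rho> i j x"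
    by metis
  have \<beta>s: "\<beta> c i j x = \<beta> c j i x" if c: "c \<in> A" and x: "x \<in> cimg c U" for c i j x
    by (rule hopen_continuous_agree[where f = "\<beta> c i j" and g = "\<beta> c j i", OF hopen_cimg[OF c U] smooth_on_continuous[OF \<beta>(1)[OF c]]
          smooth_on_continuous[OF \<beta>(1)[OF c]] _ x])
       (use \<beta>(2)[OF c] hess_coeff_symmetric[OF \<rho> c] in simp)
  define b where "b p u v c = (if c \<in> A \<and> p \<in> fst c then
      (\<Sum>i\<in>UNIV. \<Sum>j\<in>UNIV. u c $ i * v c $ j * \<beta> c i j (snd c p)) else 0)" for p and u v :: "('m, 'n) tvec" and c
  have b2: "b p (\<xi> p) (\<eta> p) = second_deriv A 1 (rho_conn A D \<rho>) \<sigma> \<xi> \<eta> p"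
    if W: "open W" "W \<subseteq> U \<inter> M" and v: "vfield A W \<xi>" "vfield A W \<eta>" and p: "p \<in> W" for W \<xi> \<eta> p
  proof
    fix c
    show "b p (\<xi> p) (\<eta> p) c = second_deriv A 1 (rho_conn A D \<rho>) \<sigma> \<xi> \<eta> p c"
    proof (cases "c \<in> A \<and> p \<in> fst c")
      case True
      then have "snd c p \<in> cimg c U" "0 < snd c p $ k" using W p intr_iff[of c p] by auto
      then show ?thesis
        using True second_deriv_sigma_chart[OF \<rho> W v p, of c] \<beta>(2)[of c "snd c p"] by (simp add: b_def)
    next
      case False
      then show ?thesis
        unfolding second_deriv_sigma[OF \<rho> W v p]
        using dens_supp[OF sigma_dens[of p] False] W p by (auto simp: b_def)
    qed
  qed
  have dens_int: "b p u v \<in> dens_space A 1 p"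
    if p: "p \<in> U \<inter> M" and uv: "u \<in> tangent_space A p" "v \<in> tangent_space A p" for p u v
  proof -
    obtain c where c: "c \<in> A" "p \<in> fst c" using chart_exists by blast
    let ?W = "fst c \<inter> (U \<inter> M)"
    have W: "open ?W" "?W \<subseteq> U \<inter> M" "p \<in> ?W" using chart_open[OF c(1)] U open_intr p c by auto
    have f: "vfield A ?W (const_field A c w)" for w by (rule const_field_vfield[OF c(1) W(1)]) auto
    have "b p u v = b p (const_field A c (u c) p) (const_field A c (v c) p)"
      using const_field_eq[OF uv(1) c] const_field_eq[OF uv(2) c] by simp
    then show ?thesis
      unfolding b2[OF W(1,2) f f W(3)] second_deriv_sigma[OF \<rho> W(1,2) f f W(3)]
      using dens_scale[OF dens_scale[OF sigma_dens]] p by auto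
  qed
  have dens: "b p u v \<in> dens_space A 1 p"
    if p: "p \<in> U" and uv: "u \<in> tangent_space A p" "v \<in> tangent_space A p" for p u v
  proof -
    have "b p u v d = \<bar>det (matrix (jac c d p))\<bar> powr (1 / (real CARD('n) + 1)) * b p u v c"
      if c: "c \<in> A" "p \<in> fst c" and d: "d \<in> A" "p \<in> fst d" for c d
    proof -
      \<comment> \<open>The two sides of the transformation law as continuous functions in the chart \<open>c\<close>, for vectors with
        constant coordinates there.\<close>
      let ?Y = "cimg c (U \<inter> fst d)"
      let ?J = "\<lambda>x w. hD k (\<lambda>x. snd d (cinv c x)) x w"
      let ?L = "\<lambda>x. \<Sum>i\<in>UNIV. \<Sum>j\<in>UNIV. ?J x (u c) $ i * ?J x (v c) $ j * \<beta> d i j (snd d (cinv c x))"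
      let ?w = "\<lambda>x. \<bar>det (matrix (jac c d (cinv c x)))\<bar> powr (1 / (real CARD('n) + 1))"
      let ?R = "\<lambda>x. ?w x * (\<Sum>i\<in>UNIV. \<Sum>j\<in>UNIV. u c $ i * v c $ j * \<beta> c i j x)"
      have Y: "hopen k ?Y" by (intro hopen_cimg c open_Int U chart_open d)
      have x: "snd c p \<in> ?Y" using c d p by auto
      have tr: "smooth_on ?Y (\<lambda>x. snd d (cinv c x))"
        by (rule smooth_on_subset[OF transition_smooth[OF c(1) d(1)]]) auto
      have \<beta>d: "smooth_on ?Y (\<lambda>x. \<beta> d i j (snd d (cinv c x)))" for i j
        by (rule smooth_on_compose[OF tr \<beta>(1)[OF d(1)]]) (use c d in auto)
      have \<beta>c: "smooth_on ?Y (\<beta> c i j)" for i j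
        by (rule smooth_on_subset[OF \<beta>(1)[OF c(1)]]) auto
      have contL: "continuous_on ?Y ?L"
        by (intro smooth_on_continuous smooth_on_sum smooth_on_mult smooth_on_vec_nth smooth_on_hD tr Y \<beta>d)
      have "continuous_on ?Y (\<lambda>x. \<Sum>i\<in>UNIV. \<Sum>j\<in>UNIV. u c $ i * v c $ j * \<beta> c i j x)"
        by (intro smooth_on_continuous smooth_on_sum smooth_on_mult smooth_on_const \<beta>c)
      moreover have "continuous_on ?Y ?w"
      proof (intro continuous_on_powr continuous_on_rabs continuous_on_const ballI)
        show "continuous_on ?Y (\<lambda>x. det (matrix (jac c d (cinv c x))))"
          by (rule continuous_on_subset[OF det_jac_continuous[OF c(1) d(1)]]) auto
        show "\<bar>det (matrix (jac c d (cinv c x)))\<bar> \<noteq> 0" if "x \<in> ?Y" for x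
        proof -
          have "cinv c x \<in> fst c" "cinv c x \<in> fst d" using cinv_in[OF c(1) that] by auto
          from det_jac_nonzero[OF c(1) d(1) this] show ?thesis by simp
        qed
      qed
      ultimately have contR: "continuous_on ?Y ?R" by (intro continuous_on_mult)
      have q: "cinv c x \<in> fst c" "cinv c x \<in> fst d" "cinv c x \<in> U" "snd c (cinv c x) = x"
        "?J x = jac c d (cinv c x)" if "x \<in> ?Y" for x
        using cinv_in[OF c(1) that] snd_cinv[OF c(1) that] jac_eq[OF c(1) d(1), of "cinv c x"] by auto
      have "?L (snd c p) = ?R (snd c p)"
      proof (rule hopen_continuous_agree[where f = ?L and g = ?R, OF Y contL contR _ x])
        fix x assume x: "x \<in> ?Y" "0 < x $ k"
        let ?q = "cinv c x"
        note q = q[OF x(1)]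
        have t: "const_field A c w ?q \<in> tangent_space A ?q" for w by (rule const_field_tangent[OF c(1) q(1)])
        have "?q \<in> U \<inter> M" using q x intr_iff[OF c(1) q(1)] by auto
        from dens_transform[OF dens_int[OF this t t] c(1) d(1) q(1,2), of "u c" "v c"]
        show "?L x = ?R x"
          using c(1) d(1) q by (simp add: b_def const_field_def)
      qed
      then show ?thesis
        using c d q[OF x] tangent_transform[OF uv(1) c(1) d(1) c(2) d(2)] tangent_transform[OF uv(2) c(1) d(1) c(2) d(2)]
        by (simp add: b_def)
    qed
    moreover have "fibre_supp A p (b p u v)" by (simp add: fibre_supp_def b_def)
    ultimately show ?thesis unfolding dens_space_def by blast
  qed
  have bil: "bilin_on (tangent_space A p) (dens_space A 1 p) (b p)" if "p \<in> U" for p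
    unfolding bilin_on_def
  proof (intro conjI ballI allI)
    show "b p u v \<in> dens_space A 1 p" if "u \<in> tangent_space A p" "v \<in> tangent_space A p" for u v
      using dens \<open>p \<in> U\<close> that by blast
    show "b p (fadd u u') v = fadd (b p u v) (b p u' v)" "b p v (fadd u u') = fadd (b p v u) (b p v u')"
      "b p (fscale a u) v = fscale a (b p u v)" "b p u (fscale a v) = fscale a (b p u v)" for u u' v a
      by (simp_all add: fun_eq_iff b_def algebra_simps sum.distrib sum_distrib_left)
  qed
  have sec: "bilin_section A 1 (tangent_space A) S b" if S: "S \<subseteq> U" for S
    unfolding bilin_section_def
  proof (intro conjI ballI allI impI)
    show "bilin_on (tangent_space A p) (dens_space A 1 p) (b p)" if "p \<in> S" for p using bil S that by blast
    fix V \<xi> \<eta> assume v: "vfield A (V \<inter> S) \<xi>" "vfield A (V \<inter> S) \<eta>"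
    have "smooth_on (cimg c (V \<inter> S)) (\<lambda>x. b (cinv c x) (\<xi> (cinv c x)) (\<eta> (cinv c x)) c)" if c: "c \<in> A" for c
    proof (rule smooth_on_cong)
      show "smooth_on (cimg c (V \<inter> S)) (\<lambda>x. \<Sum>i\<in>UNIV. \<Sum>j\<in>UNIV. \<xi> (cinv c x) c $ i * \<eta> (cinv c x) c $ j * \<beta> c i j x)"
        by (intro smooth_on_sum smooth_on_mult smooth_on_vec_nth vfield_chartD[OF v(1) c] vfield_chartD[OF v(2) c]
            smooth_on_subset[OF \<beta>(1)[OF c]]) (use S in auto)
      show "(\<Sum>i\<in>UNIV. \<Sum>j\<in>UNIV. \<xi> (cinv c x) c $ i * \<eta> (cinv c x) c $ j * \<beta> c i j x) = b (cinv c x) (\<xi> (cinv c x)) (\<eta> (cinv c x)) c"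
        if "x \<in> cimg c (V \<inter> S)" for x
        using cinv_in[OF c that] snd_cinv[OF c that] c by (simp add: b_def)
    qed
    then show "dens_section A 1 (V \<inter> S) (\<lambda>p. b p (\<xi> p) (\<eta> p))"
      unfolding dens_section_def smooth_comps_def
      using dens S vfield_tangent[OF v(1)] vfield_tangent[OF v(2)] by blast
  qed
  have "symmetric_on (tangent_space A) U b"
    unfolding symmetric_on_def
  proof (intro ballI ext)
    fix p u v c assume p: "p \<in> U"
    show "b p u v c = b p v u c"
    proof (cases "c \<in> A \<and> p \<in> fst c")
      case True
      then have "\<beta> c i j (snd c p) = \<beta> c j i (snd c p)" for i j
        by (intro \<beta>s) (use p in auto)
      then show ?thesis
        using True by (simp add: b_def, subst sum.swap, simp add: mult.commute mult.left_commute)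
    next
      case False
      then show ?thesis by (simp only: b_def if_False)
    qed
  qed
  moreover have "second_deriv_ext k A D \<sigma> U \<rho> b"
    unfolding second_deriv_ext_def is_second_deriv_def using sec[of U] sec[of "U \<inter> M"] b2 by blast
  ultimately show ?thesis by blast
qed

text \<open>At the boundary only the coefficient of the square of the conormal depends on the defining function.\<close>

lemma second_deriv_ext_unique:
  assumes \<rho>: "defining_fun k A U \<rho>" "second_deriv_ext k A D \<sigma> U \<rho> b" "p \<in> U"
    and \<rho>': "defining_fun k A U' \<rho>'" "second_deriv_ext k A D \<sigma> U' \<rho>' b'" "p \<in> U'"
    and p: "p \<in> bdry k A" and u: "u \<in> tangent_space A p" and v: "v \<in> tangent_space A p"
    and uv: "u \<in> bdry_tangent_space k A p \<or> v \<in> bdry_tangent_space k A p"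
  shows "b p u v = b' p u v"
proof (rule dens_eqI)
  show "b p u v \<in> dens_space A 1 p"
    by (rule bilin_on_value[OF second_deriv_ext_bilin[OF \<rho>(2,3)] u v])
  show "b' p u v \<in> dens_space A 1 p"
    by (rule bilin_on_value[OF second_deriv_ext_bilin[OF \<rho>'(2,3)] u v])
  fix c assume c: "c \<in> A" "p \<in> fst c"
  obtain \<beta>0 where \<beta>0: "\<forall>U \<rho>. defining_fun k A U \<rho> \<longrightarrow> (\<exists>\<beta>. \<forall>i j. smooth_on (cimg c U) (\<beta> i j) \<and>
      (\<forall>x\<in>cimg c U. 0 < x $ k \<longrightarrow> \<beta> i j x = hess_coeff c \<rho> i j x) \<and>
      (\<forall>x\<in>cimg c U. x $ k = 0 \<and> (i \<noteq> k \<or> j \<noteq> k) \<longrightarrow> \<beta> i j x = \<beta>0 i j x))"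
    using hess_coeff_extends[OF c(1)] by (elim exE conjE) (rule that)
  have k0: "snd c p $ k = 0" using bdry_iff[OF c] p by simp
  have uv0: "u c $ k = 0 \<or> v c $ k = 0" using uv bdry_tangent_chart[OF c] by blast
  have "b p u v c = (\<Sum>i\<in>UNIV. \<Sum>j\<in>UNIV. u c $ i * v c $ j * \<beta>0 i j (snd c p))"
    if \<rho>: "defining_fun k A U \<rho>" "second_deriv_ext k A D \<sigma> U \<rho> b" "p \<in> U" for U \<rho> b
  proof -
    obtain \<beta> where "\<forall>i j. smooth_on (cimg c U) (\<beta> i j) \<and>
      (\<forall>x\<in>cimg c U. 0 < x $ k \<longrightarrow> \<beta> i j x = hess_coeff c \<rho> i j x) \<and>
      (\<forall>x\<in>cimg c U. x $ k = 0 \<and> (i \<noteq> k \<or> j \<noteq> k) \<longrightarrow> \<beta> i j x = \<beta>0 i j x)"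
      using \<beta>0[rule_format, OF \<rho>(1)] by (rule exE)
    then have \<beta>: "\<And>i j. smooth_on (cimg c U) (\<beta> i j)"
      "\<And>i j x. x \<in> cimg c U \<Longrightarrow> 0 < x $ k \<Longrightarrow> \<beta> i j x = hess_coeff c \<rho> i j x"
      "\<And>i j x. x \<in> cimg c U \<Longrightarrow> x $ k = 0 \<Longrightarrow> i \<noteq> k \<or> j \<noteq> k \<Longrightarrow> \<beta> i j x = \<beta>0 i j x"
      by blast+
    have eq: "u c $ i * v c $ j * \<beta> i j (snd c p) = u c $ i * v c $ j * \<beta>0 i j (snd c p)" for i j
    proof (cases "i \<noteq> k \<or> j \<noteq> k")
      case True
      then show ?thesis using \<beta>(3)[of "snd c p" i j] k0 c \<rho>(3) by simp
    qed (use uv0 in auto)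
    show ?thesis
      using second_deriv_ext_chart[where \<beta> = \<beta>, OF \<rho>(1,2) c(1) \<beta>(1,2) \<rho>(3) c(2) u v]
      by (simp only: eq)
  qed
  from this[OF \<rho>] this[OF \<rho>'] show "b p u v c = b' p u v c" by simp
qed

text \<open>Along the boundary the differential of \<open>\<rho>\<close> annihilates tangential fields, so it is divisible there by the
  boundary coordinate.\<close>

lemma diff_defining_bdry:
  assumes \<rho>: "defining_fun k A U \<rho>" and \<eta>: "bdry_vfield k A U \<eta>" and c: "c \<in> A"
  shows "\<exists>g. smooth_on (cimg c U) g \<and> (\<forall>x\<in>cimg c U. diff_fun A \<rho> (cinv c x) (\<eta> (cinv c x)) = x $ k * g x)"
proof -
  have U: "open U" "smooth_fun A U \<rho>" using \<rho> by (auto simp: defining_fun_def)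
  have v: "vfield A U \<eta>" using \<eta> by (simp add: bdry_vfield_def)
  let ?Y = "cimg c U" and ?E = "\<lambda>x. diff_fun A \<rho> (cinv c x) (\<eta> (cinv c x))"
  have Y: "hopen k ?Y" by (rule hopen_cimg[OF c U(1)])
  have E: "smooth_on ?Y ?E" by (rule smooth_fun_chartD[OF diff_fun_smooth[OF U(2,1) v] c])
  obtain h where h: "smooth_on ?Y h" "\<And>x. x \<in> ?Y \<Longrightarrow> \<rho> (cinv c x) = x $ k * h x"
    using defining_fun_factor[OF \<rho> c] by blast
  have "?E x = 0" if x: "x \<in> ?Y" "x $ k = 0" for x
  proof -
    have q: "cinv c x \<in> fst c" "cinv c x \<in> U" "snd c (cinv c x) = x"
      using cinv_in[OF c x(1)] snd_cinv[OF c x(1)] by auto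
    then have "cinv c x \<in> bdry k A" using bdry_iff[OF c q(1)] x by simp
    then have "\<eta> (cinv c x) c $ k = 0"
      using bdry_tangent_chart(1)[OF c q(1)] \<eta> q by (auto simp: bdry_vfield_def)
    then show ?thesis
      using diff_fun_chart[OF U(2,1) q(2) c q(1) vfield_tangent[OF v q(2)]] q(3)
        hD_boundary_vanishing[OF Y h x(1)] x(2) by simp
  qed
  then show ?thesis using smooth_divide_boundary_coordinate[OF Y E] by blast
qed

text \<open>The difference between \<open>\<xi> (d\<rho> \<eta>)\<close> and \<open>d\<rho> \<xi> d\<rho> \<eta> / \<rho>\<close> is divisible by the boundary coordinate \<open>x\<close>.  Here \<open>\<rho> = x h\<close>,
  \<open>\<sigma> = x y\<close> and \<open>d\<rho> \<eta> = x g\<close>; primes denote derivatives along \<open>\<xi>\<close>, whose boundary coordinate is \<open>v\<close>; and \<open>d\<close> is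
  the term with the covariant derivative, which occurs on both sides.\<close>

lemma mixed_algebra:
  fixes x h y g g' h' v d :: real
  assumes "x \<noteq> 0" "h \<noteq> 0"
  shows "(v * g + x * g' - d) * (y / h) - x * (g' - g * h' / h) * y / h =
    ((v * h + x * h') * (x * g) / (x * h) - d) * (y / h)"
  using assms by (simp add: field_simps)

text \<open>In the interior the given density differs from the second derivative by the boundary coordinate times a
  smooth function, hence it extends and has the same boundary values.\<close>

lemma boundary_value_mixed:
  assumes \<rho>: "defining_fun k A U \<rho>" and b: "second_deriv_ext k A D \<sigma> U \<rho> b"
    and \<xi>: "vfield A U \<xi>" and \<eta>: "bdry_vfield k A U \<eta>"
  shows "dens_boundary_value k A 1 U
    (\<lambda>p. fscale (diff_fun A \<rho> p (\<xi> p) * diff_fun A \<rho> p (\<eta> p) / \<rho> p - diff_fun A \<rho> p (rho_conn A D \<rho> \<xi> \<eta> p))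
           (fscale (1 / \<rho> p) (\<sigma> p)))
    (\<lambda>p. b p (\<xi> p) (\<eta> p))"
proof -
  let ?f = "\<lambda>p. fscale (diff_fun A \<rho> p (\<xi> p) * diff_fun A \<rho> p (\<eta> p) / \<rho> p - diff_fun A \<rho> p (rho_conn A D \<rho> \<xi> \<eta> p))
           (fscale (1 / \<rho> p) (\<sigma> p))"
  define t where "t p = (if p \<in> M then ?f p else b p (\<xi> p) (\<eta> p))" for p
  have U: "open U" "smooth_fun A U \<rho>" using \<rho> by (auto simp: defining_fun_def)
  have v: "vfield A U \<eta>" using \<eta> by (simp add: bdry_vfield_def)
  have sec: "bilin_section A 1 (tangent_space A) U b"
    and sd: "is_second_deriv A (U \<inter> M) 1 (rho_conn A D \<rho>) \<sigma> b"
    using b by (auto simp: second_deriv_ext_def)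
  have "dens_section A 1 (UNIV \<inter> U) (\<lambda>p. b p (\<xi> p) (\<eta> p))"
    using sec[unfolded bilin_section_def, THEN conjunct2, rule_format, of UNIV \<xi> \<eta>] \<xi> v
      vfield_tangent[OF \<xi>] vfield_tangent[OF v] by simp
  then have bs: "dens_section A 1 U (\<lambda>p. b p (\<xi> p) (\<eta> p))" by simp
  have W: "open (U \<inter> M)" using U open_intr by auto
  have vW: "vfield A (U \<inter> M) \<xi>" "vfield A (U \<inter> M) \<eta>" using \<xi> v vfield_subset by blast+
  have "dens_section A 1 U t"
    unfolding dens_section_def
  proof (intro conjI ballI)
    show "t p \<in> dens_space A 1 p" if "p \<in> U" for p
      using bs that dens_scale[OF dens_scale[OF sigma_dens]] by (auto simp: t_def dens_section_def)
    show "smooth_comps A U t"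
      unfolding smooth_comps_def
    proof
      fix c assume c: "c \<in> A"
      let ?Y = "cimg c U"
      have Y: "hopen k ?Y" by (rule hopen_cimg[OF c U(1)])
      let ?B = "\<lambda>x. b (cinv c x) (\<xi> (cinv c x)) (\<eta> (cinv c x)) c"
      let ?v = "\<lambda>x. \<xi> (cinv c x) c"
      have B: "smooth_on ?Y ?B" using bs c by (simp add: dens_section_def smooth_comps_def)
      have vs: "smooth_on ?Y ?v" by (rule vfield_chartD[OF \<xi> c])
      obtain h where h: "smooth_on ?Y h" "\<And>x. x \<in> ?Y \<Longrightarrow> \<rho> (cinv c x) = x $ k * h x" "\<And>x. x \<in> ?Y \<Longrightarrow> h x \<noteq> 0"
        using defining_fun_factor[OF \<rho> c] by blast
      obtain g where g: "smooth_on ?Y g" "\<And>x. x \<in> ?Y \<Longrightarrow> diff_fun A \<rho> (cinv c x) (\<eta> (cinv c x)) = x $ k * g x"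
        using diff_defining_bdry[OF \<rho> \<eta> c] by blast
      obtain y where y: "smooth_on (snd c ` fst c) y"
          "\<And>x. x \<in> snd c ` fst c \<Longrightarrow> 0 < x $ k \<Longrightarrow> \<sigma> (cinv c x) c = x $ k * y x"
        using sigma_factor[OF c] by blast
      have yY: "smooth_on ?Y y" by (rule smooth_on_subset[OF y(1)]) auto
      let ?t = "\<lambda>x. ?B x - x $ k * (hD k g x (?v x) - g x * hD k h x (?v x) / h x) * y x / h x"
      have "smooth_on ?Y ?t"
        by (intro smooth_on_diff smooth_on_divide smooth_on_mult smooth_on_nth B g h yY
            smooth_on_hD_comp[OF g(1) Y vs] smooth_on_hD_comp[OF h(1) Y vs]) (use h(3) in auto)
      then show "smooth_on ?Y (\<lambda>x. t (cinv c x) c)"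
      proof (rule smooth_on_cong)
        fix x assume x: "x \<in> ?Y"
        let ?q = "cinv c x"
        have q: "?q \<in> fst c" "?q \<in> U" "snd c ?q = x" using cinv_in[OF c x] snd_cinv[OF c x] by auto
        show "?t x = t ?q c"
        proof (cases "0 < x $ k")
          case False
          then have "x $ k = 0" using hopen_nonneg[OF Y x] by simp
          moreover have "?q \<notin> M" using intr_iff[OF c q(1)] q False by simp
          ultimately show ?thesis by (simp add: t_def)
        next
          case True
          have qM: "?q \<in> U \<inter> M" using intr_iff[OF c q(1)] q True by simp
          have "?B x = second_deriv A 1 (rho_conn A D \<rho>) \<sigma> \<xi> \<eta> ?q c"
            using sd[unfolded is_second_deriv_def, THEN conjunct2, rule_format, OF W subset_refl vW qM] by simp
          also have "\<dots> = (diff_fun A (\<lambda>q. diff_fun A \<rho> q (\<eta> q)) ?q (\<xi> ?q) - diff_fun A \<rho> ?q (rho_conn A D \<rho> \<xi> \<eta> ?q))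
              * (\<sigma> ?q c / \<rho> ?q)"
            unfolding second_deriv_sigma[OF \<rho> W subset_refl vW qM] by simp
          also have "diff_fun A (\<lambda>q. diff_fun A \<rho> q (\<eta> q)) ?q (\<xi> ?q) =
              hD k (\<lambda>x. diff_fun A \<rho> (cinv c x) (\<eta> (cinv c x))) x (?v x)"
            using diff_fun_chart[OF diff_fun_smooth[OF U(2,1) v] U(1) q(2) c q(1) vfield_tangent[OF \<xi> q(2)]] q(3) by simp
          also have "\<dots> = ?v x $ k * g x + x $ k * hD k g x (?v x)"
            by (rule hD_boundary_vanishing[OF Y g x])
          finally have Bx: "?B x = (?v x $ k * g x + x $ k * hD k g x (?v x) - diff_fun A \<rho> ?q (rho_conn A D \<rho> \<xi> \<eta> ?q))
              * (\<sigma> ?q c / \<rho> ?q)" .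
          have dr: "diff_fun A \<rho> ?q (\<xi> ?q) = ?v x $ k * h x + x $ k * hD k h x (?v x)"
            using diff_fun_chart[OF U(2,1) q(2) c q(1) vfield_tangent[OF \<xi> q(2)]] q(3)
              hD_boundary_vanishing[OF Y h(1,2) x] by simp
          have s: "\<sigma> ?q c / \<rho> ?q = y x / h x"
            using y(2)[of x] h(2)[OF x] True q by (metis imageI mult_divide_mult_cancel_left less_irrefl)
          have "t ?q c = (diff_fun A \<rho> ?q (\<xi> ?q) * diff_fun A \<rho> ?q (\<eta> ?q) / \<rho> ?q - diff_fun A \<rho> ?q (rho_conn A D \<rho> \<xi> \<eta> ?q))
             * (\<sigma> ?q c / \<rho> ?q)"
            using qM by (simp add: t_def)
          also have "\<dots> = ((?v x $ k * h x + x $ k * hD k h x (?v x)) * (x $ k * g x) / (x $ k * h x)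
             - diff_fun A \<rho> ?q (rho_conn A D \<rho> \<xi> \<eta> ?q)) * (y x / h x)"
            unfolding dr g(2)[OF x] s unfolding h(2)[OF x] ..
          finally have "t ?q c = \<dots>" .
          then show ?thesis
            unfolding Bx s using mixed_algebra[of "x $ k" "h x"] True h(3)[OF x] by simp
        qed
      qed
    qed
  qed
  then show ?thesis
    unfolding dens_boundary_value_def by (intro exI[of _ t]) (auto simp: t_def intr_def)
qed

text \<open>Each of the two factors of the numerator is divisible by the boundary coordinate, whereas the denominator
  is the boundary coordinate times a nowhere vanishing function.\<close>

lemma fun_boundary_value_zero:
  assumes \<rho>: "defining_fun k A U \<rho>" and \<xi>: "bdry_vfield k A U \<xi>" and \<eta>: "bdry_vfield k A U \<eta>"
  shows "fun_boundary_value k A U (\<lambda>p. diff_fun A \<rho> p (\<xi> p) * diff_fun A \<rho> p (\<eta> p) / \<rho> p) (\<lambda>p. 0)"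
proof -
  define F where "F p = (if p \<in> M then diff_fun A \<rho> p (\<xi> p) * diff_fun A \<rho> p (\<eta> p) / \<rho> p else 0)" for p
  have U: "open U" using \<rho> by (simp add: defining_fun_def)
  have "smooth_fun A U F"
    unfolding smooth_fun_def o_def
  proof
    fix c assume c: "c \<in> A"
    let ?Y = "cimg c U"
    obtain h where h: "smooth_on ?Y h" "\<And>x. x \<in> ?Y \<Longrightarrow> \<rho> (cinv c x) = x $ k * h x" "\<And>x. x \<in> ?Y \<Longrightarrow> h x \<noteq> 0"
      using defining_fun_factor[OF \<rho> c] by blast
    obtain g where g: "smooth_on ?Y g" "\<And>x. x \<in> ?Y \<Longrightarrow> diff_fun A \<rho> (cinv c x) (\<eta> (cinv c x)) = x $ k * g x"
      using diff_defining_bdry[OF \<rho> \<eta> c] by blast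
    obtain f where f: "smooth_on ?Y f" "\<And>x. x \<in> ?Y \<Longrightarrow> diff_fun A \<rho> (cinv c x) (\<xi> (cinv c x)) = x $ k * f x"
      using diff_defining_bdry[OF \<rho> \<xi> c] by blast
    have "smooth_on ?Y (\<lambda>x. x $ k * f x * g x / h x)"
      by (intro smooth_on_divide smooth_on_mult smooth_on_nth f g h) (use h(3) in auto)
    then show "smooth_on ?Y (\<lambda>x. F (cinv c x))"
    proof (rule smooth_on_cong)
      fix x assume x: "x \<in> ?Y"
      have "cinv c x \<in> M \<longleftrightarrow> 0 < x $ k" using intr_iff[OF c, of "cinv c x"] cinv_in[OF c x] snd_cinv[OF c x] by simp
      moreover have "0 \<le> x $ k" using hopen_nonneg[OF hopen_cimg[OF c U] x] .
      ultimately show "x $ k * f x * g x / h x = F (cinv c x)"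
        by (auto simp: F_def f(2)[OF x] g(2)[OF x] h(2)[OF x])
    qed
  qed
  then show ?thesis
    unfolding fun_boundary_value_def by (intro exI[of _ F]) (auto simp: F_def intr_def)
qed

text \<open>The formula for mixed arguments, without the summand that vanishes on the boundary.\<close>

lemma boundary_value_tangential:
  assumes \<rho>: "defining_fun k A U \<rho>" and b: "second_deriv_ext k A D \<sigma> U \<rho> b"
    and \<xi>: "bdry_vfield k A U \<xi>" and \<eta>: "bdry_vfield k A U \<eta>"
  shows "dens_boundary_value k A 1 U
    (\<lambda>p. fscale (- diff_fun A \<rho> p (rho_conn A D \<rho> \<xi> \<eta> p)) (fscale (1 / \<rho> p) (\<sigma> p)))
    (\<lambda>p. b p (\<xi> p) (\<eta> p))"
proof -
  have U: "open U" using \<rho> by (simp add: defining_fun_def)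
  have v: "vfield A U \<xi>" using \<xi> by (simp add: bdry_vfield_def)
  let ?d = "\<lambda>p. diff_fun A \<rho> p (\<xi> p) * diff_fun A \<rho> p (\<eta> p) / \<rho> p"
  let ?f = "\<lambda>p. fscale (- diff_fun A \<rho> p (rho_conn A D \<rho> \<xi> \<eta> p)) (fscale (1 / \<rho> p) (\<sigma> p))"
  obtain s where s: "dens_section A 1 U s"
    "\<And>p. p \<in> U \<inter> M \<Longrightarrow> s p = fscale (?d p - diff_fun A \<rho> p (rho_conn A D \<rho> \<xi> \<eta> p)) (fscale (1 / \<rho> p) (\<sigma> p))"
    "\<And>p. p \<in> U \<inter> bdry k A \<Longrightarrow> s p = b p (\<xi> p) (\<eta> p)"
    using boundary_value_mixed[OF \<rho> b v \<eta>] unfolding dens_boundary_value_def by blast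
  obtain F where F: "smooth_fun A U F" "\<And>p. p \<in> U \<inter> M \<Longrightarrow> F p = ?d p" "\<And>p. p \<in> U \<inter> bdry k A \<Longrightarrow> F p = 0"
    using fun_boundary_value_zero[OF \<rho> \<xi> \<eta>] unfolding fun_boundary_value_def by blast
  define t where "t p = (if p \<in> M then ?f p else s p)" for p
  have "dens_section A 1 U t"
    unfolding dens_section_def
  proof (intro conjI ballI)
    show "t p \<in> dens_space A 1 p" if "p \<in> U" for p
      using s(1) that dens_scale[OF dens_scale[OF sigma_dens]] by (auto simp: t_def dens_section_def)
    show "smooth_comps A U t"
      unfolding smooth_comps_def
    proof
      fix c assume c: "c \<in> A"
      let ?Y = "cimg c U"
      obtain h where h: "smooth_on ?Y h" "\<And>x. x \<in> ?Y \<Longrightarrow> \<rho> (cinv c x) = x $ k * h x" "\<And>x. x \<in> ?Y \<Longrightarrow> h x \<noteq> 0"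
        using defining_fun_factor[OF \<rho> c] by blast
      obtain y where y: "smooth_on (snd c ` fst c) y"
          "\<And>x. x \<in> snd c ` fst c \<Longrightarrow> 0 < x $ k \<Longrightarrow> \<sigma> (cinv c x) c = x $ k * y x"
        using sigma_factor[OF c] by blast
      have yY: "smooth_on ?Y y" by (rule smooth_on_subset[OF y(1)]) auto
      have sY: "smooth_on ?Y (\<lambda>x. s (cinv c x) c)" using s(1) c by (simp add: dens_section_def smooth_comps_def)
      have "smooth_on ?Y (\<lambda>x. s (cinv c x) c - F (cinv c x) * y x / h x)"
        by (intro smooth_on_diff smooth_on_divide smooth_on_mult sY smooth_fun_chartD[OF F(1) c] yY h) (use h(3) in auto)
      then show "smooth_on ?Y (\<lambda>x. t (cinv c x) c)"
      proof (rule smooth_on_cong)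
        fix x assume x: "x \<in> ?Y"
        let ?q = "cinv c x"
        have q: "?q \<in> fst c" "?q \<in> U" "snd c ?q = x" using cinv_in[OF c x] snd_cinv[OF c x] by auto
        show "s ?q c - F ?q * y x / h x = t ?q c"
        proof (cases "0 < x $ k")
          case False
          then have "?q \<notin> M" using intr_iff[OF c q(1)] q by simp
          then show ?thesis using F(3)[of ?q] q by (simp add: t_def intr_def)
        next
          case True
          have qM: "?q \<in> U \<inter> M" using intr_iff[OF c q(1)] q True by simp
          have r: "1 / \<rho> ?q * \<sigma> ?q c = y x / h x"
            using y(2)[of x] h(2)[OF x] True q
            by (metis imageI mult_divide_mult_cancel_left less_irrefl mult_1 times_divide_eq_left)
          have "s ?q c = (?d ?q - diff_fun A \<rho> ?q (rho_conn A D \<rho> \<xi> \<eta> ?q)) * (y x / h x)"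
            unfolding s(2)[OF qM] r[symmetric] by simp
          moreover have "t ?q c = - diff_fun A \<rho> ?q (rho_conn A D \<rho> \<xi> \<eta> ?q) * (y x / h x)"
            unfolding r[symmetric] using qM by (simp add: t_def)
          ultimately show ?thesis unfolding F(2)[OF qM] by (simp add: left_diff_distrib diff_divide_distrib)
        qed
      qed
    qed
  qed
  then show ?thesis
    unfolding dens_boundary_value_def using s(3) by (intro exI[of _ t]) (auto simp: t_def intr_def)
qed

text \<open>The form \<open>\<Phi>\<close>.  Some chart around \<open>p\<close> provides a defining function; for a pair with a tangential member the
  choice is immaterial.\<close>

definition boundary_hessian :: "'m \<Rightarrow> ('m, 'n) tvec \<Rightarrow> ('m, 'n) tvec \<Rightarrow> ('m, 'n) dens" where
  "boundary_hessian p = (let c = (SOME c. c \<in> A \<and> p \<in> fst c) in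
    (SOME b. second_deriv_ext k A D \<sigma> (fst c) (\<lambda>p. snd c p $ k) b) p)"

lemma boundary_hessian_eq:
  assumes \<rho>: "defining_fun k A U \<rho>" "second_deriv_ext k A D \<sigma> U \<rho> b" "p \<in> U" and p: "p \<in> bdry k A"
    and uv: "u \<in> tangent_space A p" "v \<in> tangent_space A p"
      "u \<in> bdry_tangent_space k A p \<or> v \<in> bdry_tangent_space k A p"
  shows "b p u v = boundary_hessian p u v"
proof -
  define c where "c = (SOME c. c \<in> A \<and> p \<in> fst c)"
  have c: "c \<in> A" "p \<in> fst c"
    using someI_ex[of "\<lambda>c. c \<in> A \<and> p \<in> fst c"] chart_exists[of p] unfolding c_def by blast+
  define b' where "b' = (SOME b. second_deriv_ext k A D \<sigma> (fst c) (\<lambda>p. snd c p $ k) b)"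
  have d: "defining_fun k A (fst c) (\<lambda>p. snd c p $ k)" by (rule chart_coordinate_defining[OF c(1)])
  have "\<exists>b. second_deriv_ext k A D \<sigma> (fst c) (\<lambda>p. snd c p $ k) b"
    using second_deriv_ext_exists[OF d] by blast
  then have "second_deriv_ext k A D \<sigma> (fst c) (\<lambda>p. snd c p $ k) b'"
    unfolding b'_def by (rule someI_ex)
  from second_deriv_ext_unique[OF \<rho> d this c(2) p uv] show ?thesis
    unfolding boundary_hessian_def Let_def c_def[symmetric] b'_def[symmetric] .
qed

text \<open>Both properties are local, and near each boundary point the form is the restriction of the extended
  second derivative for the boundary coordinate of a chart.\<close>

lemma boundary_hessian_section:
  "bilin_section A 1 (bdry_tangent_space k A) (bdry k A) boundary_hessian"
  "symmetric_on (bdry_tangent_space k A) (bdry k A) boundary_hessian"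
proof -
  have ext: "\<exists>b. second_deriv_ext k A D \<sigma> (fst c) (\<lambda>p. snd c p $ k) b \<and> symmetric_on (tangent_space A) (fst c) b"
    if "c \<in> A" for c
    by (rule second_deriv_ext_exists[OF chart_coordinate_defining[OF that]])
  have local: "\<exists>b. bilin_on (tangent_space A p) (dens_space A 1 p) b \<and>
      (\<forall>u\<in>tangent_space A p. \<forall>v\<in>tangent_space A p. b u v = b v u) \<and>
      (\<forall>u\<in>tangent_space A p. \<forall>v\<in>tangent_space A p.
        u \<in> bdry_tangent_space k A p \<or> v \<in> bdry_tangent_space k A p \<longrightarrow> boundary_hessian p u v = b u v)"
    if p: "p \<in> bdry k A" for p
  proof -
    obtain c where c: "c \<in> A" "p \<in> fst c" using chart_exists by blast
    obtain b where b: "second_deriv_ext k A D \<sigma> (fst c) (\<lambda>p. snd c p $ k) b" "symmetric_on (tangent_space A) (fst c) b"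
      using ext[OF c(1)] by blast
    have "bilin_on (tangent_space A p) (dens_space A 1 p) (b p)"
      by (rule second_deriv_ext_bilin[OF b(1) c(2)])
    moreover have "\<forall>u\<in>tangent_space A p. \<forall>v\<in>tangent_space A p. b p u v = b p v u"
      using b(2) c(2) unfolding symmetric_on_def by blast
    ultimately show ?thesis
      using boundary_hessian_eq[OF chart_coordinate_defining[OF c(1)] b(1) c(2) p]
      by (intro exI[of _ "b p"]) simp
  qed
  have T: "u \<in> tangent_space A p" if "u \<in> bdry_tangent_space k A p" for u p
    using that by (simp add: bdry_tangent_space_def)
  have bil: "bilin_on (bdry_tangent_space k A p) (dens_space A 1 p) (boundary_hessian p)" if p: "p \<in> bdry k A" for p
  proof -
    obtain b where b: "bilin_on (tangent_space A p) (dens_space A 1 p) b"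
      "\<And>u v. u \<in> tangent_space A p \<Longrightarrow> v \<in> tangent_space A p \<Longrightarrow>
        u \<in> bdry_tangent_space k A p \<or> v \<in> bdry_tangent_space k A p \<Longrightarrow> boundary_hessian p u v = b u v"
      using local[OF p] by blast
    have bl: "u \<in> tangent_space A p \<Longrightarrow> v \<in> tangent_space A p \<Longrightarrow> b u v \<in> dens_space A 1 p"
      "u \<in> tangent_space A p \<Longrightarrow> u' \<in> tangent_space A p \<Longrightarrow> v \<in> tangent_space A p \<Longrightarrow> b (fadd u u') v = fadd (b u v) (b u' v)"
      "u \<in> tangent_space A p \<Longrightarrow> u' \<in> tangent_space A p \<Longrightarrow> v \<in> tangent_space A p \<Longrightarrow> b v (fadd u u') = fadd (b v u) (b v u')"
      "u \<in> tangent_space A p \<Longrightarrow> v \<in> tangent_space A p \<Longrightarrow> b (fscale a u) v = fscale a (b u v)"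
      "u \<in> tangent_space A p \<Longrightarrow> v \<in> tangent_space A p \<Longrightarrow> b u (fscale a v) = fscale a (b u v)" for u u' v a
      using b(1) unfolding bilin_on_def by blast+
    show ?thesis
      unfolding bilin_on_def
      by (intro conjI ballI allI) (simp_all add: b(2) bl T tangent_add tangent_scale)
  qed
  show "symmetric_on (bdry_tangent_space k A) (bdry k A) boundary_hessian"
    unfolding symmetric_on_def
  proof (intro ballI)
    fix p u v assume "p \<in> bdry k A" "u \<in> bdry_tangent_space k A p" "v \<in> bdry_tangent_space k A p"
    then show "boundary_hessian p u v = boundary_hessian p v u"
      using local[of p] T by metis
  qed
  show "bilin_section A 1 (bdry_tangent_space k A) (bdry k A) boundary_hessian"
    unfolding bilin_section_def
  proof (intro conjI ballI allI impI)
    show "bilin_on (bdry_tangent_space k A p) (dens_space A 1 p) (boundary_hessian p)" if "p \<in> bdry k A" for p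
      by (rule bil[OF that])
    fix V \<xi> \<eta>
    assume v: "vfield A (V \<inter> bdry k A) \<xi>" "vfield A (V \<inter> bdry k A) \<eta>"
      and t: "\<forall>p\<in>V \<inter> bdry k A. \<xi> p \<in> bdry_tangent_space k A p \<and> \<eta> p \<in> bdry_tangent_space k A p"
    have "smooth_on (cimg c (V \<inter> bdry k A)) (\<lambda>x. boundary_hessian (cinv c x) (\<xi> (cinv c x)) (\<eta> (cinv c x)) c)"
      if c: "c \<in> A" for c
    proof -
      let ?\<rho> = "\<lambda>p. snd c p $ k"
      have d: "defining_fun k A (fst c) ?\<rho>" by (rule chart_coordinate_defining[OF c])
      obtain b where b: "second_deriv_ext k A D \<sigma> (fst c) ?\<rho> b" using ext[OF c] by blast
      obtain \<beta> where \<beta>: "\<And>i j. smooth_on (cimg c (fst c)) (\<beta> i j)"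
        "\<And>i j x. x \<in> cimg c (fst c) \<Longrightarrow> 0 < x $ k \<Longrightarrow> \<beta> i j x = hess_coeff c ?\<rho> i j x"
        using hess_coeff_extends[OF c] d by meson
      have "smooth_on (cimg c (V \<inter> bdry k A)) (\<lambda>x. \<Sum>i\<in>UNIV. \<Sum>j\<in>UNIV. \<xi> (cinv c x) c $ i * \<eta> (cinv c x) c $ j * \<beta> i j x)"
        by (intro smooth_on_sum smooth_on_mult smooth_on_vec_nth vfield_chartD[OF v(1) c] vfield_chartD[OF v(2) c]
            smooth_on_subset[OF \<beta>(1)]) auto
      then show ?thesis
      proof (rule smooth_on_cong)
        fix x assume x: "x \<in> cimg c (V \<inter> bdry k A)"
        let ?q = "cinv c x"
        have q: "?q \<in> fst c" "?q \<in> V \<inter> bdry k A" "snd c ?q = x" using cinv_in[OF c x] snd_cinv[OF c x] by auto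
        have tq: "\<xi> ?q \<in> tangent_space A ?q" "\<eta> ?q \<in> tangent_space A ?q" using t q T by blast+
        have "boundary_hessian ?q (\<xi> ?q) (\<eta> ?q) = b ?q (\<xi> ?q) (\<eta> ?q)"
          using boundary_hessian_eq[OF d b q(1) _ tq] t q by simp
        then show "(\<Sum>i\<in>UNIV. \<Sum>j\<in>UNIV. \<xi> ?q c $ i * \<eta> ?q c $ j * \<beta> i j x) = boundary_hessian ?q (\<xi> ?q) (\<eta> ?q) c"
          using second_deriv_ext_chart[OF d b c \<beta> q(1,1) tq] q(3) by simp
      qed
    qed
    then show "dens_section A 1 (V \<inter> bdry k A) (\<lambda>p. boundary_hessian p (\<xi> p) (\<eta> p))"
      unfolding dens_section_def smooth_comps_def using bilin_on_value[OF bil] t by blast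
  qed
qed

lemma dens_boundary_value_cong:
  assumes "dens_boundary_value k A w U s b" "\<And>p. p \<in> U \<inter> bdry k A \<Longrightarrow> b p = b' p"
  shows "dens_boundary_value k A w U s b'"
  using assms unfolding dens_boundary_value_def by auto

end

theorem theorem2p5:
  fixes A :: "('m::{t2_space,second_countable_topology}, 'n::finite) chart set"
    and k :: 'n
    and D :: "('m, 'n) conn"
    and \<sigma> :: "'m \<Rightarrow> ('m, 'n) dens"
  assumes "smooth_atlas k A"
    and "linear_connection A (intr k A) D"
    and "torsion_free A (intr k A) D"
    and "special_connection A (intr k A) D"
    and "precompact k A D"
    and "parallel_dens A (intr k A) 1 D \<sigma>"
    and "nonvanishing (intr k A) \<sigma>"
  shows
    "(\<forall>U \<rho>. defining_fun k A U \<rho> \<longrightarrow>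
        (\<exists>b. second_deriv_ext k A D \<sigma> U \<rho> b \<and> symmetric_on (tangent_space A) (U \<inter> intr k A) b)) \<and>
     (\<exists>\<Phi>.
        (\<forall>U \<rho> \<Phi>\<rho>. defining_fun k A U \<rho> \<longrightarrow> second_deriv_ext k A D \<sigma> U \<rho> \<Phi>\<rho> \<longrightarrow>
           (\<forall>p\<in>U \<inter> bdry k A. \<forall>u\<in>tangent_space A p. \<forall>v\<in>tangent_space A p.
              u \<in> bdry_tangent_space k A p \<or> v \<in> bdry_tangent_space k A p \<longrightarrow>
              \<Phi>\<rho> p u v = \<Phi> p u v)) \<and>
        (\<forall>U \<rho> \<xi> \<eta>. defining_fun k A U \<rho> \<longrightarrow> vfield A UNIV \<xi> \<longrightarrow> bdry_vfield k A UNIV \<eta> \<longrightarrow>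
           dens_boundary_value k A 1 U
             (\<lambda>p. fscale (diff_fun A \<rho> p (\<xi> p) * diff_fun A \<rho> p (\<eta> p) / \<rho> p
                            - diff_fun A \<rho> p (rho_conn A D \<rho> \<xi> \<eta> p))
                         (fscale (1 / \<rho> p) (\<sigma> p)))
             (\<lambda>p. \<Phi> p (\<xi> p) (\<eta> p))) \<and>
        (\<forall>U \<rho> \<xi> \<eta>. defining_fun k A U \<rho> \<longrightarrow> bdry_vfield k A UNIV \<xi> \<longrightarrow> bdry_vfield k A UNIV \<eta> \<longrightarrow>
           fun_boundary_value k A U
             (\<lambda>p. diff_fun A \<rho> p (\<xi> p) * diff_fun A \<rho> p (\<eta> p) / \<rho> p) (\<lambda>p. 0) \<and>
           dens_boundary_value k A 1 U
             (\<lambda>p. fscale (- diff_fun A \<rho> p (rho_conn A D \<rho> \<xi> \<eta> p)) (fscale (1 / \<rho> p) (\<sigma> p)))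
             (\<lambda>p. \<Phi> p (\<xi> p) (\<eta> p))) \<and>
        bilin_section A 1 (bdry_tangent_space k A) (bdry k A) \<Phi> \<and>
        symmetric_on (bdry_tangent_space k A) (bdry k A) \<Phi>)"
proof -
  interpret precompact_manifold k A D \<sigma>
    using assms by unfold_locales auto
  have sub: "vfield A U \<xi>" if "vfield A UNIV \<xi>" for U \<xi> by (rule vfield_subset[OF that]) simp
  have bsub: "bdry_vfield k A U \<xi>" if "bdry_vfield k A UNIV \<xi>" for U \<xi>
    using that sub unfolding bdry_vfield_def by blast
  have bT: "\<xi> p \<in> bdry_tangent_space k A p" if "bdry_vfield k A UNIV \<xi>" "p \<in> bdry k A" for \<xi> p
    using that unfolding bdry_vfield_def by blast
  have tT: "\<xi> p \<in> tangent_space A p" if "vfield A UNIV \<xi>" for \<xi> p by (rule vfield_tangent[OF that]) simp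
  have bv: "vfield A UNIV \<xi>" if "bdry_vfield k A UNIV \<xi>" for \<xi> using that by (simp add: bdry_vfield_def)
  show ?thesis
  proof (intro conjI exI[of _ boundary_hessian];
      (intro allI impI ballI conjI boundary_hessian_section)?)
    fix U \<rho> assume \<rho>: "defining_fun k A U \<rho>"
    then obtain b where "second_deriv_ext k A D \<sigma> U \<rho> b" "symmetric_on (tangent_space A) U b"
      using second_deriv_ext_exists by blast
    then show "\<exists>b. second_deriv_ext k A D \<sigma> U \<rho> b \<and> symmetric_on (tangent_space A) (U \<inter> intr k A) b"
      unfolding symmetric_on_def by blast
  next
    fix U \<rho> b p u v
    assume "defining_fun k A U \<rho>" "second_deriv_ext k A D \<sigma> U \<rho> b" "p \<in> U \<inter> bdry k A"
      "u \<in> tangent_space A p" "v \<in> tangent_space A p"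
      "u \<in> bdry_tangent_space k A p \<or> v \<in> bdry_tangent_space k A p"
    then show "b p u v = boundary_hessian p u v" by (intro boundary_hessian_eq) auto
  next
    fix U \<rho> \<xi> \<eta>
    assume \<rho>: "defining_fun k A U \<rho>" and \<xi>: "vfield A UNIV \<xi>" and \<eta>: "bdry_vfield k A UNIV \<eta>"
    obtain b where b: "second_deriv_ext k A D \<sigma> U \<rho> b" using second_deriv_ext_exists[OF \<rho>] by blast
    show "dens_boundary_value k A 1 U
             (\<lambda>p. fscale (diff_fun A \<rho> p (\<xi> p) * diff_fun A \<rho> p (\<eta> p) / \<rho> p
                            - diff_fun A \<rho> p (rho_conn A D \<rho> \<xi> \<eta> p))
                         (fscale (1 / \<rho> p) (\<sigma> p)))
             (\<lambda>p. boundary_hessian p (\<xi> p) (\<eta> p))"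
      by (rule dens_boundary_value_cong[OF boundary_value_mixed[OF \<rho> b sub[OF \<xi>] bsub[OF \<eta>]]])
         (use boundary_hessian_eq[OF \<rho> b _ _ tT[OF \<xi>] tT[OF bv[OF \<eta>]]] bT[OF \<eta>] in auto)
  next
    fix U \<rho> \<xi> \<eta>
    assume \<rho>: "defining_fun k A U \<rho>" and \<xi>: "bdry_vfield k A UNIV \<xi>" and \<eta>: "bdry_vfield k A UNIV \<eta>"
    show "fun_boundary_value k A U (\<lambda>p. diff_fun A \<rho> p (\<xi> p) * diff_fun A \<rho> p (\<eta> p) / \<rho> p) (\<lambda>p. 0)"
      by (rule fun_boundary_value_zero[OF \<rho> bsub[OF \<xi>] bsub[OF \<eta>]])
    obtain b where b: "second_deriv_ext k A D \<sigma> U \<rho> b" using second_deriv_ext_exists[OF \<rho>] by blast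
    show "dens_boundary_value k A 1 U
             (\<lambda>p. fscale (- diff_fun A \<rho> p (rho_conn A D \<rho> \<xi> \<eta> p)) (fscale (1 / \<rho> p) (\<sigma> p)))
             (\<lambda>p. boundary_hessian p (\<xi> p) (\<eta> p))"
      by (rule dens_boundary_value_cong[OF boundary_value_tangential[OF \<rho> b bsub[OF \<xi>] bsub[OF \<eta>]]])
         (use boundary_hessian_eq[OF \<rho> b _ _ tT[OF bv[OF \<xi>]] tT[OF bv[OF \<eta>]]] bT[OF \<eta>] in auto)
  qed
qed

end
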